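(* Let $G=\langle a,b\mid a^2=b^3\rangle$, let $\overline G=\langle\alpha,\beta\mid\alpha^2=\beta^3=e\rangle$, and let $q:G\to\overline G$ be the surjective homomorphism with $q(a)=\alpha$, $q(b)=\beta$. Then the map $q_*:LO(G)\to CO(\overline G)$ induced by $q$ is a homeomorphism.
   Context: $LO(G)$ is the set of left orders of $G$ (total orders $<_\lambda$ with $f<_\lambda g\Rightarrow hf<_\lambda hg$), viewed as maps $\lambda:G\setminus\{e\}\to\{\pm1\}$ ($\lambda(g)=1$ iff $g>_\lambda e$), with the topology of pointwise convergence. A left invariant circular order of $\overline G$ is a map $c:\overline G^3\to\{0,1,-1\}$ such that (1) $c(g_1,g_2,g_3)=0$ iff $g_i=g_j$ for some $i\neq j$; (2) $c(g_2,g_3,g_4)-c(g_1,g_3,g_4)+c(g_1,g_2,g_4)-c(g_1,g_2,g_3)=0$; (3) $c(g_4g_1,g_4g_2,g_4g_3)=c(g_1,g_2,g_3)$, for all $g_i\in\overline G$. $CO(\overline G)$ is the set of all of these, with the topology of pointwise convergence. A homomorphism $\rho:G\to\mathrm{Homeo}_+(\mathbb{R})$ is tight at $x_0\in\mathbb{R}$ if (1) the stabilizer of $x_0$ is trivial, (2) $\inf\rho(G)x_0=-\infty$, $\sup\rho(G)x_0=\infty$, and (3) whenever $a<b$ and $\overline{\rho(G)x_0}\cap[a,b]=\{a,b\}$, then $\{a,b\}\subset\rho(G)x_0$. The map $q_*$: put $t=a^2=b^3\in G$; this is central and generates $\ker q$. Let $\tau$ be the translation of $\mathbb{R}$ by $1$,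 $p:\mathbb{R}\to S^1=\mathbb{R}/\langle\tau\rangle$ the projection, $\mathrm{Homeo}_{\mathbb{Z}}(\mathbb{R})$ the group of homeomorphisms of $\mathbb{R}$ commuting with $\tau$, and $\pi:\mathrm{Homeo}_{\mathbb{Z}}(\mathbb{R})\to\mathrm{Homeo}_+(S^1)$ the canonical projection. Fix $x_0\in\mathbb{R}$ and let $y_0=p(x_0)$. Given $\lambda\in LO(G)$, there is a homomorphism $\rho:G\to\mathrm{Homeo}_{\mathbb{Z}}(\mathbb{R})$, unique up to orientation and base point preserving topological conjugacy, which is tight at $x_0$, satisfies $\rho(t)=\tau$ if $t>_\lambda e$ and $\rho(t)=\tau^{-1}$ if $t<_\lambda e$, and satisfies $f<_\lambda g\Leftrightarrow\rho(f)x_0<\rho(g)x_0$ (a representative of the dynamical realization of $\lambda$). Define $q_*\rho:\overline G\to\mathrm{Homeo}_+(S^1)$ by $(q_*\rho)(\overline g)=\pi(\rho(g))$ for any $g\in G$ with $q(g)=\overline g$; it acts freely at $y_0$. Then $q_*(\lambda)\in CO(\overline G)$ is the circular order of the orbit of $y_0$: for distinct $\overline g_1,\overline g_2,\overline g_3$, $q_*(\lambda)(\overline g_1,\overline g_2,\overline g_3)=1$ if the points $(q_*\rho)(\overline g_1)y_0,(q_*\rho)(\overline g_2)y_0,(q_*\rho)(\overline g_3)y_0$ are in this order positioned anticlockwise (the positive direction of $\mathbb{R}/\mathbb{Z}$), and $-1$ if clockwise. *)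

theory Defs
  imports "HOL-Analysis.Analysis" "HOL-Algebra.Group_Action"
begin

section \<open>Groups given by generators and relations\<close>

text \<open>The letter \<open>(x, True)\<close> stands for the generator \<open>x\<close>, the letter \<open>(x, False)\<close> for
  its inverse.  A relation \<open>u = v\<close> is a pair of words.\<close>

type_synonym 'g gword = "('g \<times> bool) list"

inductive word_eq :: "('g gword \<times> 'g gword) set \<Rightarrow> 'g gword \<Rightarrow> 'g gword \<Rightarrow> bool"
  for R :: "('g gword \<times> 'g gword) set" where
  word_eq_rel: "(u, v) \<in> R \<Longrightarrow> word_eq R u v"
| word_eq_cancel: "word_eq R [(x, s), (x, \<not> s)] []"
| word_eq_append: "word_eq R u u' \<Longrightarrow> word_eq R v v' \<Longrightarrow> word_eq R (u @ v) (u' @ v')"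
| word_eq_refl: "word_eq R u u"
| word_eq_sym: "word_eq R u v \<Longrightarrow> word_eq R v u"
| word_eq_trans: "word_eq R u v \<Longrightarrow> word_eq R v w \<Longrightarrow> word_eq R u w"

definition word_class :: "('g gword \<times> 'g gword) set \<Rightarrow> 'g gword \<Rightarrow> 'g gword set" where
  "word_class R u = {v. word_eq R u v}"

definition presented_group :: "('g gword \<times> 'g gword) set \<Rightarrow> 'g gword set monoid" where
  "presented_group R =
     \<lparr>carrier = range (word_class R),
      mult = (\<lambda>X Y. \<Union>u\<in>X. \<Union>v\<in>Y. word_class R (u @ v)),
      one = word_class R []\<rparr>"

definition gen_class :: "('g gword \<times> 'g gword) set \<Rightarrow> 'g \<Rightarrow> 'g gword set" where
  "gen_class R x = word_class R [(x, True)]"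

lemma word_class_eq_iff: "word_class R u = word_class R v \<longleftrightarrow> word_eq R u v"
  unfolding word_class_def using word_eq_refl word_eq_sym word_eq_trans by blast

lemma presented_group_mult:
  "word_class R u \<otimes>\<^bsub>presented_group R\<^esub> word_class R v = word_class R (u @ v)"
proof -
  have "word_class R (u' @ v') = word_class R (u @ v)"
    if "u' \<in> word_class R u" "v' \<in> word_class R v" for u' v'
    using that unfolding word_class_eq_iff
    by (simp add: word_class_def word_eq_append word_eq_sym)
  moreover have "u \<in> word_class R u" "v \<in> word_class R v"
    by (simp_all add: word_class_def word_eq_refl)
  ultimately have "(\<Union>u'\<in>word_class R u. \<Union>v'\<in>word_class R v. word_class R (u' @ v')) = word_class R (u @ v)"
    by blast
  thus ?thesis
    by (simp add: presented_group_def)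
qed

lemma presented_group_carrier: "carrier (presented_group R) = range (word_class R)"
  by (simp add: presented_group_def)

lemma presented_group_one: "\<one>\<^bsub>presented_group R\<^esub> = word_class R []"
  by (simp add: presented_group_def)

lemma word_eq_inverse: "word_eq R (rev (map (\<lambda>(x, s). (x, \<not> s)) u) @ u) []"
proof (induction u)
  case Nil
  show ?case by (simp add: word_eq_refl)
next
  case (Cons l u)
  obtain x s where l: "l = (x, s)" by force
  let ?w = "rev (map (\<lambda>(x, s). (x, \<not> s)) u)"
  have "word_eq R [(x, \<not> s), (x, s)] []"
    using word_eq_cancel[of R x "\<not> s"] by simp
  hence "word_eq R (?w @ ([(x, \<not> s), (x, s)] @ u)) (?w @ ([] @ u))"
    by (intro word_eq_append word_eq_refl)
  from word_eq_trans[OF this[simplified] Cons.IH[simplified]] show ?case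
    by (simp add: l)
qed

lemma presented_group_group: "group (presented_group R)"
proof (rule groupI)
  fix X assume "X \<in> carrier (presented_group R)"
  then obtain u where "X = word_class R u" by (auto simp: presented_group_carrier)
  moreover have "word_class R (rev (map (\<lambda>(x, s). (x, \<not> s)) u)) \<otimes>\<^bsub>presented_group R\<^esub> word_class R u
      = \<one>\<^bsub>presented_group R\<^esub>"
    unfolding presented_group_mult presented_group_one word_class_eq_iff
    by (rule word_eq_inverse)
  ultimately show "\<exists>Y\<in>carrier (presented_group R). Y \<otimes>\<^bsub>presented_group R\<^esub> X = \<one>\<^bsub>presented_group R\<^esub>"
    by (auto simp: presented_group_carrier)
qed (auto simp: presented_group_carrier presented_group_mult presented_group_one)

datatype two_gens = Gen1 | Gen2

definition trefoil_rels :: "(two_gens gword \<times> two_gens gword) set" where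
  "trefoil_rels = {(replicate 2 (Gen1, True), replicate 3 (Gen2, True))}"

definition modular_rels :: "(two_gens gword \<times> two_gens gword) set" where
  "modular_rels = {(replicate 2 (Gen1, True), []), (replicate 3 (Gen2, True), [])}"

definition trefoil_group :: "two_gens gword set monoid" where
  "trefoil_group = presented_group trefoil_rels"

definition modular_group :: "two_gens gword set monoid" where
  "modular_group = presented_group modular_rels"

definition trefoil_a :: "two_gens gword set" where "trefoil_a = gen_class trefoil_rels Gen1"
definition trefoil_b :: "two_gens gword set" where "trefoil_b = gen_class trefoil_rels Gen2"
definition modular_\<alpha> :: "two_gens gword set" where "modular_\<alpha> = gen_class modular_rels Gen1"
definition modular_\<beta> :: "two_gens gword set" where "modular_\<beta> = gen_class modular_rels Gen2"

lemma trefoil_word_eq_modular: "word_eq trefoil_rels u v \<Longrightarrow> word_eq modular_rels u v"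
proof (induction rule: word_eq.induct)
  case (word_eq_rel u v)
  have "word_eq modular_rels (replicate 2 (Gen1, True)) []"
       "word_eq modular_rels (replicate 3 (Gen2, True)) []"
    by (auto simp: modular_rels_def intro: word_eq.word_eq_rel)
  moreover have "u = replicate 2 (Gen1, True)" "v = replicate 3 (Gen2, True)"
    using word_eq_rel by (simp_all add: trefoil_rels_def)
  ultimately show ?case
    using word_eq.word_eq_sym word_eq.word_eq_trans by blast
next
  case (word_eq_trans u v w)
  show ?case using word_eq_trans.IH by (rule word_eq.word_eq_trans)
next
  case (word_eq_sym u v)
  show ?case using word_eq_sym.IH by (rule word_eq.word_eq_sym)
qed (simp_all add: word_eq.word_eq_cancel word_eq.word_eq_append word_eq.word_eq_refl)

lemma trefoil_to_modular_exists:
  "\<exists>q \<in> epi trefoil_group modular_group. q trefoil_a = modular_\<alpha> \<and> q trefoil_b = modular_\<beta>"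
proof -
  define q where "q X = (\<Union>u\<in>X. word_class modular_rels u)" for X
  have q: "q (word_class trefoil_rels u) = word_class modular_rels u" for u
  proof -
    have "word_class modular_rels v = word_class modular_rels u"
      if "v \<in> word_class trefoil_rels u" for v
      using that unfolding word_class_eq_iff
      by (simp add: word_class_def word_eq_sym trefoil_word_eq_modular)
    moreover have "u \<in> word_class trefoil_rels u"
      by (simp add: word_class_def word_eq_refl)
    ultimately show ?thesis unfolding q_def by blast
  qed
  have "q \<in> epi trefoil_group modular_group"
    unfolding epi_def hom_def trefoil_group_def modular_group_def
    by (auto simp: presented_group_carrier presented_group_mult q image_image)
  thus ?thesis
    by (intro bexI[of _ q])
      (auto simp: q trefoil_a_def trefoil_b_def modular_\<alpha>_def modular_\<beta>_def gen_class_def)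
qed


section \<open>The space of left orders\<close>

definition left_order :: "('a, 'm) monoid_scheme \<Rightarrow> 'a rel \<Rightarrow> bool" where
  "left_order G r \<longleftrightarrow>
     r \<subseteq> carrier G \<times> carrier G \<and> strict_linear_order_on (carrier G) r \<and>
     (\<forall>f\<in>carrier G. \<forall>g\<in>carrier G. \<forall>h\<in>carrier G.
        (f, g) \<in> r \<longrightarrow> (h \<otimes>\<^bsub>G\<^esub> f, h \<otimes>\<^bsub>G\<^esub> g) \<in> r)"

definition order_sign :: "('a, 'm) monoid_scheme \<Rightarrow> 'a rel \<Rightarrow> 'a \<Rightarrow> int" where
  "order_sign G r = (\<lambda>g\<in>carrier G - {\<one>\<^bsub>G\<^esub>}. if (\<one>\<^bsub>G\<^esub>, g) \<in> r then 1 else -1)"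

definition LO :: "('a, 'm) monoid_scheme \<Rightarrow> ('a \<Rightarrow> int) set" where
  "LO G = order_sign G ` {r. left_order G r}"

definition LO_topology :: "('a, 'm) monoid_scheme \<Rightarrow> ('a \<Rightarrow> int) topology" where
  "LO_topology G =
     subtopology (product_topology (\<lambda>_. discrete_topology {1, -1}) (carrier G - {\<one>\<^bsub>G\<^esub>})) (LO G)"

text \<open>The order relation \<open>f < g\<close> belonging to the sign function \<open>\<lambda>\<close>; see
  \<open>order_less_order_sign\<close>.\<close>

definition order_less :: "('a, 'm) monoid_scheme \<Rightarrow> ('a \<Rightarrow> int) \<Rightarrow> 'a \<Rightarrow> 'a \<Rightarrow> bool" where
  "order_less G l f g \<longleftrightarrow> f \<noteq> g \<and> l (inv\<^bsub>G\<^esub> f \<otimes>\<^bsub>G\<^esub> g) = 1"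

lemma order_less_order_sign:
  assumes "group G" "left_order G r" "f \<in> carrier G" "g \<in> carrier G"
  shows "order_less G (order_sign G r) f g \<longleftrightarrow> (f, g) \<in> r"
proof (cases "f = g")
  case True
  thus ?thesis
    using assms by (auto simp: order_less_def left_order_def strict_linear_order_on_def irrefl_def)
next
  case False
  interpret group G by fact
  let ?h = "inv\<^bsub>G\<^esub> f \<otimes>\<^bsub>G\<^esub> g"
  have h: "?h \<in> carrier G" "f \<otimes>\<^bsub>G\<^esub> ?h = g"
    using assms by (simp_all add: m_assoc[symmetric])
  have "?h \<noteq> \<one>\<^bsub>G\<^esub>"
    using h False assms by force
  hence "order_less G (order_sign G r) f g \<longleftrightarrow> (\<one>\<^bsub>G\<^esub>, ?h) \<in> r"
    using h False by (simp add: order_less_def order_sign_def)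
  also have "\<dots> \<longleftrightarrow> (f, g) \<in> r"
  proof
    assume "(\<one>\<^bsub>G\<^esub>, ?h) \<in> r"
    hence "(f \<otimes>\<^bsub>G\<^esub> \<one>\<^bsub>G\<^esub>, f \<otimes>\<^bsub>G\<^esub> ?h) \<in> r"
      using assms h unfolding left_order_def by blast
    thus "(f, g) \<in> r" using assms h by simp
  next
    assume "(f, g) \<in> r"
    hence "(inv\<^bsub>G\<^esub> f \<otimes>\<^bsub>G\<^esub> f, ?h) \<in> r"
      using assms inv_closed unfolding left_order_def by blast
    thus "(\<one>\<^bsub>G\<^esub>, ?h) \<in> r" using assms by simp
  qed
  finally show ?thesis .
qed


section \<open>The space of left invariant circular orders\<close>

definition CO :: "('a, 'm) monoid_scheme \<Rightarrow> ('a \<times> 'a \<times> 'a \<Rightarrow> int) set" where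
  "CO G = {c \<in> carrier G \<times> carrier G \<times> carrier G \<rightarrow>\<^sub>E {0, 1, -1}.
     (\<forall>g1\<in>carrier G. \<forall>g2\<in>carrier G. \<forall>g3\<in>carrier G.
        c (g1, g2, g3) = 0 \<longleftrightarrow> g1 = g2 \<or> g2 = g3 \<or> g1 = g3) \<and>
     (\<forall>g1\<in>carrier G. \<forall>g2\<in>carrier G. \<forall>g3\<in>carrier G. \<forall>g4\<in>carrier G.
        c (g2, g3, g4) - c (g1, g3, g4) + c (g1, g2, g4) - c (g1, g2, g3) = 0) \<and>
     (\<forall>g1\<in>carrier G. \<forall>g2\<in>carrier G. \<forall>g3\<in>carrier G. \<forall>g4\<in>carrier G.
        c (g4 \<otimes>\<^bsub>G\<^esub> g1, g4 \<otimes>\<^bsub>G\<^esub> g2, g4 \<otimes>\<^bsub>G\<^esub> g3) = c (g1, g2, g3))}"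

definition CO_topology :: "('a, 'm) monoid_scheme \<Rightarrow> ('a \<times> 'a \<times> 'a \<Rightarrow> int) topology" where
  "CO_topology G =
     subtopology (product_topology (\<lambda>_. discrete_topology {0, 1, -1})
       (carrier G \<times> carrier G \<times> carrier G)) (CO G)"


section \<open>Tight actions on the line and dynamical realizations\<close>

definition shift :: "real \<Rightarrow> real" where
  "shift x = x + 1"

definition shift_inv :: "real \<Rightarrow> real" where
  "shift_inv x = x - 1"

definition Homeo_Z :: "(real \<Rightarrow> real) monoid" where
  "Homeo_Z =
     \<lparr>carrier = {f. (\<exists>g. homeomorphism UNIV UNIV f g) \<and> f \<circ> shift = shift \<circ> f},
      mult = (\<circ>),
      one = id\<rparr>"

definition tight :: "('a, 'm) monoid_scheme \<Rightarrow> ('a \<Rightarrow> real \<Rightarrow> real) \<Rightarrow> real \<Rightarrow> bool" where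
  "tight G \<rho> x0 \<longleftrightarrow>
     stabilizer G \<rho> x0 = {\<one>\<^bsub>G\<^esub>} \<and>
     \<not> bdd_below (orbit G \<rho> x0) \<and> \<not> bdd_above (orbit G \<rho> x0) \<and>
     (\<forall>a b. a < b \<longrightarrow> closure (orbit G \<rho> x0) \<inter> {a..b} = {a, b} \<longrightarrow> {a, b} \<subseteq> orbit G \<rho> x0)"

text \<open>Here \<open>t\<close> is the central element of \<open>G\<close> that has to act as a unit translation.\<close>

definition dynamical_realization ::
  "('a, 'm) monoid_scheme \<Rightarrow> 'a \<Rightarrow> real \<Rightarrow> ('a \<Rightarrow> int) \<Rightarrow> ('a \<Rightarrow> real \<Rightarrow> real) \<Rightarrow> bool" where
  "dynamical_realization G t x0 l \<rho> \<longleftrightarrow>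
     \<rho> \<in> hom G Homeo_Z \<and>
     tight G \<rho> x0 \<and>
     (order_less G l \<one>\<^bsub>G\<^esub> t \<longrightarrow> \<rho> t = shift) \<and>
     (order_less G l t \<one>\<^bsub>G\<^esub> \<longrightarrow> \<rho> t = shift_inv) \<and>
     (\<forall>f\<in>carrier G. \<forall>g\<in>carrier G. order_less G l f g \<longleftrightarrow> \<rho> f x0 < \<rho> g x0)"


section \<open>The circle and the induced circular order\<close>

text \<open>The circle is \<open>range circle_proj\<close>, its points being the cosets \<open>x + \<int>\<close>.  An element \<open>f\<close> of
  \<^const>\<open>Homeo_Z\<close> maps cosets onto cosets, so the induced map on the circle is the image map.\<close>

definition circle_proj :: "real \<Rightarrow> real set" where
  "circle_proj x = range (\<lambda>n::int. x + of_int n)"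

definition circle_induced :: "(real \<Rightarrow> real) \<Rightarrow> real set \<Rightarrow> real set" where
  "circle_induced f y = f ` y"

lemma circle_induced_circle_proj:
  assumes "f \<in> carrier Homeo_Z"
  shows "circle_induced f (circle_proj x) = circle_proj (f x)"
proof -
  have c: "f (y + 1) = f y + 1" for y
    using assms by (auto simp: Homeo_Z_def shift_def fun_eq_iff)
  have nat: "f (y + of_nat n) = f y + of_nat n" for y n
    by (induction n) (auto simp: c add.assoc[symmetric] add.commute[of 1])
  have "f (x + of_int n) = f x + of_int n" for n
  proof (cases "0 \<le> n")
    case True
    thus ?thesis using nat[of x "nat n"] by simp
  next
    case False
    thus ?thesis using nat[of "x + of_int n" "nat (- n)"] by simp
  qed
  thus ?thesis
    by (simp add: circle_induced_def circle_proj_def image_image)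
qed

definition anticlockwise :: "real set \<Rightarrow> real set \<Rightarrow> real set \<Rightarrow> bool" where
  "anticlockwise y1 y2 y3 \<longleftrightarrow>
     (\<exists>x1 x2 x3. y1 = circle_proj x1 \<and> y2 = circle_proj x2 \<and> y3 = circle_proj x3 \<and>
        x1 < x2 \<and> x2 < x3 \<and> x3 < x1 + 1)"

definition circle_orientation :: "real set \<Rightarrow> real set \<Rightarrow> real set \<Rightarrow> int" where
  "circle_orientation y1 y2 y3 =
     (if anticlockwise y1 y2 y3 then 1 else if anticlockwise y3 y2 y1 then -1 else 0)"

text \<open>The choice of the preimage under \<open>q\<close> is immaterial when the kernel of \<open>q\<close> is
  generated by \<open>t\<close> and \<open>\<rho> t\<close> is a unit translation.\<close>

definition pushforward_action ::
  "('a, 'm) monoid_scheme \<Rightarrow> ('a \<Rightarrow> 'b) \<Rightarrow> ('a \<Rightarrow> real \<Rightarrow> real) \<Rightarrow> 'b \<Rightarrow> real set \<Rightarrow> real set" where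
  "pushforward_action G q \<rho> h = circle_induced (\<rho> (SOME g. g \<in> carrier G \<and> q g = h))"

text \<open>If two of the three group elements agree, the value is \<open>0\<close>, because
  \<^const>\<open>anticlockwise\<close> forces its arguments to be distinct.  The result does not depend on
  which realization \<open>\<rho>\<close> is chosen, realizations being unique up to conjugacy.\<close>

definition induced_circular_order ::
  "('a, 'm) monoid_scheme \<Rightarrow> ('b, 'n) monoid_scheme \<Rightarrow> ('a \<Rightarrow> 'b) \<Rightarrow> 'a \<Rightarrow> real \<Rightarrow>
     ('a \<Rightarrow> int) \<Rightarrow> 'b \<times> 'b \<times> 'b \<Rightarrow> int" where
  "induced_circular_order G H q t x0 l =
     (let \<rho> = (SOME \<rho>. dynamical_realization G t x0 l \<rho>);
          y = (\<lambda>h. pushforward_action G q \<rho> h (circle_proj x0))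
      in (\<lambda>(h1, h2, h3) \<in> carrier H \<times> carrier H \<times> carrier H.
            circle_orientation (y h1) (y h2) (y h3)))"

end

theory Submission
  imports Defs "HOL-Algebra.Elementary_Groups"
begin

text \<open>
The map \<open>q\<^sub>*\<close> is a homeomorphism because a circular order of the modular group lifts to the trefoil
group in exactly one way, and because this lift can be read off from finitely many values of the circular
order at a time.

The carrier of the argument is an integer valued function \<open>M\<close> on the trefoil group, the height.  On the
one hand, a realization \<open>\<rho>\<close> of a left order yields \<open>M x = \<lfloor>d\<rfloor> + \<lceil>d\<rceil>\<close> with \<open>d = \<rho> x x0 - x0\<close>.
The orientation of three points of the circle is a sum of such terms over the sides of a lifted triangle
(\<open>circle_orientation_signed_turns\<close>), which gives
\<open>M (x y) = M x + M y - c (e, q x, q (x y))\<close> for the circular order \<open>c\<close> of the orbit, and the left order is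
the sign of \<open>M\<close>.  On the other hand, \<open>M\<close> is determined by \<open>c\<close>: the values at \<open>a\<close> and \<open>b\<close> have to
be \<open>c (e, \<beta>, \<beta>\<^sup>2)\<close> (\<open>orbit_order_height\<close>), and the formula computes the rest
(\<open>is_height_unique\<close>).

For an arbitrary circular order \<open>c\<close>, the central extension of the modular group by the integers with
cocycle \<open>- c (e, g, g h)\<close> admits a lift of \<open>q\<close> with these values at the generators; its integer
component is the height of \<open>c\<close> (\<open>height_exists\<close>).  Its sign is a left order
(\<open>left_order_height_order\<close>).  This defines a map \<open>order_of_circular\<close> from circular orders to left orders.
It is injective because the sign of a height determines the height (\<open>height_le_if_same_sign\<close>) and the
height determines \<open>c\<close> (\<open>c_from_M\<close>).  It is a left inverse of \<open>q\<^sub>*\<close> by the first paragraph, so it is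
surjective and \<open>q\<^sub>*\<close> is its inverse.  Each of its values depends on finitely many values of \<open>c\<close>
(\<open>height_local\<close>), so it is a continuous bijection from a compact space onto a Hausdorff space.

Since \<open>q\<^sub>*\<close> is defined by a choice of a realization, all this requires that realizations exist
(\<open>realization_exists\<close>).  Here \<open>t\<close> is cofinal in every left order, being a power of both generators.  The
ordered group is enlarged to a dense order by filling the jumps with copies of the rationals; midpoint
insertion embeds a fundamental domain of \<open>t\<close> densely into an interval; and left multiplications
extend to the line by monotonicity.
\<close>

section \<open>Dense embeddings of countable dense orders\<close>

text \<open>Points are placed one after another, each of them in the middle of the gap between its nearest
neighbours among the points placed before; \<open>0\<close> and \<open>1\<close> act as neighbours that are
always present.\<close>
function midpoint_embedding :: "(nat \<Rightarrow> nat \<Rightarrow> bool) \<Rightarrow> nat \<Rightarrow> real" where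
  "midpoint_embedding lt n =
     (Max (insert 0 (midpoint_embedding lt ` {i\<in>{..<n}. lt i n})) +
      Min (insert 1 (midpoint_embedding lt ` {i\<in>{..<n}. lt n i}))) / 2"
  by auto
termination by (relation "inv_image less_than snd") auto

declare midpoint_embedding.simps [simp del]

locale dense_order_nat =
  fixes lt :: "nat \<Rightarrow> nat \<Rightarrow> bool"
  assumes lt_irrefl: "\<not> lt i i"
    and lt_trans: "lt i j \<Longrightarrow> lt j k \<Longrightarrow> lt i k"
    and lt_total: "i \<noteq> j \<Longrightarrow> lt i j \<or> lt j i"
    and lt_dense: "lt i j \<Longrightarrow> \<exists>k. lt i k \<and> lt k j"
    and lt_no_min: "\<exists>k. lt k i"
    and lt_no_max: "\<exists>k. lt i k"
begin

abbreviation mid :: "nat \<Rightarrow> real" where "mid \<equiv> midpoint_embedding lt"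

lemma mid_strict_mono_upto:
  "\<forall>i<n. 0 < mid i \<and> mid i < 1 \<and> (\<forall>j<n. lt i j \<longrightarrow> mid i < mid j)"
proof (induction n)
  case (Suc n)
  define A where "A = insert 0 (mid ` {i\<in>{..<n}. lt i n})"
  define B where "B = insert 1 (mid ` {i\<in>{..<n}. lt n i})"
  have fin: "finite A" "finite B" "A \<noteq> {}" "B \<noteq> {}" by (auto simp: A_def B_def)
  have AB: "x < y" if "x \<in> A" "y \<in> B" for x y
    using that Suc.IH lt_trans unfolding A_def B_def by auto
  have mid: "mid n = (Max A + Min B) / 2"
    unfolding A_def B_def by (rule midpoint_embedding.simps)
  have "Max A < Min B"
    by (rule AB) (use fin in \<open>auto intro: Max_in Min_in\<close>)
  then have less: "Max A < mid n" "mid n < Min B" by (auto simp: mid)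
  have A: "x < mid n" if "x \<in> A" for x
    using less(1) Max_ge[OF fin(1) that] by linarith
  have B: "mid n < y" if "y \<in> B" for y
    using less(2) Min_le[OF fin(2) that] by linarith
  have "0 < mid n" "mid n < 1" by (auto intro: A B simp: A_def B_def)
  moreover have "mid i < mid n" if "i < n" "lt i n" for i
    using that by (intro A) (auto simp: A_def)
  moreover have "mid n < mid i" if "i < n" "lt n i" for i
    using that by (intro B) (auto simp: B_def)
  ultimately show ?case
    using Suc.IH lt_irrefl by (auto simp: less_Suc_eq)
qed simp

lemma mid_bounds: "0 < mid i" "mid i < 1"
  using mid_strict_mono_upto[of "Suc i"] by auto

lemma mid_strict_mono: "lt i j \<Longrightarrow> mid i < mid j"
  using mid_strict_mono_upto[of "Suc (max i j)"] by (auto simp: less_Suc_eq_le)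

lemma mid_less_iff: "mid i < mid j \<longleftrightarrow> lt i j"
  using mid_strict_mono lt_total lt_irrefl by (metis less_asym)

lemma mid_between:
  assumes "a \<in> insert 0 (range mid)" "b \<in> insert 1 (range mid)" "a < b"
  shows "\<exists>k. a < mid k \<and> mid k < b"
proof -
  consider "a = 0" "b = 1" | i where "a = 0" "b = mid i" | i where "a = mid i" "b = 1"
    | i j where "a = mid i" "b = mid j" using assms by auto
  then show ?thesis
  proof cases
    case 1 then show ?thesis using mid_bounds by blast
  next
    case 2 then show ?thesis using mid_bounds lt_no_min[of i] mid_strict_mono by metis
  next
    case 3 then show ?thesis using mid_bounds lt_no_max[of i] mid_strict_mono by metis
  next
    case 4 then show ?thesis using assms lt_dense[of i j] mid_less_iff by auto
  qed
qed

text \<open>A gap \<open>(u, v)\<close> avoided by all points would be contained in the stage-\<open>n\<close> gap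
\<open>(a n, b n)\<close> around it for every \<open>n\<close>.  As the order is dense without end points, some later
point falls into \<open>(a n, b n)\<close>; the first such point is placed in the middle and, avoiding
\<open>(u, v)\<close>, it cuts the gap in half.  Infinitely many halvings contradict \<open>v - u > 0\<close>.\<close>
lemma mid_dense:
  assumes uv: "0 \<le> u" "u < v" "v \<le> 1"
  shows "\<exists>k. u < mid k \<and> mid k < v"
proof (rule ccontr)
  assume "\<nexists>k. u < mid k \<and> mid k < v"
  then have gap: "mid k \<le> u \<or> v \<le> mid k" for k by (meson not_le)
  define A where "A n = insert 0 (mid ` {i\<in>{..<n}. mid i \<le> u})" for n
  define B where "B n = insert 1 (mid ` {i\<in>{..<n}. v \<le> mid i})" for n
  define a where "a n = Max (A n)" for n
  define b where "b n = Min (B n)" for n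
  have fin: "finite (A n)" "finite (B n)" "A n \<noteq> {}" "B n \<noteq> {}" for n
    by (auto simp: A_def B_def)
  have aA: "a n \<in> A n" and bB: "b n \<in> B n" for n
    unfolding a_def b_def using fin by (auto intro: Max_in Min_in)
  have au: "a n \<le> u" and vb: "v \<le> b n" for n
    using aA[of n] bB[of n] uv by (auto simp: A_def B_def)
  have halve: "\<exists>m. b m - a m \<le> (b n - a n) / 2" for n
  proof -
    have "\<exists>k. a n < mid k \<and> mid k < b n"
      by (rule mid_between) (use aA[of n] bB[of n] au[of n] vb[of n] uv in \<open>auto simp: A_def B_def\<close>)
    then obtain k where k: "a n < mid k" "mid k < b n"
      and least: "\<And>i. i < k \<Longrightarrow> \<not> (a n < mid i \<and> mid i < b n)"
      using exists_least_iff[of "\<lambda>k. a n < mid k \<and> mid k < b n"] by blast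
    have out: "mid i \<le> a n \<or> b n \<le> mid i" if "i < n" for i
      using gap[of i] that fin unfolding a_def b_def
      by (auto intro!: Max_ge Min_le simp: A_def B_def)
    have kn: "n \<le> k" using out[of k] k by force
    have 1: "Max (insert 0 (mid ` {i\<in>{..<k}. lt i k})) = a n"
    proof (rule Max_eqI)
      fix y assume "y \<in> insert 0 (mid ` {i\<in>{..<k}. lt i k})"
      then show "y \<le> a n"
      proof
        assume "y = 0" then show ?thesis unfolding a_def using fin by (auto simp: A_def intro: Max_ge)
      next
        assume "y \<in> mid ` {i\<in>{..<k}. lt i k}"
        then show ?thesis using least k(2) mid_strict_mono by fastforce
      qed
    next
      show "a n \<in> insert 0 (mid ` {i\<in>{..<k}. lt i k})"
        using aA[of n] kn k(1) by (auto simp: A_def mid_less_iff)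
    qed simp
    have 2: "Min (insert 1 (mid ` {i\<in>{..<k}. lt k i})) = b n"
    proof (rule Min_eqI)
      fix y assume "y \<in> insert 1 (mid ` {i\<in>{..<k}. lt k i})"
      then show "b n \<le> y"
      proof
        assume "y = 1" then show ?thesis unfolding b_def using fin by (auto simp: B_def intro: Min_le)
      next
        assume "y \<in> mid ` {i\<in>{..<k}. lt k i}"
        then show ?thesis using least k(1) mid_strict_mono by fastforce
      qed
    next
      show "b n \<in> insert 1 (mid ` {i\<in>{..<k}. lt k i})"
        using bB[of n] kn k(2) by (auto simp: B_def mid_less_iff)
    qed simp
    have m: "mid k = (a n + b n) / 2"
      using midpoint_embedding.simps[of lt k] 1 2 by simp
    have "A n \<subseteq> A (Suc k)" "B n \<subseteq> B (Suc k)" using kn by (auto simp: A_def B_def)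
    then have "a n \<le> a (Suc k)" "b (Suc k) \<le> b n"
      unfolding a_def b_def using fin by (auto intro: Max_mono Min_antimono)
    moreover have "mid k \<le> a (Suc k) \<or> b (Suc k) \<le> mid k"
      using gap[of k] fin unfolding a_def b_def by (auto intro!: Max_ge Min_le simp: A_def B_def)
    ultimately show ?thesis using m by (intro exI[of _ "Suc k"]) argo
  qed
  have "\<exists>n. b n - a n \<le> (b 0 - a 0) / 2 ^ j" for j
  proof (induction j)
    case (Suc j)
    then obtain n where n: "b n - a n \<le> (b 0 - a 0) / 2 ^ j" by blast
    obtain m where m: "b m - a m \<le> (b n - a n) / 2" using halve by blast
    have "b m - a m \<le> (b 0 - a 0) / 2 ^ j / 2"
      by (rule order_trans[OF m]) (use n in \<open>rule divide_right_mono, simp\<close>)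
    then show ?case by (intro exI[of _ m]) (simp add: mult.commute)
  qed auto
  moreover obtain j where "(b 0 - a 0) / (v - u) < 2 ^ j"
    using real_arch_pow[of 2 "(b 0 - a 0) / (v - u)"] by auto
  ultimately obtain n where "b n - a n \<le> (b 0 - a 0) / 2 ^ j" "(b 0 - a 0) < (v - u) * 2 ^ j"
    using uv by (metis diff_gt_0_iff_gt mult.commute pos_divide_less_eq)
  moreover have "(b 0 - a 0) / 2 ^ j < v - u"
    using calculation(2) by (simp add: field_simps)
  ultimately show False using au[of n] vb[of n] by linarith
qed

end

text \<open>Half of Cantor's theorem on countable dense orders, with a target interval in place of the
rationals: the image is dense in the unit interval, so it has no gaps at all.\<close>
lemma countable_dense_order_embedding:
  fixes D :: "'a set" and lt :: "'a \<Rightarrow> 'a \<Rightarrow> bool"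
  assumes "countable D" "D \<noteq> {}"
    and irrefl: "\<And>x. x \<in> D \<Longrightarrow> \<not> lt x x"
    and trans: "\<And>x y z. x \<in> D \<Longrightarrow> y \<in> D \<Longrightarrow> z \<in> D \<Longrightarrow> lt x y \<Longrightarrow> lt y z \<Longrightarrow> lt x z"
    and total: "\<And>x y. x \<in> D \<Longrightarrow> y \<in> D \<Longrightarrow> x \<noteq> y \<Longrightarrow> lt x y \<or> lt y x"
    and dense: "\<And>x y. x \<in> D \<Longrightarrow> y \<in> D \<Longrightarrow> lt x y \<Longrightarrow> \<exists>z\<in>D. lt x z \<and> lt z y"
    and no_min: "\<And>x. x \<in> D \<Longrightarrow> \<exists>y\<in>D. lt y x"
    and no_max: "\<And>x. x \<in> D \<Longrightarrow> \<exists>y\<in>D. lt x y"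
  shows "\<exists>\<phi>::'a \<Rightarrow> real. (\<forall>x\<in>D. 0 < \<phi> x \<and> \<phi> x < 1) \<and> (\<forall>x\<in>D. \<forall>y\<in>D. lt x y \<longrightarrow> \<phi> x < \<phi> y) \<and>
    (\<forall>u v. 0 \<le> u \<longrightarrow> u < v \<longrightarrow> v \<le> 1 \<longrightarrow> (\<exists>x\<in>D. u < \<phi> x \<and> \<phi> x < v))"
proof -
  have inf: "infinite D"
  proof
    assume "finite D"
    then obtain m where m: "m \<in> D" "\<And>x. x \<in> D \<Longrightarrow> \<not> lt m x"
    proof -
      have "wf {(y, x). x \<in> D \<and> y \<in> D \<and> lt x y}"
      proof (rule finite_acyclic_wf)
        show "finite {(y, x). x \<in> D \<and> y \<in> D \<and> lt x y}"
          by (rule finite_subset[of _ "D \<times> D"]) (use \<open>finite D\<close> in auto)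
        have "trans {(y, x). x \<in> D \<and> y \<in> D \<and> lt x y}"
          using trans by (intro transI) blast
        then show "acyclic {(y, x). x \<in> D \<and> y \<in> D \<and> lt x y}"
          unfolding acyclic_def using irrefl by (simp add: trancl_id)
      qed
      then show ?thesis using that \<open>D \<noteq> {}\<close> unfolding wf_eq_minimal
        by blast
    qed
    then show False using no_max by blast
  qed
  define e where "e = from_nat_into D"
  have e: "bij_betw e UNIV D"
    unfolding e_def using bij_betw_from_nat_into assms(1) inf by blast
  then have eD: "e i \<in> D" for i by (auto simp: bij_betw_def)
  have onto: "\<exists>i. x = e i" if "x \<in> D" for x using e that by (auto simp: bij_betw_def)
  interpret dense_order_nat "\<lambda>i j. lt (e i) (e j)"
  proof
    fix i j :: nat assume "i \<noteq> j"
    then show "lt (e i) (e j) \<or> lt (e j) (e i)"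
      using total[OF eD eD] e by (auto simp: bij_betw_def inj_def)
  next
    fix i j assume "lt (e i) (e j)"
    then show "\<exists>k. lt (e i) (e k) \<and> lt (e k) (e j)" using dense[OF eD eD] onto by metis
  next
    fix i show "\<exists>k. lt (e k) (e i)" using no_min[OF eD] onto by metis
    show "\<exists>k. lt (e i) (e k)" using no_max[OF eD] onto by metis
  qed (use irrefl trans eD in blast)+
  have inv: "the_inv e (e i) = i" for i using e by (simp add: bij_betw_def the_inv_f_f)
  have "\<forall>x\<in>D. 0 < mid (the_inv e x) \<and> mid (the_inv e x) < 1"
    using mid_bounds by blast
  moreover have "mid (the_inv e x) < mid (the_inv e y)" if xy: "x \<in> D" "y \<in> D" "lt x y" for x y
    using onto[OF xy(1)] onto[OF xy(2)] xy(3) by (auto simp: inv intro: mid_strict_mono)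
  moreover have "\<exists>x\<in>D. u < mid (the_inv e x) \<and> mid (the_inv e x) < v" if "0 \<le> u" "u < v" "v \<le> 1" for u v
    using mid_dense[OF that] eD inv by metis
  ultimately show ?thesis by (intro exI[of _ "\<lambda>x. mid (the_inv e x)"]) blast
qed

section \<open>Extending order automorphisms of a dense set of reals\<close>

text \<open>\<open>J\<close> is a coordinate on \<open>S\<close> with dense image.  An order automorphism of \<open>S\<close> then has exactly one
monotone extension to the line, and uniqueness turns every identity between automorphisms into
an identity between their extensions.\<close>
locale dense_coordinate =
  fixes S :: "'s set" and J :: "'s \<Rightarrow> real"
  assumes dense: "u < v \<Longrightarrow> \<exists>s\<in>S. u < J s \<and> J s < v"
begin

definition order_automorphism :: "('s \<Rightarrow> 's) \<Rightarrow> bool" where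
  "order_automorphism f \<longleftrightarrow> f ` S = S \<and> (\<forall>s\<in>S. \<forall>s'\<in>S. J s \<le> J s' \<longrightarrow> J (f s) \<le> J (f s'))"

definition extend :: "('s \<Rightarrow> 's) \<Rightarrow> real \<Rightarrow> real" where
  "extend f y = Sup ((\<lambda>s. J (f s)) ` {s\<in>S. J s \<le> y})"

text \<open>If \<open>f y < g y\<close>, a value \<open>f (J s)\<close> strictly between them puts \<open>J s\<close> both to the right of \<open>y\<close>
(by monotonicity of \<open>f\<close>) and to its left (by monotonicity of \<open>g\<close>).\<close>
lemma monotone_eqI:
  assumes "mono f" "mono g" and eq: "\<And>s. s \<in> S \<Longrightarrow> f (J s) = g (J s)"
    and dense_image: "\<And>u v. u < v \<Longrightarrow> \<exists>s\<in>S. u < f (J s) \<and> f (J s) < v"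
  shows "f = (g :: real \<Rightarrow> real)"
proof (rule ext, rule ccontr)
  fix y assume "f y \<noteq> g y"
  then consider "f y < g y" | "g y < f y" by linarith
  then show False
  proof cases
    case 1
    then obtain s where "s \<in> S" "f y < f (J s)" "f (J s) < g y" using dense_image by blast
    then show False using eq monoD[OF assms(1), of "J s" y] monoD[OF assms(2), of y "J s"] by fastforce
  next
    case 2
    then obtain s where "s \<in> S" "g y < f (J s)" "f (J s) < f y" using dense_image by blast
    then show False using eq monoD[OF assms(1), of y "J s"] monoD[OF assms(2), of "J s" y] by fastforce
  qed
qed

context
  fixes f assumes f: "order_automorphism f"
begin

lemma extend_set:
  "(\<lambda>s. J (f s)) ` {s\<in>S. J s \<le> y} \<noteq> {}" "bdd_above ((\<lambda>s. J (f s)) ` {s\<in>S. J s \<le> y})"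
proof -
  show "(\<lambda>s. J (f s)) ` {s\<in>S. J s \<le> y} \<noteq> {}" using dense[of "y - 1" y] by auto
  obtain s' where s': "s' \<in> S" "y < J s'" using dense[of y "y + 1"] by auto
  show "bdd_above ((\<lambda>s. J (f s)) ` {s\<in>S. J s \<le> y})"
    by (rule bdd_aboveI[of _ "J (f s')"]) (use s' f in \<open>auto simp: order_automorphism_def\<close>)
qed

lemma extend_mono: "mono (extend f)"
proof
  fix x y :: real assume "x \<le> y"
  then show "extend f x \<le> extend f y"
    unfolding extend_def by (intro cSup_subset_mono extend_set) auto
qed

lemma extend_eq: "s \<in> S \<Longrightarrow> extend f (J s) = J (f s)"
  unfolding extend_def
  by (rule cSup_eq_maximum) (use f in \<open>auto simp: order_automorphism_def\<close>)

lemma extend_dense_image: "u < v \<Longrightarrow> \<exists>s\<in>S. u < extend f (J s) \<and> extend f (J s) < v"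
  using dense[of u v] f extend_eq unfolding order_automorphism_def by (metis image_iff)

lemma extend_eqI:
  assumes "mono g" "\<And>s. s \<in> S \<Longrightarrow> g (J s) = J (f s)"
  shows "extend f = g"
  by (rule monotone_eqI[OF extend_mono assms(1) _ extend_dense_image]) (auto simp: extend_eq assms(2))

end

lemma order_automorphism_compose:
  assumes f: "order_automorphism f" and g: "order_automorphism g"
  shows "order_automorphism (f \<circ> g)"
proof -
  have "(f \<circ> g) ` S = S" using f g by (simp only: image_comp[symmetric] order_automorphism_def)
  moreover have "g s \<in> S" if "s \<in> S" for s using g that by (auto simp: order_automorphism_def)
  ultimately show ?thesis
    using f g unfolding order_automorphism_def by simp
qed

lemma extend_compose:
  assumes f: "order_automorphism f" and g: "order_automorphism g"
  shows "extend (f \<circ> g) = extend f \<circ> extend g"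
proof (rule extend_eqI)
  show "order_automorphism (f \<circ> g)" by (rule order_automorphism_compose[OF f g])
  show "mono (extend f \<circ> extend g)"
    using extend_mono[OF f] extend_mono[OF g] by (simp add: mono_def)
  show "(extend f \<circ> extend g) (J s) = J ((f \<circ> g) s)" if "s \<in> S" for s
  proof -
    have "g s \<in> S" using g that by (auto simp: order_automorphism_def)
    then show ?thesis using that by (simp add: extend_eq[OF f] extend_eq[OF g])
  qed
qed

text \<open>Uniqueness makes the extensions of inverse automorphisms inverse to each other, and a monotone
surjection of the line is continuous.\<close>
lemma extend_homeomorphism:
  assumes f: "order_automorphism f" and g: "order_automorphism g"
    and inverse: "\<And>s. s \<in> S \<Longrightarrow> f (g s) = s" "\<And>s. s \<in> S \<Longrightarrow> g (f s) = s"
  shows "homeomorphism UNIV UNIV (extend f) (extend g)"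
proof -
  have id: "extend f \<circ> extend g = id"
    if f: "order_automorphism f" and g: "order_automorphism g" and "\<And>s. s \<in> S \<Longrightarrow> f (g s) = s" for f g
  proof (subst extend_compose[OF f g, symmetric], rule extend_eqI)
    show "order_automorphism (f \<circ> g)" by (rule order_automorphism_compose[OF f g])
    show "mono (id :: real \<Rightarrow> real)" by (simp add: mono_def)
    show "id (J s) = J ((f \<circ> g) s)" if "s \<in> S" for s
      using \<open>\<And>s. s \<in> S \<Longrightarrow> f (g s) = s\<close>[OF that] by simp
  qed
  note fg = id[OF f g inverse(1)] and gf = id[OF g f inverse(2)]
  then have inv: "extend f (extend g y) = y" "extend g (extend f y) = y" for y
    by (simp_all add: fun_eq_iff)
  have surj: "range (extend f) = UNIV" "range (extend g) = UNIV"
    using inv by (metis surjI)+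
  have "continuous_on UNIV (extend f)"
    by (rule continuous_onI_mono) (use surj monoD[OF extend_mono[OF f]] in auto)
  moreover have "continuous_on UNIV (extend g)"
    by (rule continuous_onI_mono) (use surj monoD[OF extend_mono[OF g]] in auto)
  ultimately show ?thesis using surj inv by (intro homeomorphismI) auto
qed

end

section \<open>Left orders with a cofinal central element\<close>

locale left_ordered_group = group G for G (structure) +
  fixes r :: "'a rel"
  assumes left_order: "left_order G r"
begin

abbreviation less (infix "\<prec>\<^sub>r" 50) where "x \<prec>\<^sub>r y \<equiv> (x, y) \<in> r"

lemma less_closed: "x \<prec>\<^sub>r y \<Longrightarrow> x \<in> carrier G" "x \<prec>\<^sub>r y \<Longrightarrow> y \<in> carrier G"
  using left_order by (auto simp: left_order_def)

lemma less_irrefl [simp]: "\<not> x \<prec>\<^sub>r x"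
  using left_order by (auto simp: left_order_def strict_linear_order_on_def irrefl_def)

lemma less_trans: "x \<prec>\<^sub>r y \<Longrightarrow> y \<prec>\<^sub>r w \<Longrightarrow> x \<prec>\<^sub>r w"
  using left_order by (auto simp: left_order_def strict_linear_order_on_def dest: transD)

lemma less_total: "x \<in> carrier G \<Longrightarrow> y \<in> carrier G \<Longrightarrow> x \<noteq> y \<Longrightarrow> x \<prec>\<^sub>r y \<or> y \<prec>\<^sub>r x"
  using left_order by (auto simp: left_order_def strict_linear_order_on_def total_on_def)

lemma less_mult_left:
  "h \<in> carrier G \<Longrightarrow> f \<in> carrier G \<Longrightarrow> g \<in> carrier G \<Longrightarrow> f \<prec>\<^sub>r g \<Longrightarrow> h \<otimes> f \<prec>\<^sub>r h \<otimes> g"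
  using left_order by (auto simp: left_order_def)

lemma less_mult_left_iff:
  assumes "h \<in> carrier G" "f \<in> carrier G" "g \<in> carrier G"
  shows "h \<otimes> f \<prec>\<^sub>r h \<otimes> g \<longleftrightarrow> f \<prec>\<^sub>r g"
proof
  assume "h \<otimes> f \<prec>\<^sub>r h \<otimes> g"
  then have "inv h \<otimes> (h \<otimes> f) \<prec>\<^sub>r inv h \<otimes> (h \<otimes> g)"
    by (rule less_mult_left[rotated 3]) (use assms in auto)
  then show "f \<prec>\<^sub>r g" using assms by (simp add: m_assoc[symmetric])
qed (use assms in \<open>auto intro: less_mult_left\<close>)

lemma less_asym: "x \<prec>\<^sub>r y \<Longrightarrow> \<not> y \<prec>\<^sub>r x"
  using less_trans less_irrefl by blast

lemma pow_pos:
  assumes "\<one> \<prec>\<^sub>r x"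
  shows "\<one> \<prec>\<^sub>r x [^] Suc n"
proof (induction n)
  case 0
  show ?case using assms less_closed by simp
next
  case (Suc n)
  have "x \<in> carrier G" using assms less_closed by blast
  then have "x [^] Suc n \<otimes> \<one> \<prec>\<^sub>r x [^] Suc n \<otimes> x"
    by (intro less_mult_left assms) auto
  then have "x [^] Suc n \<prec>\<^sub>r x [^] Suc (Suc n)" using \<open>x \<in> carrier G\<close> by simp
  then show ?case using Suc less_trans by blast
qed

lemma pow_neg:
  assumes "x \<prec>\<^sub>r \<one>"
  shows "x [^] Suc n \<prec>\<^sub>r \<one>"
proof (induction n)
  case 0
  show ?case using assms less_closed by simp
next
  case (Suc n)
  have "x \<in> carrier G" using assms less_closed by blast
  then have "x [^] Suc n \<otimes> x \<prec>\<^sub>r x [^] Suc n \<otimes> \<one>"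
    by (intro less_mult_left assms) auto
  then have "x [^] Suc (Suc n) \<prec>\<^sub>r x [^] Suc n" using \<open>x \<in> carrier G\<close> by simp
  then show ?case using Suc less_trans by blast
qed

text \<open>A positive power has a positive base, so its base and the inverse of its base lie below it.
This is how the central element \<open>t\<close>, being a power of both generators, bounds the generators.\<close>
lemma root_bound:
  assumes x: "x \<in> carrier G" and pos: "\<one> \<prec>\<^sub>r x [^] Suc (Suc n)"
  shows "x \<prec>\<^sub>r x [^] Suc (Suc n)" "inv x \<prec>\<^sub>r x [^] Suc (Suc n)"
proof -
  have "\<one> [^] Suc (Suc n) = \<one>" by (rule nat_pow_one)
  then have "x \<noteq> \<one>" using pos by (metis less_irrefl)
  moreover have "\<not> x \<prec>\<^sub>r \<one>" using pow_neg[of x "Suc n"] pos less_asym by blast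
  ultimately have x_pos: "\<one> \<prec>\<^sub>r x" using less_total[OF x one_closed] by blast
  have "x \<otimes> \<one> \<prec>\<^sub>r x \<otimes> x [^] Suc n"
    by (intro less_mult_left pow_pos x_pos) (use x in auto)
  moreover have "x \<otimes> x [^] Suc n = x [^] Suc (Suc n)" using x by (rule nat_pow_Suc2[symmetric])
  ultimately show "x \<prec>\<^sub>r x [^] Suc (Suc n)" using x by simp
  have "inv x \<otimes> \<one> \<prec>\<^sub>r inv x \<otimes> x" by (intro less_mult_left x_pos) (use x in auto)
  then have "inv x \<prec>\<^sub>r \<one>" using x by simp
  then show "inv x \<prec>\<^sub>r x [^] Suc (Suc n)" using pos less_trans by blast
qed

definition has_successor :: "'a \<Rightarrow> bool" where
  "has_successor x \<longleftrightarrow> (\<exists>y. x \<prec>\<^sub>r y \<and> (\<nexists>w. x \<prec>\<^sub>r w \<and> w \<prec>\<^sub>r y))"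

lemma has_successor_mult_left:
  assumes g: "g \<in> carrier G" and x: "x \<in> carrier G"
  shows "has_successor (g \<otimes> x) \<longleftrightarrow> has_successor x"
proof -
  have "has_successor (g \<otimes> x)"
    if g: "g \<in> carrier G" and x: "x \<in> carrier G" and succ: "has_successor x" for g x
  proof -
    obtain y where y: "x \<prec>\<^sub>r y" "\<And>w. \<not> (x \<prec>\<^sub>r w \<and> w \<prec>\<^sub>r y)" using succ by (auto simp: has_successor_def)
    have "\<not> (g \<otimes> x \<prec>\<^sub>r w \<and> w \<prec>\<^sub>r g \<otimes> y)" for w
    proof
      assume w: "g \<otimes> x \<prec>\<^sub>r w \<and> w \<prec>\<^sub>r g \<otimes> y"
      then have c: "w \<in> carrier G" using less_closed by blast
      then have "w = g \<otimes> (inv g \<otimes> w)" using g by (simp add: m_assoc[symmetric])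
      then have "x \<prec>\<^sub>r inv g \<otimes> w \<and> inv g \<otimes> w \<prec>\<^sub>r y"
        using w less_mult_left_iff[OF g] x c g less_closed(2)[OF y(1)] by (metis inv_closed m_closed)
      then show False using y(2) by blast
    qed
    moreover have "g \<otimes> x \<prec>\<^sub>r g \<otimes> y" using less_mult_left g x y(1) less_closed by blast
    ultimately show ?thesis unfolding has_successor_def by blast
  qed
  from this[OF g x] this[OF inv_closed[OF g] m_closed[OF g x]] show ?thesis
    using g x by (auto simp: m_assoc[symmetric])
qed

text \<open>The order of the group is made dense by inserting a copy of the rationals of \<open>(0, 1)\<close> after every
element that has an immediate successor.  Left multiplication acts on the enlarged order.  The
tightness of a realization comes from this choice: in a densely embedded enlarged order a gap of the
orbit can only be one of the inserted intervals, whose two ends belong to the orbit.\<close>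
definition filled :: "('a \<times> rat) set" where
  "filled = {(x, p). x \<in> carrier G \<and> 0 \<le> p \<and> p < 1 \<and> (p = 0 \<or> has_successor x)}"

definition lex_less :: "'a \<times> rat \<Rightarrow> 'a \<times> rat \<Rightarrow> bool" where
  "lex_less s s' \<longleftrightarrow> fst s \<prec>\<^sub>r fst s' \<or> fst s = fst s' \<and> snd s < snd s'"

definition act :: "'a \<Rightarrow> 'a \<times> rat \<Rightarrow> 'a \<times> rat" where
  "act g s = (g \<otimes> fst s, snd s)"

lemma lex_irrefl: "\<not> lex_less s s"
  by (simp add: lex_less_def)

lemma lex_trans: "lex_less s s' \<Longrightarrow> lex_less s' s'' \<Longrightarrow> lex_less s s''"
  using less_trans by (auto simp: lex_less_def)

lemma lex_total: "s \<in> filled \<Longrightarrow> s' \<in> filled \<Longrightarrow> s \<noteq> s' \<Longrightarrow> lex_less s s' \<or> lex_less s' s"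
  using less_total[of "fst s" "fst s'"]
  by (cases s; cases s'; cases "fst s = fst s'") (auto simp: lex_less_def filled_def)

lemma act_filled: "g \<in> carrier G \<Longrightarrow> s \<in> filled \<Longrightarrow> act g s \<in> filled"
  by (auto simp: act_def filled_def has_successor_mult_left)

lemma act_lex_iff:
  "g \<in> carrier G \<Longrightarrow> s \<in> filled \<Longrightarrow> s' \<in> filled \<Longrightarrow> lex_less (act g s) (act g s') \<longleftrightarrow> lex_less s s'"
  by (auto simp: act_def lex_less_def filled_def less_mult_left_iff)

lemma act_mult: "g \<in> carrier G \<Longrightarrow> h \<in> carrier G \<Longrightarrow> s \<in> filled \<Longrightarrow> act (g \<otimes> h) s = act g (act h s)"
  by (auto simp: act_def filled_def m_assoc)

lemma act_one: "s \<in> filled \<Longrightarrow> act \<one> s = s"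
  by (auto simp: act_def filled_def)

lemma base_filled: "x \<in> carrier G \<Longrightarrow> (x, 0) \<in> filled"
  by (simp add: filled_def)

lemma filled_dense:
  assumes "s \<in> filled" "s' \<in> filled" "lex_less s s'"
  shows "\<exists>w\<in>filled. lex_less s w \<and> lex_less w s'"
proof -
  obtain x p y q where s: "s = (x, p)" "s' = (y, q)" by (cases s, cases s')
  consider "has_successor x" "x \<prec>\<^sub>r y" | "\<not> has_successor x" "x \<prec>\<^sub>r y" | "x = y" "p < q"
    using assms(3) s by (auto simp: lex_less_def)
  then show ?thesis
  proof cases
    case 1
    then show ?thesis
      by (intro bexI[of _ "(x, (p + 1) / 2)"]) (use assms s in \<open>auto simp: lex_less_def filled_def\<close>)
  next
    case 2
    then obtain w where "x \<prec>\<^sub>r w" "w \<prec>\<^sub>r y" by (auto simp: has_successor_def)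
    then show ?thesis
      by (intro bexI[of _ "(w, 0)"]) (auto simp: lex_less_def s filled_def dest: less_closed)
  next
    case 3
    then show ?thesis
      by (intro bexI[of _ "(x, (p + q) / 2)"]) (use assms s in \<open>auto simp: lex_less_def filled_def\<close>)
  qed
qed

end

text \<open>The central element \<open>z\<close> will act as the translation by \<open>1\<close>; cofinality is needed for every element
to lie between two consecutive powers of \<open>z\<close>.\<close>
locale cofinal_central = left_ordered_group +
  fixes z
  assumes countable: "countable (carrier G)"
    and z_closed [simp]: "z \<in> carrier G"
    and z_pos: "\<one> \<prec>\<^sub>r z"
    and z_central: "x \<in> carrier G \<Longrightarrow> z \<otimes> x = x \<otimes> z"
    and cofinal: "x \<in> carrier G \<Longrightarrow> \<exists>n::nat. x \<prec>\<^sub>r z [^] n"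
begin

lemma z_pow_mono: "m < n \<Longrightarrow> z [^] (m::int) \<prec>\<^sub>r z [^] (n::int)"
proof -
  assume "m < n"
  then obtain k where k: "n = m + int (Suc k)" by (metis zless_iff_Suc_zadd)
  have "z [^] m \<otimes> \<one> \<prec>\<^sub>r z [^] m \<otimes> z [^] Suc k"
    by (rule less_mult_left) (use pow_pos[OF z_pos] in auto)
  moreover have "z [^] n = z [^] m \<otimes> z [^] Suc k"
    unfolding k by (simp only: int_pow_mult[OF z_closed] int_pow_int)
  ultimately show ?thesis by simp
qed

lemma z_pow_less_iff: "z [^] (m::int) \<prec>\<^sub>r z [^] (n::int) \<longleftrightarrow> m < n"
  using z_pow_mono less_asym less_irrefl by (metis linorder_neqE)

lemma z_pow_mult_less_iff:
  assumes "x \<in> carrier G"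
  shows "z [^] (k::int) \<otimes> x \<prec>\<^sub>r z [^] (n::int) \<longleftrightarrow> x \<prec>\<^sub>r z [^] (n - k)"
proof -
  have "z [^] n = z [^] k \<otimes> z [^] (n - k)"
    using int_pow_mult[OF z_closed, of k "n - k"] by simp
  then show ?thesis using less_mult_left_iff[of "z [^] k" x "z [^] (n - k)"] assms by simp
qed

definition level :: "'a \<Rightarrow> int" where
  "level x = (THE n. \<not> x \<prec>\<^sub>r z [^] n \<and> x \<prec>\<^sub>r z [^] (n + 1))"

lemma level_unique:
  assumes "x \<in> carrier G" "\<not> x \<prec>\<^sub>r z [^] (m::int)" "x \<prec>\<^sub>r z [^] (n + 1)"
  shows "m \<le> n"
proof (rule ccontr)
  assume "\<not> m \<le> n"
  then have "n + 1 = m \<or> z [^] (n + 1) \<prec>\<^sub>r z [^] m" using z_pow_mono[of "n + 1" m] by linarith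
  then show False using assms less_trans by blast
qed

lemma level_eqI:
  assumes "x \<in> carrier G" "\<not> x \<prec>\<^sub>r z [^] n" "x \<prec>\<^sub>r z [^] (n + 1)"
  shows "level x = n"
  unfolding level_def using assms level_unique by (intro the_equality) (auto intro: antisym)

lemma level:
  assumes x: "x \<in> carrier G"
  shows "\<not> x \<prec>\<^sub>r z [^] level x" "x \<prec>\<^sub>r z [^] (level x + 1)"
proof -
  obtain k :: nat where k: "x \<prec>\<^sub>r z [^] k" using cofinal x by blast
  obtain j :: nat where j: "inv x \<prec>\<^sub>r z [^] j" using cofinal x by blast
  have "z [^] (- int j) \<prec>\<^sub>r x"
  proof -
    have "x \<otimes> inv x \<prec>\<^sub>r x \<otimes> z [^] j" using x j by (intro less_mult_left) auto
    moreover have "x \<otimes> z [^] j = z [^] j \<otimes> x" using group_commutes_pow z_central x by simp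
    ultimately have "\<one> \<prec>\<^sub>r z [^] j \<otimes> x" using x by simp
    then have "inv (z [^] j) \<otimes> \<one> \<prec>\<^sub>r inv (z [^] j) \<otimes> (z [^] j \<otimes> x)"
      using x by (intro less_mult_left) auto
    then show ?thesis using x by (simp add: int_pow_neg_int m_assoc[symmetric])
  qed
  then have lower: "\<not> x \<prec>\<^sub>r z [^] (- int j)" using less_asym by blast
  define m where "m = (LEAST m::nat. x \<prec>\<^sub>r z [^] (int m - int j))"
  have m: "x \<prec>\<^sub>r z [^] (int m - int j)"
    unfolding m_def by (rule LeastI[of _ "k + j"]) (simp add: k int_pow_int)
  then obtain m' where m': "m = Suc m'" using lower by (cases m) auto
  then have "\<not> x \<prec>\<^sub>r z [^] (int m' - int j)"
    unfolding m_def using not_less_Least by (metis lessI)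
  moreover have "x \<prec>\<^sub>r z [^] (int m' - int j + 1)" using m m' by (simp add: algebra_simps)
  ultimately have "level x = int m' - int j" using level_eqI[OF x] by blast
  with \<open>\<not> x \<prec>\<^sub>r z [^] (int m' - int j)\<close> \<open>x \<prec>\<^sub>r z [^] (int m' - int j + 1)\<close>
  show "\<not> x \<prec>\<^sub>r z [^] level x" "x \<prec>\<^sub>r z [^] (level x + 1)" by simp_all
qed

lemma level_mult: "x \<in> carrier G \<Longrightarrow> level (z [^] (k::int) \<otimes> x) = level x + k"
  using level[of x] by (intro level_eqI) (auto simp: z_pow_mult_less_iff algebra_simps)

lemma level_mono:
  assumes "x \<prec>\<^sub>r y"
  shows "level x \<le> level y"
  using level_unique[of y "level x" "level y"] level[of x] level[of y] assms less_closed less_trans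
  by (metis)

text \<open>The elements of the enlarged order above \<open>(\<one>, 0)\<close> whose group part lies below \<open>z\<close> form a countable
dense order without end points.  It is embedded densely into \<open>(0, 1)\<close>, \<open>(\<one>, 0)\<close> is put at \<open>0\<close>, and
translation by powers of \<open>z\<close> extends this coordinate to the whole order.\<close>
lemma coordinate_exists:
  "\<exists>J. dense_coordinate filled J \<and> (\<forall>s\<in>filled. \<forall>s'\<in>filled. lex_less s s' \<longrightarrow> J s < J s') \<and>
     (\<forall>s\<in>filled. J (act z s) = J s + 1) \<and> J (\<one>, 0) = x0"
proof -
  define D where "D = {s\<in>filled. lex_less (\<one>, 0) s \<and> fst s \<prec>\<^sub>r z}"
  have lex_z: "fst s \<prec>\<^sub>r z" if "s \<in> filled" "lex_less s (z, 0)" for s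
    using that by (auto simp: lex_less_def filled_def)
  have lex_D: "s \<in> D" if "s \<in> filled" "lex_less (\<one>, 0) s" "lex_less s s'" "s' \<in> D" for s s'
    using that less_trans by (auto simp: D_def lex_less_def)
  have z0: "(z, 0) \<in> filled" "(\<one>, 0) \<in> filled" by (auto intro: base_filled)
  have "\<exists>\<phi>::'a \<times> rat \<Rightarrow> real. (\<forall>x\<in>D. 0 < \<phi> x \<and> \<phi> x < 1) \<and> (\<forall>x\<in>D. \<forall>y\<in>D. lex_less x y \<longrightarrow> \<phi> x < \<phi> y) \<and>
    (\<forall>u v. 0 \<le> u \<longrightarrow> u < v \<longrightarrow> v \<le> 1 \<longrightarrow> (\<exists>x\<in>D. u < \<phi> x \<and> \<phi> x < v))"
  proof (rule countable_dense_order_embedding)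
    show "countable D"
      by (rule countable_subset[of _ "carrier G \<times> UNIV"]) (auto simp: D_def filled_def countable)
    have "lex_less (\<one>, 0) (z, 0)" using z_pos by (simp add: lex_less_def)
    then obtain w where "w \<in> filled" "lex_less (\<one>, 0) w" "lex_less w (z, 0)"
      using filled_dense[OF z0(2,1)] by blast
    then have "w \<in> D" using lex_z[of w] by (simp add: D_def)
    then show "D \<noteq> {}" by blast
    fix s assume s: "s \<in> D"
    show "\<not> lex_less s s" by (rule lex_irrefl)
    obtain w where "w \<in> filled" "lex_less (\<one>, 0) w" "lex_less w s"
      using filled_dense[OF z0(2), of s] s by (auto simp: D_def)
    then show "\<exists>w\<in>D. lex_less w s" using lex_D[of w s] s by blast
    have "lex_less s (z, 0)" using s by (simp add: D_def lex_less_def)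
    then obtain w where w: "w \<in> filled" "lex_less s w" "lex_less w (z, 0)"
      using filled_dense[OF _ z0(1), of s] s by (auto simp: D_def)
    then have "lex_less (\<one>, 0) w" using s lex_trans[of "(\<one>, 0)" s w] by (simp add: D_def)
    then have "w \<in> D" using w lex_z[of w] by (simp add: D_def)
    then show "\<exists>w\<in>D. lex_less s w" using w(2) by blast
    fix s' assume s': "s' \<in> D"
    show "lex_less s s' \<or> lex_less s' s" if "s \<noteq> s'" using that s s' lex_total by (auto simp: D_def)
    show "\<exists>w\<in>D. lex_less s w \<and> lex_less w s'" if less: "lex_less s s'"
    proof -
      obtain w where w: "w \<in> filled" "lex_less s w" "lex_less w s'"
        using filled_dense[OF _ _ less] s s' by (auto simp: D_def)
      then have "lex_less (\<one>, 0) w" using s lex_trans[of "(\<one>, 0)" s w] by (simp add: D_def)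
      then have "w \<in> D" using w s' lex_D[of w s'] by blast
      then show ?thesis using w by blast
    qed
  qed (rule lex_trans)
  then obtain \<phi> :: "'a \<times> rat \<Rightarrow> real" where
    \<phi>: "\<forall>s\<in>D. 0 < \<phi> s \<and> \<phi> s < 1" "\<forall>s\<in>D. \<forall>s'\<in>D. lex_less s s' \<longrightarrow> \<phi> s < \<phi> s'"
      "\<forall>u v. 0 \<le> u \<longrightarrow> u < v \<longrightarrow> v \<le> 1 \<longrightarrow> (\<exists>s\<in>D. u < \<phi> s \<and> \<phi> s < v)"
    by blast
  have bounds: "0 < \<phi> s" "\<phi> s < 1" if "s \<in> D" for s using \<phi>(1) that by auto
  have mono: "\<phi> s < \<phi> s'" if "s \<in> D" "s' \<in> D" "lex_less s s'" for s s' using \<phi>(2) that by blast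
  have dense: "\<exists>s\<in>D. u < \<phi> s \<and> \<phi> s < v" if "0 \<le> u" "u < v" "v \<le> 1" for u v
    using \<phi>(3) that by blast
  define \<kappa> where "\<kappa> s = (if s = (\<one>, 0) then 0 else \<phi> s)" for s
  define red where "red s = act (z [^] (- level (fst s))) s" for s
  define J where "J s = x0 + real_of_int (level (fst s)) + \<kappa> (red s)" for s
  have F: "red s \<in> insert (\<one>, 0) D" if s: "s \<in> filled" for s
  proof -
    have c: "fst s \<in> carrier G" using s by (auto simp: filled_def)
    have red: "red s \<in> filled" using s by (simp add: red_def act_filled)
    have 1: "\<not> fst (red s) \<prec>\<^sub>r \<one>" "fst (red s) \<prec>\<^sub>r z"
      using level[OF c] z_pow_mult_less_iff[OF c, of "- level (fst s)" 0]
        z_pow_mult_less_iff[OF c, of "- level (fst s)" 1]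
      by (simp_all add: red_def act_def add.commute)
    have "lex_less (\<one>, 0) (red s)" if "red s \<noteq> (\<one>, 0)"
      using lex_total[OF z0(2) red] that 1(1) red by (auto simp: lex_less_def filled_def)
    then show ?thesis using 1(2) red by (auto simp: D_def)
  qed
  have kbounds: "0 \<le> \<kappa> s" "\<kappa> s < 1" if "s \<in> insert (\<one>, 0) D" for s
  proof -
    have "0 \<le> \<kappa> s \<and> \<kappa> s < 1"
      using bounds[of s] that by (cases "s = (\<one>, 0)") (simp_all add: \<kappa>_def)
    then show "0 \<le> \<kappa> s" "\<kappa> s < 1" by simp_all
  qed
  have kmono: "\<kappa> s < \<kappa> s'" if "s \<in> insert (\<one>, 0) D" "s' \<in> insert (\<one>, 0) D" "lex_less s s'" for s s'
  proof -
    have "s' \<noteq> (\<one>, 0)"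
    proof
      assume "s' = (\<one>, 0)"
      then have "lex_less s s" using that lex_trans[of s s' s] by (auto simp: D_def)
      then show False using lex_irrefl by blast
    qed
    then have "s' \<in> D" using that(2) by simp
    then have "s' \<noteq> (\<one>, 0)" by (auto simp: D_def lex_irrefl)
    then show ?thesis
      using that bounds[of s'] mono[of s s'] \<open>s' \<in> D\<close> by (cases "s = (\<one>, 0)") (simp_all add: \<kappa>_def)
  qed
  have Jmono: "J s < J s'" if s: "s \<in> filled" "s' \<in> filled" "lex_less s s'" for s s'
  proof -
    have le: "level (fst s) \<le> level (fst s')"
      using s(3) level_mono by (auto simp: lex_less_def)
    show ?thesis
    proof (cases "level (fst s) = level (fst s')")
      case True
      then have "lex_less (red s) (red s')" using s by (simp add: red_def act_lex_iff)
      then show ?thesis using True kmono[OF F[OF s(1)] F[OF s(2)]] by (simp add: J_def)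
    next
      case False
      then have "level (fst s) + 1 \<le> level (fst s')" using le by linarith
      then have "real_of_int (level (fst s)) + 1 \<le> real_of_int (level (fst s'))" by linarith
      then show ?thesis using kbounds[OF F[OF s(1)]] kbounds[OF F[OF s(2)]] unfolding J_def by linarith
    qed
  qed
  have shift: "J (act (z [^] k) s) = J s + real_of_int k" if s: "s \<in> filled" for s and k :: int
  proof -
    have c: "fst s \<in> carrier G" using s by (auto simp: filled_def)
    have "level (fst (act (z [^] k) s)) = level (fst s) + k"
      using level_mult[OF c] by (simp add: act_def)
    moreover have "red (act (z [^] k) s) = red s"
      using act_mult[OF _ _ s, of "z [^] (- (level (fst s) + k))" "z [^] k"]
        int_pow_mult[OF z_closed, of "- (level (fst s) + k)" k]
      by (simp add: red_def calculation)
    ultimately show ?thesis by (simp add: J_def)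
  qed
  have base: "J s = x0 + \<kappa> s" if "s \<in> insert (\<one>, 0) D" for s
  proof -
    have s: "s \<in> filled" and "\<not> fst s \<prec>\<^sub>r z [^] (0::int)" "fst s \<prec>\<^sub>r z [^] (0 + 1 :: int)"
      using that z0 z_pos less_asym by (auto simp: D_def lex_less_def)
    moreover have "fst s \<in> carrier G" using s by (auto simp: filled_def)
    ultimately have "level (fst s) = 0" by (intro level_eqI)
    then show ?thesis using s by (simp add: J_def red_def act_one)
  qed
  have Jdense: "dense_coordinate filled J"
  proof
    fix u v :: real assume "u < v"
    define n where "n = \<lfloor>u - x0\<rfloor>"
    have n: "real_of_int n \<le> u - x0" "u - x0 < real_of_int n + 1"
      unfolding n_def by linarith+
    then have "\<exists>s\<in>D. u - x0 - real_of_int n < \<phi> s \<and> \<phi> s < min 1 (v - x0 - real_of_int n)"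
      using \<open>u < v\<close> by (intro dense) auto
    then obtain s where s: "s \<in> D" "u - x0 - real_of_int n < \<phi> s" "\<phi> s < v - x0 - real_of_int n" by auto
    then have "s \<in> filled" "s \<noteq> (\<one>, 0)" by (auto simp: D_def lex_irrefl)
    then have "J (act (z [^] n) s) = x0 + \<phi> s + real_of_int n"
      using shift[of s n] base[of s] s(1) by (simp add: \<kappa>_def)
    then show "\<exists>s\<in>filled. u < J s \<and> J s < v"
      using s by (intro bexI[of _ "act (z [^] n) s"]) (auto intro: act_filled \<open>s \<in> filled\<close>)
  qed
  have "J (act z s) = J s + 1" if "s \<in> filled" for s using shift[OF that, of 1] by simp
  moreover have "J (\<one>, 0) = x0" using base[of "(\<one>, 0)"] by (simp add: \<kappa>_def)
  ultimately show ?thesis using Jmono Jdense by blast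
qed

text \<open>Left multiplication by \<open>g\<close> is an order automorphism of the enlarged order, and \<open>\<rho> g\<close> is its monotone
extension to the line.  It commutes with \<open>\<rho> z\<close>, the unit translation, because \<open>z\<close> is central.\<close>
lemma realization_exists:
  "\<exists>\<rho>\<in>hom G Homeo_Z. tight G \<rho> x0 \<and> \<rho> z = shift \<and>
     (\<forall>f\<in>carrier G. \<forall>g\<in>carrier G. f \<prec>\<^sub>r g \<longleftrightarrow> \<rho> f x0 < \<rho> g x0)"
proof -
  obtain J where "dense_coordinate filled J"
    and Jmono: "\<And>s s'. s \<in> filled \<Longrightarrow> s' \<in> filled \<Longrightarrow> lex_less s s' \<Longrightarrow> J s < J s'"
    and Jz: "\<And>s. s \<in> filled \<Longrightarrow> J (act z s) = J s + 1"
    and J0: "J (\<one>, 0) = x0"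
    using coordinate_exists[of x0] by blast
  interpret dense_coordinate filled J by fact
  have J_less_iff: "J s < J s' \<longleftrightarrow> lex_less s s'" if "s \<in> filled" "s' \<in> filled" for s s'
    using that Jmono lex_total by (metis less_asym' less_irrefl)
  have J_le_iff: "J s \<le> J s' \<longleftrightarrow> \<not> lex_less s' s" if "s \<in> filled" "s' \<in> filled" for s s'
    using that J_less_iff by (simp add: not_less[symmetric])
  have auto: "order_automorphism (act g)" if g: "g \<in> carrier G" for g
    unfolding order_automorphism_def
  proof
    show "act g ` filled = filled"
    proof
      show "filled \<subseteq> act g ` filled"
      proof
        fix s assume s: "s \<in> filled"
        then have "s = act g (act (inv g) s)" using act_mult[of g "inv g" s] g act_one by simp
        then show "s \<in> act g ` filled" using act_filled s g by blast
      qed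
    qed (use act_filled g in blast)
  qed (simp add: J_le_iff act_filled act_lex_iff g)
  define \<rho> where "\<rho> g = extend (act g)" for g
  have rho_J: "\<rho> g (J s) = J (act g s)" if "g \<in> carrier G" "s \<in> filled" for g s
    unfolding \<rho>_def using extend_eq[OF auto] that by blast
  have rho_x0: "\<rho> g x0 = J (g, 0)" if "g \<in> carrier G" for g
    using rho_J[OF that base_filled[OF one_closed]] that by (simp add: J0 act_def)
  have mult: "\<rho> (g \<otimes> h) = \<rho> g \<circ> \<rho> h" if "g \<in> carrier G" "h \<in> carrier G" for g h
  proof -
    have "extend (act (g \<otimes> h)) = extend (act g) \<circ> extend (act h)"
    proof (rule extend_eqI[OF auto])
      show "mono (extend (act g) \<circ> extend (act h))"
        using extend_mono[OF auto] that by (simp add: mono_def)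
      show "(extend (act g) \<circ> extend (act h)) (J s) = J (act (g \<otimes> h) s)" if "s \<in> filled" for s
        using rho_J[unfolded \<rho>_def] act_mult act_filled that \<open>g \<in> carrier G\<close> \<open>h \<in> carrier G\<close> by simp
    qed (use that in simp)
    then show ?thesis by (simp add: \<rho>_def)
  qed
  have z: "\<rho> z = shift"
    unfolding \<rho>_def by (rule extend_eqI[OF auto]) (auto simp: shift_def mono_def Jz)
  have "\<rho> \<in> hom G Homeo_Z"
  proof (rule homI)
    fix g assume g: "g \<in> carrier G"
    have "homeomorphism UNIV UNIV (\<rho> g) (\<rho> (inv g))"
      unfolding \<rho>_def
      by (rule extend_homeomorphism) (use g auto act_mult act_one in \<open>auto simp flip: act_mult\<close>)
    moreover have "\<rho> g \<circ> shift = shift \<circ> \<rho> g"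
      using mult[OF g z_closed] mult[OF z_closed g] z_central[OF g] z by simp
    ultimately show "\<rho> g \<in> carrier Homeo_Z" by (auto simp: Homeo_Z_def)
  qed (simp add: Homeo_Z_def mult)
  moreover have less: "f \<prec>\<^sub>r g \<longleftrightarrow> \<rho> f x0 < \<rho> g x0" if "f \<in> carrier G" "g \<in> carrier G" for f g
    using that by (simp add: rho_x0 J_less_iff base_filled lex_less_def)
  moreover have "tight G \<rho> x0"
  proof -
    have orb: "orbit G \<rho> x0 = (\<lambda>g. J (g, 0)) ` carrier G"
      unfolding orbit_def using rho_x0 by force
    have "J (act z (x, 0)) = J (x, 0) + 1" if "x \<in> carrier G" for x
      using Jz base_filled that by blast
    then have Jpow: "J (z [^] n, 0) = x0 + real n" for n :: nat
      by (induction n) (auto simp: J0 act_def z_central)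
    have Jneg: "J (inv (z [^] n), 0) = x0 - real n" for n :: nat
    proof -
      have "\<rho> (z [^] m) y = y + real m" if "\<rho> \<one> = id" for y and m :: nat
        by (induction m arbitrary: y) (auto simp: that mult z shift_def)
      moreover have "\<rho> \<one> = id"
        unfolding \<rho>_def by (rule extend_eqI[OF auto]) (auto simp: mono_def act_one)
      moreover have "\<rho> (z [^] n) (J (inv (z [^] n), 0)) = x0"
        using rho_J[of "z [^] n" "(inv (z [^] n), 0)"] base_filled[of "inv (z [^] n)"]
        by (simp add: act_def J0)
      ultimately show ?thesis by (metis add_diff_cancel)
    qed
    have stab: "stabilizer G \<rho> x0 = {\<one>}"
    proof -
      have "g = \<one>" if "g \<in> carrier G" "\<rho> g x0 = x0" for g
        using less_total[of g \<one>] less[of g \<one>] less[of \<one> g] that rho_x0[of \<one>] J0 by auto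
      then show ?thesis using rho_x0[of \<one>] J0 by (auto simp: stabilizer_def)
    qed
    have "\<not> bdd_below (orbit G \<rho> x0)"
    proof
      assume "bdd_below (orbit G \<rho> x0)"
      then obtain B where B: "\<And>y. y \<in> orbit G \<rho> x0 \<Longrightarrow> B \<le> y" by (auto simp: bdd_below_def)
      obtain n :: nat where "x0 - B < real n" using reals_Archimedean2 by blast
      moreover have "B \<le> J (inv (z [^] n), 0)" by (rule B) (auto simp: orb)
      ultimately show False using Jneg by simp
    qed
    moreover have "\<not> bdd_above (orbit G \<rho> x0)"
    proof
      assume "bdd_above (orbit G \<rho> x0)"
      then obtain B where B: "\<And>y. y \<in> orbit G \<rho> x0 \<Longrightarrow> y \<le> B" by (auto simp: bdd_above_def)
      obtain n :: nat where "B - x0 < real n" using reals_Archimedean2 by blast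
      moreover have "J (z [^] n, 0) \<le> B" by (rule B) (auto simp: orb)
      ultimately show False using Jpow by simp
    qed
    moreover have "{a, b} \<subseteq> orbit G \<rho> x0"
      if ab: "a < b" and gap: "closure (orbit G \<rho> x0) \<inter> {a..b} = {a, b}" for a b
    proof -
      have out: "J (x, 0) \<le> a \<or> b \<le> J (x, 0)" if "x \<in> carrier G" for x
      proof -
        have "J (x, 0) \<in> closure (orbit G \<rho> x0)" using that closure_subset orb by blast
        then show ?thesis using gap by (metis IntI atLeastAtMost_iff insert_iff linear empty_iff order_refl)
      qed
      \<comment> \<open>The inserted point found in the gap shows that the gap lies between an element and its successor.\<close>
      obtain x p where s: "(x, p) \<in> filled" "a < J (x, p)" "J (x, p) < b" using dense[OF ab] by auto
      then have c: "x \<in> carrier G" by (simp add: filled_def)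
      have "p \<noteq> 0" using s out[OF c] by auto
      then have p: "p > 0" "has_successor x" using s by (auto simp: filled_def)
      then obtain y where y: "x \<prec>\<^sub>r y" "\<And>w. \<not> (x \<prec>\<^sub>r w \<and> w \<prec>\<^sub>r y)" by (auto simp: has_successor_def)
      then have yc: "y \<in> carrier G" using less_closed by blast
      have "J (x, 0) < J (x, p)" "J (x, p) < J (y, 0)"
        using s(1) y(1) p c yc by (auto intro!: Jmono base_filled simp: lex_less_def)
      then have le: "J (x, 0) \<le> a" "b \<le> J (y, 0)" using out[OF c] out[OF yc] s by linarith+
      have "J (w, 0) \<notin> {J (x, 0)<..<J (y, 0)}" if "w \<in> carrier G" for w
        using y(2)[of w] that c yc by (auto simp: J_less_iff base_filled lex_less_def)
      then have "{J (x, 0)<..<J (y, 0)} \<inter> orbit G \<rho> x0 = {}" by (auto simp: orb)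
      then have "{J (x, 0)<..<J (y, 0)} \<inter> closure (orbit G \<rho> x0) = {}"
        by (simp add: open_Int_closure_eq_empty)
      moreover have "a \<in> closure (orbit G \<rho> x0)" "b \<in> closure (orbit G \<rho> x0)" using gap by auto
      ultimately have "a \<notin> {J (x, 0)<..<J (y, 0)}" "b \<notin> {J (x, 0)<..<J (y, 0)}" by blast+
      then have "a = J (x, 0)" "b = J (y, 0)" using le ab by auto
      then show ?thesis using c yc orb by auto
    qed
    ultimately show ?thesis unfolding tight_def using stab by blast
  qed
  ultimately show ?thesis using z by blast
qed

end

section \<open>Homomorphisms from presented groups\<close>

lemma presented_group_induct [consumes 1, case_names one gen inv_gen]:
  assumes "X \<in> carrier (presented_group R)"
    and "P \<one>\<^bsub>presented_group R\<^esub>"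
    and "\<And>x X. X \<in> carrier (presented_group R) \<Longrightarrow> P X \<Longrightarrow>
           P (gen_class R x \<otimes>\<^bsub>presented_group R\<^esub> X)"
    and "\<And>x X. X \<in> carrier (presented_group R) \<Longrightarrow> P X \<Longrightarrow>
           P (inv\<^bsub>presented_group R\<^esub> gen_class R x \<otimes>\<^bsub>presented_group R\<^esub> X)"
  shows "P X"
proof -
  interpret group "presented_group R" by (rule presented_group_group)
  have inv: "inv\<^bsub>presented_group R\<^esub> gen_class R x = word_class R [(x, False)]" for x
  proof (rule inv_equality)
    show "word_class R [(x, False)] \<otimes>\<^bsub>presented_group R\<^esub> gen_class R x = \<one>\<^bsub>presented_group R\<^esub>"
      using word_eq_cancel[of R x False]
      by (simp add: gen_class_def presented_group_mult presented_group_one word_class_eq_iff)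
  qed (auto simp: gen_class_def presented_group_carrier)
  have "P (word_class R u)" for u
  proof (induction u)
    case Nil
    then show ?case using assms(2) by (simp add: presented_group_one)
  next
    case (Cons l u)
    obtain x s where l: "l = (x, s)" by force
    have "word_class R u \<in> carrier (presented_group R)" by (simp add: presented_group_carrier)
    from assms(3)[OF this Cons.IH, of x] assms(4)[OF this Cons.IH, of x] show ?case
      unfolding inv by (cases s) (simp_all add: l gen_class_def presented_group_mult)
  qed
  then show ?thesis using assms(1) by (auto simp: presented_group_carrier)
qed

definition word_eval :: "('a, 'm) monoid_scheme \<Rightarrow> ('g \<Rightarrow> 'a) \<Rightarrow> 'g gword \<Rightarrow> 'a" where
  "word_eval K f u = foldr (\<lambda>(x, s) k. (if s then f x else inv\<^bsub>K\<^esub> f x) \<otimes>\<^bsub>K\<^esub> k) u \<one>\<^bsub>K\<^esub>"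

lemma (in group) word_eval_closed: "range f \<subseteq> carrier G \<Longrightarrow> word_eval G f u \<in> carrier G"
  by (induction u) (auto simp: word_eval_def image_subset_iff)

lemma (in group) word_eval_append:
  assumes "range f \<subseteq> carrier G"
  shows "word_eval G f (u @ v) = word_eval G f u \<otimes> word_eval G f v"
proof (induction u)
  case Nil
  then show ?case using word_eval_closed[OF assms, of v] by (simp add: word_eval_def)
next
  case (Cons l u)
  obtain x s where l: "l = (x, s)" by force
  have "f x \<in> carrier G" using assms by auto
  then show ?case
    using Cons.IH word_eval_closed[OF assms, of v] word_eval_closed[OF assms, of u]
    by (simp add: l word_eval_def m_assoc)
qed

lemma (in group) word_eval_word_eq:
  assumes "range f \<subseteq> carrier G" and "\<And>u v. (u, v) \<in> R \<Longrightarrow> word_eval G f u = word_eval G f v"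
    and "word_eq R u v"
  shows "word_eval G f u = word_eval G f v"
  using assms(3)
proof (induction rule: word_eq.induct)
  case (word_eq_cancel x s)
  have "f x \<in> carrier G" using assms by auto
  then show ?case by (simp add: word_eval_def)
qed (use assms in \<open>auto simp: word_eval_append\<close>)

text \<open>The universal property of a presentation: a map on the generators that respects the relations
extends to a homomorphism.\<close>
lemma (in group) presented_group_lift:
  fixes f :: "'g \<Rightarrow> 'a"
  assumes "range f \<subseteq> carrier G" and "\<And>u v. (u, v) \<in> R \<Longrightarrow> word_eval G f u = word_eval G f v"
  shows "\<exists>h\<in>hom (presented_group R) G. \<forall>x. h (gen_class R x) = f x"
proof -
  define h where "h X = (THE k. \<exists>u. X = word_class R u \<and> k = word_eval G f u)" for X
  have h: "h (word_class R u) = word_eval G f u" for u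
    unfolding h_def
    by (rule the_equality)
      (use word_eq_refl in \<open>auto simp: word_class_eq_iff intro: word_eval_word_eq[OF assms, symmetric]\<close>)
  have "h \<in> hom (presented_group R) G"
    by (auto simp: hom_def presented_group_carrier presented_group_mult h
      word_eval_closed[OF assms(1)] word_eval_append[OF assms(1)])
  moreover have "f x \<in> carrier G" for x using assms(1) by auto
  ultimately show ?thesis
    by (intro bexI[of _ h]) (auto simp: gen_class_def h word_eval_def)
qed

lemma presented_group_countable:
  "countable (carrier (presented_group (R :: ('g::countable gword \<times> 'g gword) set)))"
  unfolding presented_group_carrier by simp

section \<open>The trefoil group as a central extension of the modular group\<close>

instance two_gens :: countable by countable_datatype

lemma trefoil_group: "group trefoil_group"
  unfolding trefoil_group_def by (rule presented_group_group)

lemma modular_group: "group modular_group"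
  unfolding modular_group_def by (rule presented_group_group)

interpretation T: group trefoil_group by (rule trefoil_group)
interpretation Q: group modular_group by (rule modular_group)

abbreviation tref_mult (infixl "\<cdot>" 70) where "x \<cdot> y \<equiv> x \<otimes>\<^bsub>trefoil_group\<^esub> y"

abbreviation trefoil_t :: "two_gens gword set" where
  "trefoil_t \<equiv> trefoil_a [^]\<^bsub>trefoil_group\<^esub> (2::nat)"

lemma trefoil_a_closed [simp]: "trefoil_a \<in> carrier trefoil_group"
  and trefoil_b_closed [simp]: "trefoil_b \<in> carrier trefoil_group"
  by (auto simp: trefoil_a_def trefoil_b_def trefoil_group_def gen_class_def presented_group_carrier)

lemma modular_alpha_closed [simp]: "modular_\<alpha> \<in> carrier modular_group"
  and modular_beta_closed [simp]: "modular_\<beta> \<in> carrier modular_group"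
  by (auto simp: modular_\<alpha>_def modular_\<beta>_def modular_group_def gen_class_def presented_group_carrier)

lemma trefoil_t_eq_a: "trefoil_t = trefoil_a \<cdot> trefoil_a"
  by (simp add: numeral_2_eq_2)

lemma trefoil_t_eq_b: "trefoil_t = trefoil_b \<cdot> trefoil_b \<cdot> trefoil_b"
proof -
  have "word_eq trefoil_rels (replicate 2 (Gen1, True)) (replicate 3 (Gen2, True))"
    by (rule word_eq_rel) (simp add: trefoil_rels_def)
  then show ?thesis
    unfolding trefoil_t_eq_a
    by (simp add: trefoil_group_def trefoil_a_def trefoil_b_def gen_class_def
      presented_group_mult word_class_eq_iff numeral_2_eq_2 numeral_3_eq_3)
qed

lemma modular_relations:
  "modular_\<alpha> \<otimes>\<^bsub>modular_group\<^esub> modular_\<alpha> = \<one>\<^bsub>modular_group\<^esub>"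
  "modular_\<beta> \<otimes>\<^bsub>modular_group\<^esub> modular_\<beta> \<otimes>\<^bsub>modular_group\<^esub> modular_\<beta> = \<one>\<^bsub>modular_group\<^esub>"
proof -
  have "word_eq modular_rels (replicate 2 (Gen1, True)) []"
       "word_eq modular_rels (replicate 3 (Gen2, True)) []"
    by (auto intro!: word_eq_rel simp: modular_rels_def)
  then show "modular_\<alpha> \<otimes>\<^bsub>modular_group\<^esub> modular_\<alpha> = \<one>\<^bsub>modular_group\<^esub>"
    "modular_\<beta> \<otimes>\<^bsub>modular_group\<^esub> modular_\<beta> \<otimes>\<^bsub>modular_group\<^esub> modular_\<beta> = \<one>\<^bsub>modular_group\<^esub>"
    by (simp_all add: modular_group_def modular_\<alpha>_def modular_\<beta>_def gen_class_def
      presented_group_mult presented_group_one word_class_eq_iff numeral_2_eq_2 numeral_3_eq_3)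
qed

text \<open>The assignment \<open>\<alpha> \<mapsto> 3\<close>, \<open>\<beta> \<mapsto> 2\<close> defines a homomorphism to the cyclic group of order \<open>6\<close>.\<close>
lemma modular_generators_nontrivial:
  "modular_\<alpha> \<noteq> \<one>\<^bsub>modular_group\<^esub>" "modular_\<beta> \<noteq> \<one>\<^bsub>modular_group\<^esub>"
proof -
  interpret Z6: group "integer_mod_group 6" by simp
  let ?f = "case_two_gens 3 2 :: two_gens \<Rightarrow> int"
  have "\<exists>h\<in>hom (presented_group modular_rels) (integer_mod_group 6).
    \<forall>x. h (gen_class modular_rels x) = ?f x"
  proof (rule Z6.presented_group_lift)
    show "range ?f \<subseteq> carrier (integer_mod_group 6)"
      by (auto simp: carrier_integer_mod_group split: two_gens.split)
    show "word_eval (integer_mod_group 6) ?f u = word_eval (integer_mod_group 6) ?f v"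
      if "(u, v) \<in> modular_rels" for u v
      using that by (auto simp: modular_rels_def word_eval_def numeral_2_eq_2 numeral_3_eq_3)
  qed
  then obtain h where "h \<in> hom (presented_group modular_rels) (integer_mod_group 6)"
    and "\<And>x. h (gen_class modular_rels x) = ?f x" by blast
  then have h: "h \<in> hom modular_group (integer_mod_group 6)" "h modular_\<alpha> = 3" "h modular_\<beta> = 2"
    by (simp_all add: modular_group_def modular_\<alpha>_def modular_\<beta>_def)
  have "h \<one>\<^bsub>modular_group\<^esub> = 0" using hom_one[OF h(1)] by (simp add: modular_group)
  with h show "modular_\<alpha> \<noteq> \<one>\<^bsub>modular_group\<^esub>" "modular_\<beta> \<noteq> \<one>\<^bsub>modular_group\<^esub>" by auto
qed

lemma trefoil_induct [consumes 1, case_names one a b inv_a inv_b]: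
  assumes "x \<in> carrier trefoil_group"
    and "P \<one>\<^bsub>trefoil_group\<^esub>"
    and "\<And>x. x \<in> carrier trefoil_group \<Longrightarrow> P x \<Longrightarrow> P (trefoil_a \<cdot> x)"
    and "\<And>x. x \<in> carrier trefoil_group \<Longrightarrow> P x \<Longrightarrow> P (trefoil_b \<cdot> x)"
    and "\<And>x. x \<in> carrier trefoil_group \<Longrightarrow> P x \<Longrightarrow> P (inv\<^bsub>trefoil_group\<^esub> trefoil_a \<cdot> x)"
    and "\<And>x. x \<in> carrier trefoil_group \<Longrightarrow> P x \<Longrightarrow> P (inv\<^bsub>trefoil_group\<^esub> trefoil_b \<cdot> x)"
  shows "P x"
  using assms(1)[unfolded trefoil_group_def]
proof (rule presented_group_induct)
  show "P \<one>\<^bsub>presented_group trefoil_rels\<^esub>"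
    using assms(2) by (simp only: trefoil_group_def)
  show "P (gen_class trefoil_rels g \<otimes>\<^bsub>presented_group trefoil_rels\<^esub> X)"
    if "X \<in> carrier (presented_group trefoil_rels)" "P X" for g X
    using assms(3,4)[of X] that
    by (cases g) (simp_all only: trefoil_group_def trefoil_a_def trefoil_b_def)
  show "P (inv\<^bsub>presented_group trefoil_rels\<^esub> gen_class trefoil_rels g \<otimes>\<^bsub>presented_group trefoil_rels\<^esub> X)"
    if "X \<in> carrier (presented_group trefoil_rels)" "P X" for g X
    using assms(5,6)[of X] that
    by (cases g) (simp_all only: trefoil_group_def trefoil_a_def trefoil_b_def)
qed

lemma (in group) commute_inv:
  assumes "x \<in> carrier G" "y \<in> carrier G" "x \<otimes> y = y \<otimes> x"
  shows "x \<otimes> inv y = inv y \<otimes> x"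
proof -
  have "y \<otimes> (x \<otimes> inv y) = (y \<otimes> x) \<otimes> inv y"
    using assms(1,2) by (metis m_assoc inv_closed)
  also have "\<dots> = x \<otimes> (y \<otimes> inv y)" using assms by (metis m_assoc inv_closed)
  also have "\<dots> = x" using assms(1,2) by (metis r_inv r_one)
  finally show ?thesis using assms(1,2) by (metis inv_solve_left inv_closed m_closed)
qed

lemma (in group) commute_int_pow:
  fixes k :: int
  assumes "x \<in> carrier G" "y \<in> carrier G" "x \<otimes> y = y \<otimes> x"
  shows "x [^] k \<otimes> y = y \<otimes> x [^] k"
proof (cases k rule: int_cases2)
  case (nonneg n)
  show ?thesis unfolding nonneg int_pow_int by (rule group_commutes_pow[OF assms(3,1,2)])
next
  case (nonpos n)
  have "y \<otimes> inv (x [^] n) = inv (x [^] n) \<otimes> y"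
    by (rule commute_inv[OF assms(2) nat_pow_closed[OF assms(1)] group_commutes_pow[OF assms(3,1,2), symmetric]])
  then show ?thesis unfolding nonpos int_pow_neg_int[OF assms(1)] by (rule sym)
qed

lemma trefoil_t_central:
  assumes "x \<in> carrier trefoil_group"
  shows "trefoil_t \<cdot> x = x \<cdot> trefoil_t"
proof -
  let ?t = trefoil_t
  have t: "?t \<in> carrier trefoil_group" by simp
  have step: "?t \<cdot> (y \<cdot> x) = y \<cdot> x \<cdot> ?t"
    if "x \<in> carrier trefoil_group" "y \<in> carrier trefoil_group" "?t \<cdot> x = x \<cdot> ?t" "?t \<cdot> y = y \<cdot> ?t" for x y
  proof -
    have "?t \<cdot> (y \<cdot> x) = (?t \<cdot> y) \<cdot> x" using that(1,2) t by (simp only: T.m_assoc)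
    also have "\<dots> = y \<cdot> (?t \<cdot> x)" using that(1,2) t by (simp only: that(4) T.m_assoc)
    also have "\<dots> = y \<cdot> x \<cdot> ?t" using that(1,2) t by (simp only: that(3) T.m_assoc)
    finally show ?thesis .
  qed
  have a: "?t \<cdot> trefoil_a = trefoil_a \<cdot> ?t"
    unfolding trefoil_t_eq_a by (simp add: T.m_assoc)
  have b: "?t \<cdot> trefoil_b = trefoil_b \<cdot> ?t"
    unfolding trefoil_t_eq_b by (simp add: T.m_assoc)
  from assms show ?thesis
  proof (induction rule: trefoil_induct)
    case one
    show ?case by simp
  next
    case (a x)
    then show ?case by (intro step \<open>?t \<cdot> trefoil_a = trefoil_a \<cdot> ?t\<close>) simp_all
  next
    case (b x)
    then show ?case by (intro step \<open>?t \<cdot> trefoil_b = trefoil_b \<cdot> ?t\<close>) simp_all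
  next
    case (inv_a x)
    then show ?case by (intro step T.commute_inv[OF t _ a]) simp_all
  next
    case (inv_b x)
    then show ?case by (intro step T.commute_inv[OF t _ b]) simp_all
  qed
qed

locale trefoil_cover =
  fixes q :: "two_gens gword set \<Rightarrow> two_gens gword set"
  assumes q_epi: "q \<in> epi trefoil_group modular_group"
    and q_a: "q trefoil_a = modular_\<alpha>"
    and q_b: "q trefoil_b = modular_\<beta>"
begin

lemma q_hom: "q \<in> hom trefoil_group modular_group"
  and q_onto: "q ` carrier trefoil_group = carrier modular_group"
  using q_epi by (auto simp: epi_def)

sublocale q: group_hom trefoil_group modular_group q
  by (simp add: group_hom_def group_hom_axioms_def q_hom trefoil_group modular_group)

lemma q_word: "q (word_class trefoil_rels u) = word_class modular_rels u"
proof (induction u)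
  case Nil
  show ?case using q.hom_one
    by (simp add: trefoil_group_def modular_group_def presented_group_one)
next
  case (Cons l u)
  obtain x s where l: "l = (x, s)" by force
  have gen: "q (word_class trefoil_rels [(x, True)]) = word_class modular_rels [(x, True)]"
    using q_a q_b by (cases x) (simp_all add: trefoil_a_def trefoil_b_def modular_\<alpha>_def
      modular_\<beta>_def gen_class_def)
  have mult: "q (word_class trefoil_rels (v @ w)) =
    q (word_class trefoil_rels v) \<otimes>\<^bsub>modular_group\<^esub> q (word_class trefoil_rels w)" for v w
    using q.hom_mult[of "word_class trefoil_rels v" "word_class trefoil_rels w"]
    by (simp add: trefoil_group_def presented_group_mult presented_group_carrier)
  have l': "q (word_class trefoil_rels [l]) = word_class modular_rels [l]"
  proof (cases s)
    case True then show ?thesis using gen l by simp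
  next
    case False
    have *: "word_class R [(x, False)] = inv\<^bsub>presented_group R\<^esub> (word_class R [(x, True)])" for R :: "(two_gens gword \<times> two_gens gword) set"
      by (rule group.inv_equality[OF presented_group_group, symmetric])
        (use word_eq_cancel[of R x False] in
          \<open>auto simp: presented_group_mult presented_group_one presented_group_carrier word_class_eq_iff\<close>)
    show ?thesis
      using gen q.hom_inv[of "word_class trefoil_rels [(x, True)]"] False
      by (simp add: l * trefoil_group_def modular_group_def presented_group_carrier)
  qed
  show ?case using mult[of "[l]" u] l' Cons.IH
    by (simp add: modular_group_def presented_group_mult)
qed

lemma q_t: "q trefoil_t = \<one>\<^bsub>modular_group\<^esub>"
  using modular_relations(1) by (simp add: trefoil_t_eq_a q_a)

text \<open>The kernel of \<open>q\<close> is generated by \<open>t\<close>: in the trefoil group the relations \<open>\<alpha>\<^sup>2 = e\<close> and \<open>\<beta>\<^sup>3 = e\<close>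
each change a word by the central factor \<open>t\<close>, so every equality of words in the modular group holds
in the trefoil group up to a power of \<open>t\<close>.\<close>
lemma word_eq_modular_trefoil:
  assumes "word_eq modular_rels u v"
  shows "\<exists>k::int. word_class trefoil_rels u =
    word_class trefoil_rels v \<cdot> trefoil_t [^]\<^bsub>trefoil_group\<^esub> k"
proof -
  let ?W = "word_class trefoil_rels"
  let ?t = "trefoil_t"
  have t: "?t \<in> carrier trefoil_group" by simp
  have W: "?W u \<in> carrier trefoil_group" for u by (simp add: trefoil_group_def presented_group_carrier)
  have app: "?W (u @ v) = ?W u \<cdot> ?W v" for u v by (simp add: trefoil_group_def presented_group_mult)
  have nil: "?W [] = \<one>\<^bsub>trefoil_group\<^esub>" by (simp add: trefoil_group_def presented_group_one)
  have comm: "?t [^]\<^bsub>trefoil_group\<^esub> (k::int) \<cdot> x = x \<cdot> ?t [^]\<^bsub>trefoil_group\<^esub> k"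
    if "x \<in> carrier trefoil_group" for x k
    by (rule T.commute_int_pow[OF t that trefoil_t_central[OF that]])
  have pow: "?t [^]\<^bsub>trefoil_group\<^esub> (k::int) \<cdot> ?t [^]\<^bsub>trefoil_group\<^esub> l = ?t [^]\<^bsub>trefoil_group\<^esub> (k + l)" for k l
    using t by (simp add: T.int_pow_mult)
  have P: "?t [^]\<^bsub>trefoil_group\<^esub> (k::int) \<in> carrier trefoil_group" for k using t by (rule T.int_pow_closed)
  from assms show ?thesis
  proof (induction rule: word_eq.induct)
    case (word_eq_rel u v)
    have "?W [(Gen1, True), (Gen1, True)] = ?t"
      unfolding trefoil_t_eq_a using app[of "[(Gen1, True)]" "[(Gen1, True)]"]
      by (simp add: trefoil_a_def gen_class_def)
    moreover have "?W [(Gen2, True), (Gen2, True), (Gen2, True)] = ?t"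
      unfolding trefoil_t_eq_b using app[of "[(Gen2, True)]" "[(Gen2, True)]"]
        app[of "[(Gen2, True), (Gen2, True)]" "[(Gen2, True)]"]
      by (simp add: trefoil_b_def gen_class_def)
    ultimately have "?W u = ?W v \<cdot> ?t [^]\<^bsub>trefoil_group\<^esub> (1::int)"
      using word_eq_rel by (auto simp: modular_rels_def nil numeral_2_eq_2 numeral_3_eq_3)
    then show ?case by blast
  next
    case (word_eq_cancel x s)
    have "?W [(x, s), (x, \<not> s)] = ?W []" by (simp add: word_class_eq_iff word_eq.word_eq_cancel)
    then show ?case by (intro exI[of _ 0]) (simp add: nil)
  next
    case (word_eq_append u u' v v')
    then obtain k l :: int where kl: "?W u = ?W u' \<cdot> ?t [^]\<^bsub>trefoil_group\<^esub> k" "?W v = ?W v' \<cdot> ?t [^]\<^bsub>trefoil_group\<^esub> l"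
      by blast
    have "?W (u @ v) = ?W u' \<cdot> (?t [^]\<^bsub>trefoil_group\<^esub> k \<cdot> ?W v') \<cdot> ?t [^]\<^bsub>trefoil_group\<^esub> l"
      by (simp only: app kl T.m_assoc W P T.m_closed)
    also have "\<dots> = ?W u' \<cdot> ?W v' \<cdot> (?t [^]\<^bsub>trefoil_group\<^esub> k \<cdot> ?t [^]\<^bsub>trefoil_group\<^esub> l)"
      by (simp only: comm[OF W[of v']] T.m_assoc W P T.m_closed)
    finally have "?W (u @ v) = ?W (u' @ v') \<cdot> ?t [^]\<^bsub>trefoil_group\<^esub> (k + l)"
      by (simp only: app pow)
    then show ?case by blast
  next
    case (word_eq_refl u)
    show ?case using W by (intro exI[of _ 0]) simp
  next
    case (word_eq_sym u v)
    then obtain k :: int where "?W u = ?W v \<cdot> ?t [^]\<^bsub>trefoil_group\<^esub> k" by blast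
    then have "?W v = ?W u \<cdot> ?t [^]\<^bsub>trefoil_group\<^esub> (- k)"
      by (simp only: T.m_assoc W P pow) (use W[of v] in simp)
    then show ?case by blast
  next
    case (word_eq_trans u v w)
    then obtain k l :: int where kl: "?W u = ?W v \<cdot> ?t [^]\<^bsub>trefoil_group\<^esub> k" "?W v = ?W w \<cdot> ?t [^]\<^bsub>trefoil_group\<^esub> l"
      by blast
    then have "?W u = ?W w \<cdot> ?t [^]\<^bsub>trefoil_group\<^esub> (l + k)"
      by (simp only: T.m_assoc W P pow)
    then show ?case by blast
  qed
qed

lemma q_eq_imp:
  assumes "x \<in> carrier trefoil_group" "y \<in> carrier trefoil_group" "q x = q y"
  shows "\<exists>k::int. x = y \<cdot> trefoil_t [^]\<^bsub>trefoil_group\<^esub> k"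
proof -
  obtain u v where "x = word_class trefoil_rels u" "y = word_class trefoil_rels v"
    using assms by (auto simp: trefoil_group_def presented_group_carrier)
  then show ?thesis
    using assms(3) word_eq_modular_trefoil[of u v] by (simp add: q_word word_class_eq_iff)
qed

end

section \<open>The orientation cocycle of the circle\<close>

text \<open>This odd function counts twice the number of full turns, plus one for an incomplete turn.  Its
purpose is that the orientation of a triple on the circle is the sum of its values over the three
oriented sides of any lift of the triple to the line.\<close>
definition signed_turns :: "real \<Rightarrow> int" where
  "signed_turns x = \<lfloor>x\<rfloor> + \<lceil>x\<rceil>"

lemma signed_turns_add_int [simp]: "signed_turns (x + of_int n) = signed_turns x + 2 * n"
  by (simp add: signed_turns_def)

lemma signed_turns_diff_int [simp]: "signed_turns (x - of_int n) = signed_turns x - 2 * n"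
  by (simp add: signed_turns_def)

lemma signed_turns_minus: "signed_turns (- x) = - signed_turns x"
  by (simp add: signed_turns_def ceiling_def)

lemma signed_turns_pos_iff: "0 < signed_turns x \<longleftrightarrow> 0 < x"
proof (cases "0 < x")
  case True
  then have "0 \<le> \<lfloor>x\<rfloor>" "0 < \<lceil>x\<rceil>" by simp_all
  then have "0 < \<lfloor>x\<rfloor> + \<lceil>x\<rceil>" by (rule add_nonneg_pos)
  then show ?thesis using True by (simp add: signed_turns_def)
next
  case False
  then have "\<lfloor>x\<rfloor> \<le> 0" "\<lceil>x\<rceil> \<le> 0" by (simp_all add: floor_le_iff)
  then have "\<lfloor>x\<rfloor> + \<lceil>x\<rceil> \<le> 0" by (rule add_nonpos_nonpos)
  then show ?thesis using False by (simp add: signed_turns_def)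
qed

lemma signed_turns_zero [simp]: "signed_turns 0 = 0"
  by (simp add: signed_turns_def)

lemma signed_turns_eq_1: "0 < x \<Longrightarrow> x < 1 \<Longrightarrow> signed_turns x = 1"
  using floor_unique[of 0 x] ceiling_unique[of 1 x] by (simp add: signed_turns_def)

lemma signed_turns_cong:
  assumes "\<And>n::int. of_int n < u \<longleftrightarrow> of_int n < v" and "\<And>n::int. u < of_int n \<longleftrightarrow> v < of_int n"
  shows "signed_turns u = signed_turns v"
proof -
  have "\<lfloor>u\<rfloor> = \<lfloor>v\<rfloor>"
  proof (rule floor_unique)
    show "of_int \<lfloor>v\<rfloor> \<le> u" using assms(2)[of "\<lfloor>v\<rfloor>"] of_int_floor_le[of v] by linarith
    show "u < of_int \<lfloor>v\<rfloor> + 1" using assms(2)[of "\<lfloor>v\<rfloor> + 1"] by simp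
  qed
  moreover have "\<lceil>u\<rceil> = \<lceil>v\<rceil>"
  proof (rule ceiling_unique)
    show "of_int \<lceil>v\<rceil> - 1 < u" using assms(1)[of "\<lceil>v\<rceil> - 1"] ceiling_correct[of v] by simp
    show "u \<le> of_int \<lceil>v\<rceil>" using assms(1)[of "\<lceil>v\<rceil>"] le_of_int_ceiling[of v] by linarith
  qed
  ultimately show ?thesis by (simp add: signed_turns_def)
qed

lemma circle_proj_eq_iff: "circle_proj x = circle_proj y \<longleftrightarrow> (\<exists>n::int. y = x + of_int n)"
proof
  assume "circle_proj x = circle_proj y"
  moreover have "y \<in> circle_proj y" unfolding circle_proj_def by (rule range_eqI[of _ _ 0]) simp
  ultimately show "\<exists>n::int. y = x + of_int n" by (auto simp: circle_proj_def)
next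
  assume "\<exists>n::int. y = x + of_int n"
  then obtain n :: int where y: "y = x + of_int n" by blast
  have "x + of_int m \<in> circle_proj y" "y + of_int m \<in> circle_proj x" for m
    unfolding circle_proj_def y
    by (rule range_eqI[of _ _ "m - n"], simp, rule range_eqI[of _ _ "m + n"], simp)
  then show "circle_proj x = circle_proj y" by (auto simp: circle_proj_def)
qed

lemma anticlockwise_signed_turns:
  assumes "anticlockwise (circle_proj x1) (circle_proj x2) (circle_proj x3)"
  shows "signed_turns (x2 - x1) + signed_turns (x3 - x2) + signed_turns (x1 - x3) = 1"
proof -
  obtain y1 y2 y3 where y: "circle_proj x1 = circle_proj y1" "circle_proj x2 = circle_proj y2"
    "circle_proj x3 = circle_proj y3" "y1 < y2" "y2 < y3" "y3 < y1 + 1"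
    using assms by (auto simp: anticlockwise_def)
  obtain k l m :: int where k: "y1 = x1 + of_int k" "y2 = x2 + of_int l" "y3 = x3 + of_int m"
    using y(1-3) by (auto simp: circle_proj_eq_iff)
  have eq: "x2 - x1 = (y2 - y1) + of_int (k - l)" "x3 - x2 = (y3 - y2) + of_int (l - m)"
    "x1 - x3 = - (y3 - y1) + of_int (m - k)" by (simp_all add: k)
  have "signed_turns (y2 - y1) = 1" "signed_turns (y3 - y2) = 1" "signed_turns (y3 - y1) = 1"
    using y(4-6) by (auto intro!: signed_turns_eq_1)
  then show ?thesis unfolding eq signed_turns_add_int signed_turns_minus by simp
qed

lemma anticlockwise_cases:
  assumes "circle_proj x1 \<noteq> circle_proj x2" "circle_proj x2 \<noteq> circle_proj x3" "circle_proj x1 \<noteq> circle_proj x3"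
  shows "anticlockwise (circle_proj x1) (circle_proj x2) (circle_proj x3) \<or>
    anticlockwise (circle_proj x3) (circle_proj x2) (circle_proj x1)"
proof -
  define y2 where "y2 = x1 + frac (x2 - x1)"
  define y3 where "y3 = x1 + frac (x3 - x1)"
  have "x2 = y2 + of_int \<lfloor>x2 - x1\<rfloor>" "x3 = y3 + of_int \<lfloor>x3 - x1\<rfloor>" by (simp_all add: y2_def y3_def frac_def)
  then have p: "circle_proj x2 = circle_proj y2" "circle_proj x3 = circle_proj y3"
    by (metis circle_proj_eq_iff)+
  have b: "x1 \<le> y2" "y2 < x1 + 1" "x1 \<le> y3" "y3 < x1 + 1"
    by (auto simp: y2_def y3_def frac_lt_1)
  have ne: "y2 \<noteq> x1" "y3 \<noteq> x1" "y2 \<noteq> y3" using assms p by auto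
  have p1: "circle_proj x1 = circle_proj (x1 + 1)"
    unfolding circle_proj_eq_iff by (rule exI[of _ 1]) simp
  consider "y2 < y3" | "y3 < y2" using ne by linarith
  then show ?thesis
  proof cases
    case 1
    then have "anticlockwise (circle_proj x1) (circle_proj x2) (circle_proj x3)"
      unfolding anticlockwise_def p using b ne by (intro exI[of _ x1] exI[of _ y2] exI[of _ y3]) auto
    then show ?thesis ..
  next
    case 2
    then have "anticlockwise (circle_proj x3) (circle_proj x2) (circle_proj x1)"
      unfolding anticlockwise_def p p1 using b ne
      by (intro exI[of _ y3] exI[of _ y2] exI[of _ "x1 + 1"]) auto
    then show ?thesis ..
  qed
qed

text \<open>The right-hand side is unchanged when one of the points moves by an integer, so it may be computed
on a lift within one period.  As a sum over oriented sides of an odd function, it makes the cocycle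
identity for the orientation a matter of cancellation.\<close>
lemma circle_orientation_signed_turns:
  "circle_orientation (circle_proj x1) (circle_proj x2) (circle_proj x3) =
     signed_turns (x2 - x1) + signed_turns (x3 - x2) + signed_turns (x1 - x3)"
proof -
  have odd: "signed_turns (x - y) = - signed_turns (y - x)" for x y
    using signed_turns_minus[of "y - x"] by simp
  consider "anticlockwise (circle_proj x1) (circle_proj x2) (circle_proj x3)"
    | "anticlockwise (circle_proj x3) (circle_proj x2) (circle_proj x1)"
      "\<not> anticlockwise (circle_proj x1) (circle_proj x2) (circle_proj x3)"
    | "\<not> anticlockwise (circle_proj x3) (circle_proj x2) (circle_proj x1)"
      "\<not> anticlockwise (circle_proj x1) (circle_proj x2) (circle_proj x3)" by blast
  then show ?thesis
  proof cases
    case 1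
    then show ?thesis using anticlockwise_signed_turns by (simp add: circle_orientation_def)
  next
    case 2
    then show ?thesis
      using anticlockwise_signed_turns[OF 2(1)] odd[of x1 x2] odd[of x2 x3] odd[of x3 x1]
      by (simp add: circle_orientation_def)
  next
    case 3
    then consider "circle_proj x1 = circle_proj x2" | "circle_proj x2 = circle_proj x3"
      | "circle_proj x1 = circle_proj x3" using anticlockwise_cases by blast
    then have "signed_turns (x2 - x1) + signed_turns (x3 - x2) + signed_turns (x1 - x3) = 0"
    proof cases
      case 1
      then obtain n :: int where "x2 = x1 + of_int n" by (auto simp: circle_proj_eq_iff)
      then have "x2 - x1 = 0 + of_int n" "x3 - x2 = (x3 - x1) - of_int n" by simp_all
      then show ?thesis unfolding odd[of x1 x3] by (simp only: signed_turns_add_int signed_turns_diff_int) simp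
    next
      case 2
      then obtain n :: int where "x3 = x2 + of_int n" by (auto simp: circle_proj_eq_iff)
      then have "x3 - x2 = 0 + of_int n" "x1 - x3 = (x1 - x2) - of_int n" by simp_all
      then show ?thesis unfolding odd[of x2 x1] by (simp only: signed_turns_add_int signed_turns_diff_int) simp
    next
      case 3
      then obtain n :: int where "x3 = x1 + of_int n" by (auto simp: circle_proj_eq_iff)
      then have "x1 - x3 = 0 - of_int n" "x3 - x2 = (x1 - x2) + of_int n" by simp_all
      then show ?thesis unfolding odd[of x2 x1] by (simp only: signed_turns_add_int signed_turns_diff_int) simp
    qed
    then show ?thesis using 3 by (simp add: circle_orientation_def)
  qed
qed

lemma circle_orientation_eq_0_iff:
  "circle_orientation (circle_proj x1) (circle_proj x2) (circle_proj x3) = 0 \<longleftrightarrow>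
     circle_proj x1 = circle_proj x2 \<or> circle_proj x2 = circle_proj x3 \<or> circle_proj x1 = circle_proj x3"
proof
  assume "circle_orientation (circle_proj x1) (circle_proj x2) (circle_proj x3) = 0"
  then show "circle_proj x1 = circle_proj x2 \<or> circle_proj x2 = circle_proj x3 \<or> circle_proj x1 = circle_proj x3"
    using anticlockwise_cases[of x1 x2 x3] by (auto simp: circle_orientation_def split: if_splits)
next
  have ne: "y1 \<noteq> y2 \<and> y2 \<noteq> y3 \<and> y1 \<noteq> y3" if "anticlockwise y1 y2 y3" for y1 y2 y3
  proof -
    obtain x1 x2 x3 where x: "y1 = circle_proj x1" "y2 = circle_proj x2" "y3 = circle_proj x3"
      "x1 < x2" "x2 < x3" "x3 < x1 + 1" using \<open>anticlockwise y1 y2 y3\<close> unfolding anticlockwise_def by blast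
    have "circle_proj x \<noteq> circle_proj y" if "x < y" "y < x + 1" for x y
    proof
      assume "circle_proj x = circle_proj y"
      then obtain n :: int where "y = x + of_int n" by (auto simp: circle_proj_eq_iff)
      then have "0 < real_of_int n" "real_of_int n < 1" using that by linarith+
      then have "0 < n" "n < 1" by (simp_all only: of_int_0_less_iff of_int_less_1_iff)
      then show False by simp
    qed
    from this[of x1 x2] this[of x2 x3] this[of x1 x3] show ?thesis
      using x(4-6) unfolding x(1-3) by simp
  qed
  assume "circle_proj x1 = circle_proj x2 \<or> circle_proj x2 = circle_proj x3 \<or> circle_proj x1 = circle_proj x3"
  then show "circle_orientation (circle_proj x1) (circle_proj x2) (circle_proj x3) = 0"
    using ne[of "circle_proj x1" "circle_proj x2" "circle_proj x3"]
      ne[of "circle_proj x3" "circle_proj x2" "circle_proj x1"]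
    by (auto simp: circle_orientation_def)
qed

section \<open>Left invariant circular orders\<close>

locale circularly_ordered_group = group H for H (structure) +
  fixes c :: "'b \<times> 'b \<times> 'b \<Rightarrow> int"
  assumes c_CO: "c \<in> CO H"
begin

lemma c_eq_0_iff:
  assumes "g1 \<in> carrier H" "g2 \<in> carrier H" "g3 \<in> carrier H"
  shows "c (g1, g2, g3) = 0 \<longleftrightarrow> g1 = g2 \<or> g2 = g3 \<or> g1 = g3"
  using c_CO assms unfolding CO_def by blast

lemma c_range:
  assumes "g1 \<in> carrier H" "g2 \<in> carrier H" "g3 \<in> carrier H"
  shows "c (g1, g2, g3) \<in> {0, 1, -1}"
  using c_CO assms unfolding CO_def by blast

lemma c_cocycle:
  assumes "g1 \<in> carrier H" "g2 \<in> carrier H" "g3 \<in> carrier H" "g4 \<in> carrier H"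
  shows "c (g2, g3, g4) - c (g1, g3, g4) + c (g1, g2, g4) - c (g1, g2, g3) = 0"
  using c_CO assms unfolding CO_def by blast

lemma c_mult_left:
  assumes "g1 \<in> carrier H" "g2 \<in> carrier H" "g3 \<in> carrier H" "g4 \<in> carrier H"
  shows "c (g4 \<otimes> g1, g4 \<otimes> g2, g4 \<otimes> g3) = c (g1, g2, g3)"
  using c_CO assms unfolding CO_def by blast

text \<open>The central extension of \<open>H\<close> by the integers with cocycle \<open>- c (e, g, g h)\<close>.  The customary lift of
a circularly ordered group to a left ordered one uses an integer cocycle with values \<open>0\<close> and \<open>1\<close>;
the present one is, up to a coboundary, twice that cocycle.  In exchange, the sign of the first component
alone will decide positivity.\<close>
definition circular_extension :: "(int \<times> 'b) monoid" where
  "circular_extension = \<lparr>carrier = UNIV \<times> carrier H,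
     mult = (\<lambda>(m, g) (n, h). (m + n - c (\<one>, g, g \<otimes> h), g \<otimes> h)), one = (0, \<one>)\<rparr>"

lemma circular_extension_mult [simp]:
  "(m, g) \<otimes>\<^bsub>circular_extension\<^esub> (n, h) = (m + n - c (\<one>, g, g \<otimes> h), g \<otimes> h)"
  by (simp add: circular_extension_def)

lemma circular_extension_carrier [simp]: "carrier circular_extension = UNIV \<times> carrier H"
  by (simp add: circular_extension_def)

lemma circular_extension_one [simp]: "\<one>\<^bsub>circular_extension\<^esub> = (0, \<one>)"
  by (simp add: circular_extension_def)

lemma circular_extension_group: "group circular_extension"
proof (rule groupI)
  fix x y w
  assume "x \<in> carrier circular_extension" "y \<in> carrier circular_extension" "w \<in> carrier circular_extension"
  then obtain l g m h n k where x: "x = (l, g)" "y = (m, h)" "w = (n, k)"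
    and cl: "g \<in> carrier H" "h \<in> carrier H" "k \<in> carrier H" by auto
  have "c (\<one>, h, h \<otimes> k) = c (g, g \<otimes> h, g \<otimes> h \<otimes> k)"
    using c_mult_left[of \<one> h "h \<otimes> k" g] cl by (simp add: m_assoc)
  then show "x \<otimes>\<^bsub>circular_extension\<^esub> y \<otimes>\<^bsub>circular_extension\<^esub> w =
      x \<otimes>\<^bsub>circular_extension\<^esub> (y \<otimes>\<^bsub>circular_extension\<^esub> w)"
    using c_cocycle[of \<one> g "g \<otimes> h" "g \<otimes> h \<otimes> k"] cl by (simp add: x m_assoc)
next
  fix x assume "x \<in> carrier circular_extension"
  then obtain m g where x: "x = (m, g)" "g \<in> carrier H" by auto
  then have "c (\<one>, inv g, \<one>) = 0" by (simp add: c_eq_0_iff)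
  then show "\<exists>y\<in>carrier circular_extension. y \<otimes>\<^bsub>circular_extension\<^esub> x = \<one>\<^bsub>circular_extension\<^esub>"
    using x by (intro bexI[of _ "(- m, inv g)"]) auto
qed (auto simp: c_eq_0_iff)

end

section \<open>The height function of a circular order of the modular group\<close>

context trefoil_cover
begin

abbreviation G where "G \<equiv> trefoil_group"
abbreviation H where "H \<equiv> modular_group"

text \<open>A circular order rotates \<open>\<beta>\<close> by one third of a turn, either anticlockwise or clockwise; this sign tells
the two cases apart.\<close>
abbreviation handedness :: "(two_gens gword set \<times> two_gens gword set \<times> two_gens gword set \<Rightarrow> int) \<Rightarrow> int" where
  "handedness c \<equiv> c (\<one>\<^bsub>H\<^esub>, modular_\<beta>, modular_\<beta> \<otimes>\<^bsub>H\<^esub> modular_\<beta>)"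

text \<open>A height is a quasimorphism whose defect is the circular order.  It arises from a homomorphism of the
trefoil group to the central extension above that lifts \<open>q\<close>.  The values at \<open>a\<close> and \<open>b\<close> have to
respect the relation \<open>a\<^sup>2 = b\<^sup>3\<close>: with \<open>m = M a\<close>, \<open>n = M b\<close> and \<open>s\<close> the handedness it says \<open>2 m = 3 n - s\<close>,
and \<open>m = n = s\<close> is the solution for which \<open>t\<close> is a single full turn.\<close>
definition is_height ::
  "(two_gens gword set \<times> two_gens gword set \<times> two_gens gword set \<Rightarrow> int) \<Rightarrow> (two_gens gword set \<Rightarrow> int) \<Rightarrow> bool" where
  "is_height c M \<longleftrightarrow>
     (\<forall>x\<in>carrier G. \<forall>y\<in>carrier G. M (x \<otimes>\<^bsub>G\<^esub> y) = M x + M y - c (\<one>\<^bsub>H\<^esub>, q x, q (x \<otimes>\<^bsub>G\<^esub> y))) \<and>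
     M trefoil_a = handedness c \<and> M trefoil_b = handedness c"

definition height ::
  "(two_gens gword set \<times> two_gens gword set \<times> two_gens gword set \<Rightarrow> int) \<Rightarrow> two_gens gword set \<Rightarrow> int" where
  "height c = (SOME M. is_height c M)"

lemma is_height_mult:
  "is_height c M \<Longrightarrow> x \<in> carrier G \<Longrightarrow> y \<in> carrier G \<Longrightarrow>
     M (x \<otimes>\<^bsub>G\<^esub> y) = M x + M y - c (\<one>\<^bsub>H\<^esub>, q x, q (x \<otimes>\<^bsub>G\<^esub> y))"
  by (simp add: is_height_def)

lemma is_height_one: "is_height c M \<Longrightarrow> M \<one>\<^bsub>G\<^esub> = c (\<one>\<^bsub>H\<^esub>, \<one>\<^bsub>H\<^esub>, \<one>\<^bsub>H\<^esub>)"
  using is_height_mult[of c M "\<one>\<^bsub>G\<^esub>" "\<one>\<^bsub>G\<^esub>"] by simp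

lemma is_height_inv:
  "is_height c M \<Longrightarrow> x \<in> carrier G \<Longrightarrow>
     M (inv\<^bsub>G\<^esub> x) = c (\<one>\<^bsub>H\<^esub>, \<one>\<^bsub>H\<^esub>, \<one>\<^bsub>H\<^esub>) + c (\<one>\<^bsub>H\<^esub>, q (inv\<^bsub>G\<^esub> x), \<one>\<^bsub>H\<^esub>) - M x"
  using is_height_mult[of c M "inv\<^bsub>G\<^esub> x" x] is_height_one[of c M] by simp

text \<open>The defect formula computes the height of a product of generators step by step from finitely many
values of \<open>c\<close>.  With \<open>c = c'\<close> this is the uniqueness of the height; with varying \<open>c\<close> it is the
continuity of the inverse of the map under study.\<close>
lemma height_local:
  assumes "x \<in> carrier G"
  shows "\<exists>F. finite F \<and> F \<subseteq> carrier H \<times> carrier H \<times> carrier H \<and>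
    (\<forall>c c' M M'. is_height c M \<longrightarrow> is_height c' M' \<longrightarrow> (\<forall>i\<in>F. c i = c' i) \<longrightarrow> M x = M' x)"
proof -
  let ?local = "\<lambda>x F. \<forall>c c' M M'. is_height c M \<longrightarrow> is_height c' M' \<longrightarrow> (\<forall>i\<in>F. c i = c' i) \<longrightarrow> M x = M' x"
  let ?C = "carrier H \<times> carrier H \<times> carrier H"
  let ?one = "(\<one>\<^bsub>H\<^esub>, \<one>\<^bsub>H\<^esub>, \<one>\<^bsub>H\<^esub>)"
  let ?h = "(\<one>\<^bsub>H\<^esub>, modular_\<beta>, modular_\<beta> \<otimes>\<^bsub>H\<^esub> modular_\<beta>)"
  have mult: "\<exists>F. finite F \<and> F \<subseteq> ?C \<and> ?local (y \<otimes>\<^bsub>G\<^esub> x) F"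
    if y: "y \<in> carrier G" "finite Fy" "Fy \<subseteq> ?C" "?local y Fy"
      and x: "x \<in> carrier G" and IH: "\<exists>F. finite F \<and> F \<subseteq> ?C \<and> ?local x F" for x y Fy
  proof -
    obtain Fx where Fx: "finite Fx" "Fx \<subseteq> ?C" "?local x Fx" using IH by blast
    let ?F = "insert (\<one>\<^bsub>H\<^esub>, q y, q (y \<otimes>\<^bsub>G\<^esub> x)) (Fx \<union> Fy)"
    have "?local (y \<otimes>\<^bsub>G\<^esub> x) ?F"
    proof (intro allI impI)
      fix c c' M M' assume M: "is_height c M" "is_height c' M'" "\<forall>i\<in>?F. c i = c' i"
      have "M x = M' x" using Fx(3) M by blast
      moreover have "M y = M' y" using y(4) M by blast
      ultimately show "M (y \<otimes>\<^bsub>G\<^esub> x) = M' (y \<otimes>\<^bsub>G\<^esub> x)"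
        using M by (simp add: is_height_mult[OF _ y(1) x])
    qed
    then show ?thesis using Fx y x by (intro exI[of _ ?F]) auto
  qed
  have inv: "?local (inv\<^bsub>G\<^esub> y) {?h, ?one, (\<one>\<^bsub>H\<^esub>, q (inv\<^bsub>G\<^esub> y), \<one>\<^bsub>H\<^esub>)}"
    if "y \<in> {trefoil_a, trefoil_b}" for y
  proof (intro allI impI)
    fix c c' M M' assume M: "is_height c M" "is_height c' M'"
      "\<forall>i\<in>{?h, ?one, (\<one>\<^bsub>H\<^esub>, q (inv\<^bsub>G\<^esub> y), \<one>\<^bsub>H\<^esub>)}. c i = c' i"
    have "M y = M' y" using that M by (auto simp: is_height_def)
    moreover have "y \<in> carrier G" using that by auto
    ultimately show "M (inv\<^bsub>G\<^esub> y) = M' (inv\<^bsub>G\<^esub> y)"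
      using M(3) is_height_inv[OF M(1), of y] is_height_inv[OF M(2), of y] by simp
  qed
  from assms show ?thesis
  proof (induction rule: trefoil_induct)
    case one
    show ?case by (rule exI[of _ "{?one}"]) (auto simp: is_height_one)
  next
    case (a x)
    then show ?case by (intro mult[of _ "{?h}"]) (auto simp: is_height_def)
  next
    case (b x)
    then show ?case by (intro mult[of _ "{?h}"]) (auto simp: is_height_def)
  next
    case (inv_a x)
    show ?case
      by (rule mult[OF _ _ _ inv[of trefoil_a] inv_a]) auto
  next
    case (inv_b x)
    show ?case
      by (rule mult[OF _ _ _ inv[of trefoil_b] inv_b]) auto
  qed
qed

lemma is_height_unique:
  "is_height c M \<Longrightarrow> is_height c M' \<Longrightarrow> x \<in> carrier G \<Longrightarrow> M x = M' x"
  using height_local[of x] by blast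

end

locale trefoil_circular = trefoil_cover q + circularly_ordered_group modular_group c for q c
begin

lemma handedness: "handedness c = 1 \<or> handedness c = -1"
proof -
  have "modular_\<beta> \<otimes>\<^bsub>H\<^esub> modular_\<beta> \<noteq> \<one>\<^bsub>H\<^esub>"
  proof
    assume "modular_\<beta> \<otimes>\<^bsub>H\<^esub> modular_\<beta> = \<one>\<^bsub>H\<^esub>"
    then show False using modular_relations(2) modular_generators_nontrivial(2) by simp
  qed
  then have "handedness c \<noteq> 0"
    using modular_generators_nontrivial(2) by (auto simp: c_eq_0_iff)
  then show ?thesis using c_range[of "\<one>\<^bsub>H\<^esub>" modular_\<beta> "modular_\<beta> \<otimes>\<^bsub>H\<^esub> modular_\<beta>"] by auto
qed

lemma height_exists: "\<exists>M. is_height c M"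
proof -
  interpret E: group circular_extension by (rule circular_extension_group)
  let ?f = "case_two_gens (handedness c, modular_\<alpha>) (handedness c, modular_\<beta>)"
  have zero: "c (g, g, h) = 0" "c (g, h, g) = 0" "c (g, h, h) = 0" if "g \<in> carrier H" "h \<in> carrier H" for g h
    using that by (simp_all add: c_eq_0_iff)
  have "\<exists>\<Theta>\<in>hom (presented_group trefoil_rels) circular_extension.
      \<forall>x. \<Theta> (gen_class trefoil_rels x) = ?f x"
  proof (rule E.presented_group_lift)
    have "?f x \<in> carrier circular_extension" for x by (cases x) simp_all
    then show "range ?f \<subseteq> carrier circular_extension" by blast
    show "word_eval circular_extension ?f u = word_eval circular_extension ?f v"
      if "(u, v) \<in> trefoil_rels" for u v
      using that modular_relations
      by (auto simp: trefoil_rels_def word_eval_def numeral_2_eq_2 numeral_3_eq_3 zero Q.m_assoc)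
  qed
  then obtain \<Theta> where hom: "\<Theta> \<in> hom G circular_extension"
    and \<Theta>: "\<Theta> trefoil_a = (handedness c, modular_\<alpha>)" "\<Theta> trefoil_b = (handedness c, modular_\<beta>)"
    unfolding trefoil_group_def trefoil_a_def trefoil_b_def by (metis two_gens.case)
  interpret \<Theta>: group_hom G circular_extension \<Theta>
    by (simp add: group_hom_def group_hom_axioms_def hom trefoil_group E.is_group)
  have snd_mult: "snd (X \<otimes>\<^bsub>circular_extension\<^esub> Y) = snd X \<otimes>\<^bsub>H\<^esub> snd Y" for X Y
    by (cases X; cases Y) simp
  have closed: "snd (\<Theta> x) \<in> carrier H" if "x \<in> carrier G" for x
    using \<Theta>.hom_closed[OF that] by auto
  have inv: "snd (\<Theta> (inv\<^bsub>G\<^esub> x)) = inv\<^bsub>H\<^esub> (snd (\<Theta> x))" if "x \<in> carrier G" for x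
  proof (rule Q.inv_equality[symmetric])
    show "snd (\<Theta> (inv\<^bsub>G\<^esub> x)) \<otimes>\<^bsub>H\<^esub> snd (\<Theta> x) = \<one>\<^bsub>H\<^esub>"
    proof -
      have "\<Theta> (inv\<^bsub>G\<^esub> x) \<otimes>\<^bsub>circular_extension\<^esub> \<Theta> x = (0, \<one>\<^bsub>H\<^esub>)"
        using \<Theta>.hom_mult[of "inv\<^bsub>G\<^esub> x" x] \<Theta>.hom_one that by simp
      then show ?thesis unfolding snd_mult[symmetric] by simp
    qed
  qed (intro closed T.inv_closed that)+
  have q: "snd (\<Theta> x) = q x" if "x \<in> carrier G" for x
    using that by (induction rule: trefoil_induct) (simp_all add: snd_mult inv \<Theta> q_a q_b del: \<Theta>.hom_inv)
  have "is_height c (\<lambda>x. fst (\<Theta> x))"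
    unfolding is_height_def
  proof (intro conjI ballI)
    fix x y assume xy: "x \<in> carrier G" "y \<in> carrier G"
    obtain m n where "\<Theta> x = (m, q x)" "\<Theta> y = (n, q y)" using q xy by (metis prod.collapse)
    then show "fst (\<Theta> (x \<otimes>\<^bsub>G\<^esub> y)) = fst (\<Theta> x) + fst (\<Theta> y) - c (\<one>\<^bsub>H\<^esub>, q x, q (x \<otimes>\<^bsub>G\<^esub> y))"
      using xy by simp
  qed (simp_all add: \<Theta>)
  then show ?thesis by blast
qed

abbreviation M where "M \<equiv> height c"

lemma is_height: "is_height c M"
  unfolding height_def using height_exists by (rule someI_ex)

lemmas M_mult = is_height_mult[OF is_height]

lemma M_one [simp]: "M \<one>\<^bsub>G\<^esub> = 0"
  using is_height_one[OF is_height] by (simp add: c_eq_0_iff)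

lemma M_inv: "x \<in> carrier G \<Longrightarrow> M (inv\<^bsub>G\<^esub> x) = - M x"
  using is_height_inv[OF is_height, of x] c_eq_0_iff[of "\<one>\<^bsub>H\<^esub>" "\<one>\<^bsub>H\<^esub>" "\<one>\<^bsub>H\<^esub>"]
    c_eq_0_iff[of "\<one>\<^bsub>H\<^esub>" "q (inv\<^bsub>G\<^esub> x)" "\<one>\<^bsub>H\<^esub>"] by simp

lemma M_a: "M trefoil_a = handedness c" and M_b: "M trefoil_b = handedness c"
  using is_height by (auto simp: is_height_def)

lemma M_t: "M trefoil_t = 2 * handedness c"
  using M_mult[of trefoil_a trefoil_a] q_t by (simp add: trefoil_t_eq_a M_a q_a c_eq_0_iff)

lemma M_mult_t_pow:
  assumes x: "x \<in> carrier G"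
  shows "M (x \<otimes>\<^bsub>G\<^esub> trefoil_t [^]\<^bsub>G\<^esub> (k::int)) = M x + 2 * k * handedness c"
proof -
  have t: "trefoil_t \<in> carrier G" by simp
  have step: "M (y \<otimes>\<^bsub>G\<^esub> trefoil_t) = M y + 2 * handedness c" if "y \<in> carrier G" for y
    using M_mult[OF that t] that q_t by (simp add: M_t c_eq_0_iff del: T.nat_pow_Suc)
  have split: "x \<otimes>\<^bsub>G\<^esub> trefoil_t [^]\<^bsub>G\<^esub> (i + 1) = (x \<otimes>\<^bsub>G\<^esub> trefoil_t [^]\<^bsub>G\<^esub> i) \<otimes>\<^bsub>G\<^esub> trefoil_t" for i :: int
    using T.int_pow_mult[OF t, of i 1] T.int_pow_1[OF t] T.m_assoc[OF x T.int_pow_closed[OF t, of i] t] by argo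
  have s: "M (x \<otimes>\<^bsub>G\<^esub> trefoil_t [^]\<^bsub>G\<^esub> (i + 1)) = M (x \<otimes>\<^bsub>G\<^esub> trefoil_t [^]\<^bsub>G\<^esub> i) + 2 * handedness c" for i :: int
    unfolding split by (rule step) (intro T.m_closed x T.int_pow_closed t)
  show ?thesis
  proof (induction k rule: int_induct[of _ 0])
    case base
    show ?case using x by simp
  next
    case (step1 i)
    then show ?case using s[of i] by (simp add: algebra_simps)
  next
    case (step2 i)
    then show ?case using s[of "i - 1"] by (simp add: algebra_simps)
  qed
qed

text \<open>The values of \<open>c\<close> are odd except at degenerate triples, and this is what parity needs to pass
from the factors to the product.\<close>
lemma M_even_iff: "x \<in> carrier G \<Longrightarrow> even (M x) \<longleftrightarrow> q x = \<one>\<^bsub>H\<^esub>"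
proof -
  assume "x \<in> carrier G"
  have gens: "odd (M trefoil_a)" "odd (M trefoil_b)"
    using handedness by (auto simp: M_a M_b)
  have mult: "even (M (y \<otimes>\<^bsub>G\<^esub> x)) \<longleftrightarrow> q (y \<otimes>\<^bsub>G\<^esub> x) = \<one>\<^bsub>H\<^esub>"
    if y: "y \<in> carrier G" "even (M y) \<longleftrightarrow> q y = \<one>\<^bsub>H\<^esub>"
      and x: "x \<in> carrier G" "even (M x) \<longleftrightarrow> q x = \<one>\<^bsub>H\<^esub>" for x y
  proof -
    let ?c = "c (\<one>\<^bsub>H\<^esub>, q y, q (y \<otimes>\<^bsub>G\<^esub> x))"
    have cl: "q x \<in> carrier H" "q y \<in> carrier H" using x y by auto
    have "q y = q (y \<otimes>\<^bsub>G\<^esub> x) \<longleftrightarrow> q x = \<one>\<^bsub>H\<^esub>" using x(1) y(1) cl by auto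
    then have zero: "?c = 0 \<longleftrightarrow> q y = \<one>\<^bsub>H\<^esub> \<or> q x = \<one>\<^bsub>H\<^esub> \<or> q (y \<otimes>\<^bsub>G\<^esub> x) = \<one>\<^bsub>H\<^esub>"
      using c_eq_0_iff[of "\<one>\<^bsub>H\<^esub>" "q y" "q (y \<otimes>\<^bsub>G\<^esub> x)"] x(1) y(1) cl by auto
    have c: "even ?c \<longleftrightarrow> ?c = 0"
      using c_range[of "\<one>\<^bsub>H\<^esub>" "q y" "q (y \<otimes>\<^bsub>G\<^esub> x)"] x(1) y(1) cl by auto
    have "q x = \<one>\<^bsub>H\<^esub> \<and> q y = \<one>\<^bsub>H\<^esub> \<longrightarrow> q (y \<otimes>\<^bsub>G\<^esub> x) = \<one>\<^bsub>H\<^esub>"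
      "q x = \<one>\<^bsub>H\<^esub> \<and> q y \<noteq> \<one>\<^bsub>H\<^esub> \<longrightarrow> q (y \<otimes>\<^bsub>G\<^esub> x) \<noteq> \<one>\<^bsub>H\<^esub>"
      "q x \<noteq> \<one>\<^bsub>H\<^esub> \<and> q y = \<one>\<^bsub>H\<^esub> \<longrightarrow> q (y \<otimes>\<^bsub>G\<^esub> x) \<noteq> \<one>\<^bsub>H\<^esub>"
      using x(1) y(1) cl by auto
    then show ?thesis
      unfolding M_mult[OF y(1) x(1)] by (simp only: even_diff even_add x(2) y(2) c zero) blast
  qed
  have nontriv: "q trefoil_a \<noteq> \<one>\<^bsub>H\<^esub>" "q trefoil_b \<noteq> \<one>\<^bsub>H\<^esub>"
    using modular_generators_nontrivial by (auto simp: q_a q_b)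
  have ninv: "q (inv\<^bsub>G\<^esub> y) \<noteq> \<one>\<^bsub>H\<^esub>" if "y \<in> carrier G" "q y \<noteq> \<one>\<^bsub>H\<^esub>" for y
    using that by (simp add: Q.inv_eq_1_iff)
  from \<open>x \<in> carrier G\<close> show ?thesis
  proof (induction rule: trefoil_induct)
    case one
    show ?case by simp
  next
    case (a x)
    then show ?case using gens nontriv by (intro mult) auto
  next
    case (b x)
    then show ?case using gens nontriv by (intro mult) auto
  next
    case (inv_a x)
    then show ?case using gens nontriv ninv by (intro mult) (auto simp: M_inv)
  next
    case (inv_b x)
    then show ?case using gens nontriv ninv by (intro mult) (auto simp: M_inv)
  qed
qed

text \<open>By parity an element of height \<open>0\<close> is in the kernel of \<open>q\<close>, hence a power of \<open>t\<close>; but the height of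
\<open>t\<^sup>k\<close> is \<open>\<plusminus> 2 k\<close>.\<close>
lemma M_eq_0_iff: "x \<in> carrier G \<Longrightarrow> M x = 0 \<longleftrightarrow> x = \<one>\<^bsub>G\<^esub>"
proof
  assume x: "x \<in> carrier G" "M x = 0"
  then have "q x = q \<one>\<^bsub>G\<^esub>" using M_even_iff[of x] by simp
  then obtain k :: int where k: "x = \<one>\<^bsub>G\<^esub> \<otimes>\<^bsub>G\<^esub> trefoil_t [^]\<^bsub>G\<^esub> k"
    using q_eq_imp[of x "\<one>\<^bsub>G\<^esub>"] x by auto
  then have "k = 0" using M_mult_t_pow[of "\<one>\<^bsub>G\<^esub>" k] x handedness by auto
  then show "x = \<one>\<^bsub>G\<^esub>" using k by simp
qed simp

text \<open>The circular order is the coboundary of its height, so the height determines it.\<close>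
lemma c_from_M:
  assumes "x \<in> carrier G" "y \<in> carrier G" "w \<in> carrier G"
  shows "c (q x, q y, q w) = M (inv\<^bsub>G\<^esub> x \<otimes>\<^bsub>G\<^esub> y) + M (inv\<^bsub>G\<^esub> y \<otimes>\<^bsub>G\<^esub> w) - M (inv\<^bsub>G\<^esub> x \<otimes>\<^bsub>G\<^esub> w)"
proof -
  have "inv\<^bsub>G\<^esub> x \<otimes>\<^bsub>G\<^esub> y \<otimes>\<^bsub>G\<^esub> (inv\<^bsub>G\<^esub> y \<otimes>\<^bsub>G\<^esub> w) = inv\<^bsub>G\<^esub> x \<otimes>\<^bsub>G\<^esub> (y \<otimes>\<^bsub>G\<^esub> inv\<^bsub>G\<^esub> y) \<otimes>\<^bsub>G\<^esub> w"
    using assms by (simp only: T.m_assoc T.inv_closed T.m_closed)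
  then have "inv\<^bsub>G\<^esub> x \<otimes>\<^bsub>G\<^esub> y \<otimes>\<^bsub>G\<^esub> (inv\<^bsub>G\<^esub> y \<otimes>\<^bsub>G\<^esub> w) = inv\<^bsub>G\<^esub> x \<otimes>\<^bsub>G\<^esub> w"
    using assms by simp
  then have "M (inv\<^bsub>G\<^esub> x \<otimes>\<^bsub>G\<^esub> w) = M (inv\<^bsub>G\<^esub> x \<otimes>\<^bsub>G\<^esub> y) + M (inv\<^bsub>G\<^esub> y \<otimes>\<^bsub>G\<^esub> w) -
      c (\<one>\<^bsub>H\<^esub>, q (inv\<^bsub>G\<^esub> x \<otimes>\<^bsub>G\<^esub> y), q (inv\<^bsub>G\<^esub> x \<otimes>\<^bsub>G\<^esub> w))"
    using M_mult[of "inv\<^bsub>G\<^esub> x \<otimes>\<^bsub>G\<^esub> y" "inv\<^bsub>G\<^esub> y \<otimes>\<^bsub>G\<^esub> w"] assms by simp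
  moreover have "c (\<one>\<^bsub>H\<^esub>, q (inv\<^bsub>G\<^esub> x \<otimes>\<^bsub>G\<^esub> y), q (inv\<^bsub>G\<^esub> x \<otimes>\<^bsub>G\<^esub> w)) = c (q x, q y, q w)"
    using c_mult_left[of "q x" "q y" "q w" "inv\<^bsub>H\<^esub> (q x)"] assms by simp
  ultimately show ?thesis by simp
qed

definition height_order :: "two_gens gword set rel" where
  "height_order = {(x, y). x \<in> carrier G \<and> y \<in> carrier G \<and> 0 < M (inv\<^bsub>G\<^esub> x \<otimes>\<^bsub>G\<^esub> y)}"

text \<open>Positive elements are closed under products because heights are integers and the defect is at most \<open>1\<close>.
Totality holds because only the identity has height \<open>0\<close> and inversion changes the sign of the height.\<close>
lemma left_order_height_order: "left_order G height_order"
proof -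
  have "trans height_order"
  proof (rule transI)
    fix x y w assume "(x, y) \<in> height_order" "(y, w) \<in> height_order"
    then have xyw: "x \<in> carrier G" "y \<in> carrier G" "w \<in> carrier G"
      and pos: "0 < M (inv\<^bsub>G\<^esub> x \<otimes>\<^bsub>G\<^esub> y)" "0 < M (inv\<^bsub>G\<^esub> y \<otimes>\<^bsub>G\<^esub> w)" by (auto simp: height_order_def)
    have "c (q x, q y, q w) \<in> {0, 1, -1}" using xyw by (intro c_range) auto
    then have "c (q x, q y, q w) \<le> 1" by auto
    then show "(x, w) \<in> height_order" using c_from_M[OF xyw] pos xyw by (simp add: height_order_def)
  qed
  moreover have "irrefl height_order" by (auto simp: irrefl_def height_order_def)
  moreover have "(x, y) \<in> height_order \<or> (y, x) \<in> height_order"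
    if xy: "x \<in> carrier G" "y \<in> carrier G" "x \<noteq> y" for x y
  proof -
    have "M (inv\<^bsub>G\<^esub> x \<otimes>\<^bsub>G\<^esub> y) \<noteq> 0"
    proof
      assume "M (inv\<^bsub>G\<^esub> x \<otimes>\<^bsub>G\<^esub> y) = 0"
      then have "inv\<^bsub>G\<^esub> x \<otimes>\<^bsub>G\<^esub> y = \<one>\<^bsub>G\<^esub>" using xy M_eq_0_iff by simp
      then show False using xy by (metis T.inv_closed T.inv_equality T.inv_inv)
    qed
    moreover have "M (inv\<^bsub>G\<^esub> y \<otimes>\<^bsub>G\<^esub> x) = - M (inv\<^bsub>G\<^esub> x \<otimes>\<^bsub>G\<^esub> y)"
      using M_inv[of "inv\<^bsub>G\<^esub> x \<otimes>\<^bsub>G\<^esub> y"] xy by (simp add: T.inv_mult_group)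
    ultimately show ?thesis using xy by (auto simp: height_order_def)
  qed
  moreover have "(h \<otimes>\<^bsub>G\<^esub> x, h \<otimes>\<^bsub>G\<^esub> y) \<in> height_order" if "h \<in> carrier G" "(x, y) \<in> height_order" for h x y
  proof -
    have xy: "x \<in> carrier G" "y \<in> carrier G" using that by (auto simp: height_order_def)
    have "inv\<^bsub>G\<^esub> (h \<otimes>\<^bsub>G\<^esub> x) \<otimes>\<^bsub>G\<^esub> (h \<otimes>\<^bsub>G\<^esub> y) = inv\<^bsub>G\<^esub> x \<otimes>\<^bsub>G\<^esub> (inv\<^bsub>G\<^esub> h \<otimes>\<^bsub>G\<^esub> h) \<otimes>\<^bsub>G\<^esub> y"
      using xy that(1) by (simp only: T.inv_mult_group T.m_assoc T.inv_closed T.m_closed)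
    then have "inv\<^bsub>G\<^esub> (h \<otimes>\<^bsub>G\<^esub> x) \<otimes>\<^bsub>G\<^esub> (h \<otimes>\<^bsub>G\<^esub> y) = inv\<^bsub>G\<^esub> x \<otimes>\<^bsub>G\<^esub> y" using xy that(1) by simp
    then show ?thesis using that xy by (simp add: height_order_def)
  qed
  ultimately show ?thesis
    unfolding left_order_def strict_linear_order_on_def total_on_def
    by (auto simp: height_order_def)
qed

end

context trefoil_cover
begin

definition order_of_circular ::
  "(two_gens gword set \<times> two_gens gword set \<times> two_gens gword set \<Rightarrow> int) \<Rightarrow> two_gens gword set \<Rightarrow> int" where
  "order_of_circular c = (\<lambda>x\<in>carrier G - {\<one>\<^bsub>G\<^esub>}. if 0 < height c x then 1 else -1)"

lemma trefoil_circular: "c \<in> CO H \<Longrightarrow> trefoil_circular q c"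
  by (simp add: trefoil_circular_def circularly_ordered_group_def circularly_ordered_group_axioms_def
    modular_group trefoil_cover_axioms)

lemma order_of_circular_LO:
  assumes "c \<in> CO H"
  shows "order_of_circular c \<in> LO G"
proof -
  interpret trefoil_circular q c using assms by (rule trefoil_circular)
  have "order_of_circular c = order_sign G height_order"
    by (auto simp: order_of_circular_def order_sign_def height_order_def fun_eq_iff restrict_def)
  then show ?thesis using left_order_height_order by (auto simp: LO_def)
qed

text \<open>Both heights have the same parity and change by the same amount under multiplication by \<open>t\<close>.  If
they differed at \<open>x\<close>, they would differ by at least \<open>2\<close>, and a power of \<open>t\<close> would move \<open>x\<close> to an element at
which one height is positive and the other is not.\<close>
lemma height_le_if_same_sign:
  assumes c: "c \<in> CO H" "c' \<in> CO H" and x: "x \<in> carrier G"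
    and pos: "\<And>x. x \<in> carrier G \<Longrightarrow> 0 < height c x \<longleftrightarrow> 0 < height c' x"
  shows "height c' x \<le> height c x"
proof -
  interpret c: trefoil_circular q c using c(1) by (rule trefoil_circular)
  interpret c': trefoil_circular q c' using c(2) by (rule trefoil_circular)
  have t: "trefoil_t \<in> carrier G" by simp
  have hand: "handedness c = handedness c'"
    using pos[OF t] c.handedness c'.handedness by (auto simp: c.M_t c'.M_t simp del: T.nat_pow_Suc)
  show "height c' x \<le> height c x"
  proof (rule ccontr)
    assume "\<not> height c' x \<le> height c x"
    moreover have "even (height c x) \<longleftrightarrow> even (height c' x)" using x by (simp add: c.M_even_iff c'.M_even_iff)
    ultimately have gap: "height c x + 2 \<le> height c' x" by presburger
    \<comment> \<open>Multiplication by this power of \<open>t\<close>, up to the handedness, brings the smaller height to \<open>0\<close> or \<open>-1\<close>.\<close>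
    define k where "k = - ((height c x + 1) div 2)"
    have k: "height c x + 2 * k \<in> {0, -1}" unfolding k_def by auto
    let ?y = "x \<otimes>\<^bsub>G\<^esub> trefoil_t [^]\<^bsub>G\<^esub> (k * handedness c)"
    have "2 * (k * handedness c) * handedness c = 2 * k" using c.handedness by auto
    then have "height c ?y = height c x + 2 * k" "height c' ?y = height c' x + 2 * k"
      using c.M_mult_t_pow[OF x, of "k * handedness c"] c'.M_mult_t_pow[OF x, of "k * handedness c"]
      by (simp_all only: hand)
    moreover have "?y \<in> carrier G" by (intro T.m_closed x T.int_pow_closed t)
    ultimately show False using pos[of ?y] gap k by auto
  qed
qed

lemma order_of_circular_inj: "inj_on order_of_circular (CO H)"
proof (rule inj_onI)
  fix c c' assume c: "c \<in> CO H" "c' \<in> CO H" and eq: "order_of_circular c = order_of_circular c'"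
  interpret c: trefoil_circular q c using c(1) by (rule trefoil_circular)
  interpret c': trefoil_circular q c' using c(2) by (rule trefoil_circular)
  have pos: "0 < height c x \<longleftrightarrow> 0 < height c' x" if "x \<in> carrier G" for x
  proof (cases "x = \<one>\<^bsub>G\<^esub>")
    case False
    then show ?thesis using fun_cong[OF eq, of x] that by (auto simp: order_of_circular_def split: if_splits)
  qed simp
  have M: "height c x = height c' x" if "x \<in> carrier G" for x
    using height_le_if_same_sign[OF c that pos] height_le_if_same_sign[OF c(2,1) that pos[symmetric]]
    by (rule antisym[rotated])
  have "c (g1, g2, g3) = c' (g1, g2, g3)" if g: "g1 \<in> carrier H" "g2 \<in> carrier H" "g3 \<in> carrier H" for g1 g2 g3
  proof -
    have lift: "\<exists>x\<in>carrier G. h = q x" if "h \<in> carrier H" for h using that q_onto by blast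
    obtain x1 x2 x3 where "g1 = q x1" "g2 = q x2" "g3 = q x3" "x1 \<in> carrier G" "x2 \<in> carrier G" "x3 \<in> carrier G"
      using lift[OF g(1)] lift[OF g(2)] lift[OF g(3)] by blast
    then show ?thesis by (simp add: c.c_from_M c'.c_from_M M)
  qed
  moreover have "c \<in> extensional (carrier H \<times> carrier H \<times> carrier H)"
    "c' \<in> extensional (carrier H \<times> carrier H \<times> carrier H)"
    using c by (auto simp: CO_def PiE_def)
  ultimately show "c = c'" by (intro extensionalityI) auto
qed

end

section \<open>Existence of dynamical realizations\<close>

text \<open>An idempotent homeomorphism is the identity.\<close>
lemma hom_Homeo_Z_one:
  fixes G (structure)
  assumes "group G" "\<rho> \<in> hom G Homeo_Z"
  shows "\<rho> \<one> = id"
proof -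
  interpret group G by fact
  have "\<rho> \<one> \<in> carrier Homeo_Z" using assms(2) by (auto simp: hom_def)
  then obtain g where "homeomorphism UNIV UNIV (\<rho> \<one>) g" by (auto simp: Homeo_Z_def)
  then have g: "g (\<rho> \<one> y) = y" for y by (simp add: homeomorphism_def)
  have "\<rho> \<one> = \<rho> \<one> \<circ> \<rho> \<one>" using hom_mult[OF assms(2) one_closed one_closed] by (simp add: Homeo_Z_def)
  then have "\<rho> \<one> y = \<rho> \<one> (\<rho> \<one> y)" for y by (metis comp_apply)
  then show ?thesis using g by (metis eq_id_iff)
qed

context trefoil_cover
begin

lemma trefoil_a_nontrivial: "trefoil_a \<noteq> \<one>\<^bsub>G\<^esub>"
  using modular_generators_nontrivial(1) q_a q.hom_one by metis

text \<open>The generators and their inverses are bounded by \<open>z\<close>, and since \<open>z\<close> is central these bounds multiply.\<close>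
lemma trefoil_cofinal_central:
  assumes r: "left_order G r" and z: "(\<one>\<^bsub>G\<^esub>, z) \<in> r" "z = trefoil_t \<or> z = inv\<^bsub>G\<^esub> trefoil_t"
  shows "cofinal_central G r z"
proof -
  interpret left_ordered_group G r
    by (simp add: left_ordered_group_def left_ordered_group_axioms_def trefoil_group r)
  have t: "trefoil_t \<in> carrier G" by (rule T.nat_pow_closed) simp
  have zc: "z \<in> carrier G" using z(2) t by auto
  have central: "z \<otimes>\<^bsub>G\<^esub> x = x \<otimes>\<^bsub>G\<^esub> z" if "x \<in> carrier G" for x
    using z(2) trefoil_t_central[OF that] T.commute_inv[OF that t] that by auto
  have b3: "trefoil_t = trefoil_b [^]\<^bsub>G\<^esub> (3::nat)"
    unfolding trefoil_t_eq_b by (simp add: numeral_3_eq_3)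
  define gens where "gens = {trefoil_a, trefoil_b, inv\<^bsub>G\<^esub> trefoil_a, inv\<^bsub>G\<^esub> trefoil_b}"
  have gens: "(g, z) \<in> r" if "g \<in> gens" for g
    using z(2)
  proof
    assume "z = trefoil_t"
    then have a: "z = trefoil_a [^]\<^bsub>G\<^esub> Suc (Suc 0)" and b: "z = trefoil_b [^]\<^bsub>G\<^esub> Suc (Suc (Suc 0))"
      using b3 by (simp_all only: numeral_2_eq_2 numeral_3_eq_3)
    show ?thesis
      using root_bound[OF trefoil_a_closed z(1)[unfolded a]] root_bound[OF trefoil_b_closed z(1)[unfolded b]] that
      unfolding a[symmetric] b[symmetric] by (auto simp: gens_def)
  next
    assume "z = inv\<^bsub>G\<^esub> trefoil_t"
    then have a: "z = (inv\<^bsub>G\<^esub> trefoil_a) [^]\<^bsub>G\<^esub> Suc (Suc 0)"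
      and b: "z = (inv\<^bsub>G\<^esub> trefoil_b) [^]\<^bsub>G\<^esub> Suc (Suc (Suc 0))"
      using b3 T.nat_pow_inv[OF trefoil_a_closed] T.nat_pow_inv[OF trefoil_b_closed]
      by (simp_all only: numeral_2_eq_2 numeral_3_eq_3)
    show ?thesis
      using root_bound[OF T.inv_closed[OF trefoil_a_closed] z(1)[unfolded a]]
        root_bound[OF T.inv_closed[OF trefoil_b_closed] z(1)[unfolded b]] that
      unfolding a[symmetric] b[symmetric] by (auto simp: gens_def)
  qed
  have cofinal: "\<exists>n::nat. (x, z [^]\<^bsub>G\<^esub> n) \<in> r" if "x \<in> carrier G" for x
  proof -
    have step: "\<exists>n::nat. (g \<otimes>\<^bsub>G\<^esub> x, z [^]\<^bsub>G\<^esub> n) \<in> r"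
      if g: "g \<in> gens" and x: "x \<in> carrier G" "\<exists>n::nat. (x, z [^]\<^bsub>G\<^esub> n) \<in> r" for g x
    proof -
      obtain n :: nat where n: "(x, z [^]\<^bsub>G\<^esub> n) \<in> r" using x by blast
      have gc: "g \<in> carrier G" using g by (auto simp: gens_def)
      have "(g \<otimes>\<^bsub>G\<^esub> x, g \<otimes>\<^bsub>G\<^esub> z [^]\<^bsub>G\<^esub> n) \<in> r" using n gc x zc by (intro less_mult_left) auto
      moreover have "g \<otimes>\<^bsub>G\<^esub> z [^]\<^bsub>G\<^esub> n = z [^]\<^bsub>G\<^esub> n \<otimes>\<^bsub>G\<^esub> g"
        by (rule T.group_commutes_pow[OF central[OF gc] zc gc, symmetric])
      moreover have "(z [^]\<^bsub>G\<^esub> n \<otimes>\<^bsub>G\<^esub> g, z [^]\<^bsub>G\<^esub> n \<otimes>\<^bsub>G\<^esub> z) \<in> r"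
        using gens[OF g] gc zc by (intro less_mult_left) auto
      ultimately have "(g \<otimes>\<^bsub>G\<^esub> x, z [^]\<^bsub>G\<^esub> Suc n) \<in> r" using less_trans by simp
      then show ?thesis by blast
    qed
    show ?thesis
      using that
    proof (induction rule: trefoil_induct)
      case one
      show ?case using z(1) zc by (intro exI[of _ 1]) simp
    qed (rule step; simp add: gens_def)+
  qed
  have "countable (carrier G)"
    unfolding trefoil_group_def by (rule presented_group_countable)
  then show ?thesis
    using zc z(1) central cofinal
    by (intro cofinal_central.intro left_ordered_group_axioms cofinal_central_axioms.intro)
qed

lemma dynamical_realization_exists:
  assumes "l \<in> LO G"
  shows "\<exists>\<rho>. dynamical_realization G trefoil_t x0 l \<rho>"
proof -
  obtain r where r: "left_order G r" and l: "l = order_sign G r" using assms by (auto simp: LO_def)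
  interpret left_ordered_group G r
    by (simp add: left_ordered_group_def left_ordered_group_axioms_def trefoil_group r)
  have less: "order_less G l f g \<longleftrightarrow> (f, g) \<in> r" if "f \<in> carrier G" "g \<in> carrier G" for f g
    using order_less_order_sign[OF trefoil_group r that] l by simp
  have t: "trefoil_t \<in> carrier G" by (rule T.nat_pow_closed) simp
  have "(trefoil_a, \<one>\<^bsub>G\<^esub>) \<in> r \<or> (\<one>\<^bsub>G\<^esub>, trefoil_a) \<in> r"
    using less_total trefoil_a_nontrivial by simp
  then have trich: "(trefoil_t, \<one>\<^bsub>G\<^esub>) \<in> r \<or> (\<one>\<^bsub>G\<^esub>, trefoil_t) \<in> r"
    using pow_pos[of trefoil_a 1] pow_neg[of trefoil_a 1] by (simp only: numeral_2_eq_2 One_nat_def) blast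
  define z where "z = (if (\<one>\<^bsub>G\<^esub>, trefoil_t) \<in> r then trefoil_t else inv\<^bsub>G\<^esub> trefoil_t)"
  have zpos: "(\<one>\<^bsub>G\<^esub>, z) \<in> r"
  proof (cases "(\<one>\<^bsub>G\<^esub>, trefoil_t) \<in> r")
    case False
    then have "(inv\<^bsub>G\<^esub> trefoil_t \<otimes>\<^bsub>G\<^esub> trefoil_t, inv\<^bsub>G\<^esub> trefoil_t \<otimes>\<^bsub>G\<^esub> \<one>\<^bsub>G\<^esub>) \<in> r"
      using trich t by (intro less_mult_left) auto
    then show ?thesis unfolding z_def using False by (simp only: T.l_inv[OF t] T.r_one[OF T.inv_closed[OF t]] if_False)
  qed (simp add: z_def)
  interpret cofinal_central G r z
    using trefoil_cofinal_central[OF r zpos] z_def by argo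
  obtain \<rho> where \<rho>: "\<rho> \<in> hom G Homeo_Z" "tight G \<rho> x0" "\<rho> z = shift"
    "\<And>f g. f \<in> carrier G \<Longrightarrow> g \<in> carrier G \<Longrightarrow> (f, g) \<in> r \<longleftrightarrow> \<rho> f x0 < \<rho> g x0"
    using realization_exists[of x0] by blast
  have "\<rho> trefoil_t = shift" if "(\<one>\<^bsub>G\<^esub>, trefoil_t) \<in> r" using \<rho>(3) that by (simp only: z_def if_True)
  moreover have "\<rho> trefoil_t = shift_inv" if "(trefoil_t, \<one>\<^bsub>G\<^esub>) \<in> r"
  proof -
    have z: "z = inv\<^bsub>G\<^esub> trefoil_t" using less_asym[OF that] by (simp only: z_def if_False)
    have "\<rho> (trefoil_t \<otimes>\<^bsub>G\<^esub> z) = \<rho> trefoil_t \<circ> shift"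
      using hom_mult[OF \<rho>(1) t z_closed] \<rho>(3) by (simp add: Homeo_Z_def)
    moreover have "\<rho> (trefoil_t \<otimes>\<^bsub>G\<^esub> z) = id"
      using hom_Homeo_Z_one[OF trefoil_group \<rho>(1)] T.r_inv[OF t] unfolding z by (simp only:)
    ultimately have "\<rho> trefoil_t (shift y) = y" for y by (metis comp_apply id_apply)
    from this[of "y - 1" for y] show ?thesis by (simp add: shift_def shift_inv_def fun_eq_iff)
  qed
  ultimately show ?thesis
    using \<rho> less t unfolding dynamical_realization_def by (intro exI[of _ \<rho>]) (simp only: T.one_closed, blast)
qed

end

section \<open>The circular order of a dynamical realization\<close>

locale trefoil_realization = trefoil_cover q for q +
  fixes x0 :: real and l :: "two_gens gword set \<Rightarrow> int" and \<rho> :: "two_gens gword set \<Rightarrow> real \<Rightarrow> real"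
  assumes l_LO: "l \<in> LO G" and realization: "dynamical_realization G trefoil_t x0 l \<rho>"
begin

lemma rho_hom: "\<rho> \<in> hom G Homeo_Z"
  using realization by (simp add: dynamical_realization_def)

lemma rho_mult: "x \<in> carrier G \<Longrightarrow> y \<in> carrier G \<Longrightarrow> \<rho> (x \<otimes>\<^bsub>G\<^esub> y) u = \<rho> x (\<rho> y u)"
  using hom_mult[OF rho_hom] by (simp add: Homeo_Z_def)

lemma rho_one: "\<rho> \<one>\<^bsub>G\<^esub> u = u"
  using hom_Homeo_Z_one[OF trefoil_group rho_hom] by simp

lemma less_iff: "x \<in> carrier G \<Longrightarrow> y \<in> carrier G \<Longrightarrow> order_less G l x y \<longleftrightarrow> \<rho> x x0 < \<rho> y x0"
  using realization by (simp add: dynamical_realization_def)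

lemma rho_inj:
  assumes x: "x \<in> carrier G" and y: "y \<in> carrier G" and eq: "\<rho> x x0 = \<rho> y x0"
  shows "x = y"
proof -
  have "\<rho> (inv\<^bsub>G\<^esub> y \<otimes>\<^bsub>G\<^esub> x) x0 = \<rho> (inv\<^bsub>G\<^esub> y \<otimes>\<^bsub>G\<^esub> y) x0"
    using x y eq by (simp only: rho_mult T.inv_closed)
  then have "\<rho> (inv\<^bsub>G\<^esub> y \<otimes>\<^bsub>G\<^esub> x) x0 = x0" using y by (simp add: rho_one)
  then have "inv\<^bsub>G\<^esub> y \<otimes>\<^bsub>G\<^esub> x \<in> stabilizer G \<rho> x0" using x y by (simp add: stabilizer_def)
  then have "inv\<^bsub>G\<^esub> y \<otimes>\<^bsub>G\<^esub> x = \<one>\<^bsub>G\<^esub>" using realization by (simp add: dynamical_realization_def tight_def)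
  then have "inv\<^bsub>G\<^esub> (inv\<^bsub>G\<^esub> x) = inv\<^bsub>G\<^esub> (inv\<^bsub>G\<^esub> y)"
    using x y T.inv_equality by (metis T.inv_closed)
  then show ?thesis using x y by simp
qed

lemma order_less_mult_left:
  assumes "g \<in> carrier G" "x \<in> carrier G" "y \<in> carrier G"
  shows "order_less G l (g \<otimes>\<^bsub>G\<^esub> x) (g \<otimes>\<^bsub>G\<^esub> y) \<longleftrightarrow> order_less G l x y"
proof -
  have "inv\<^bsub>G\<^esub> (g \<otimes>\<^bsub>G\<^esub> x) \<otimes>\<^bsub>G\<^esub> (g \<otimes>\<^bsub>G\<^esub> y) = inv\<^bsub>G\<^esub> x \<otimes>\<^bsub>G\<^esub> (inv\<^bsub>G\<^esub> g \<otimes>\<^bsub>G\<^esub> g) \<otimes>\<^bsub>G\<^esub> y"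
    using assms by (simp only: T.inv_mult_group T.m_assoc T.inv_closed T.m_closed)
  then have "inv\<^bsub>G\<^esub> (g \<otimes>\<^bsub>G\<^esub> x) \<otimes>\<^bsub>G\<^esub> (g \<otimes>\<^bsub>G\<^esub> y) = inv\<^bsub>G\<^esub> x \<otimes>\<^bsub>G\<^esub> y" using assms by simp
  then show ?thesis using assms by (simp add: order_less_def)
qed

lemma rho_t: "\<exists>s\<in>{1, -1}. \<forall>u. \<rho> trefoil_t u = u + of_int s"
proof -
  have t: "trefoil_t \<in> carrier G" by (rule T.nat_pow_closed) simp
  have "trefoil_t \<noteq> \<one>\<^bsub>G\<^esub>"
  proof
    assume t1: "trefoil_t = \<one>\<^bsub>G\<^esub>"
    have "order_less G l \<one>\<^bsub>G\<^esub> trefoil_a \<longleftrightarrow> order_less G l trefoil_a \<one>\<^bsub>G\<^esub>"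
      using order_less_mult_left[of trefoil_a "\<one>\<^bsub>G\<^esub>" trefoil_a] t1 by (simp add: trefoil_t_eq_a)
    then have "\<rho> \<one>\<^bsub>G\<^esub> x0 < \<rho> trefoil_a x0 \<longleftrightarrow> \<rho> trefoil_a x0 < \<rho> \<one>\<^bsub>G\<^esub> x0"
      by (simp only: less_iff trefoil_a_closed T.one_closed)
    then have "\<rho> trefoil_a x0 = \<rho> \<one>\<^bsub>G\<^esub> x0" by linarith
    then show False using rho_inj trefoil_a_nontrivial by simp
  qed
  then have "\<rho> trefoil_t x0 \<noteq> \<rho> \<one>\<^bsub>G\<^esub> x0" using rho_inj t by blast
  then have "order_less G l \<one>\<^bsub>G\<^esub> trefoil_t \<or> order_less G l trefoil_t \<one>\<^bsub>G\<^esub>"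
    using less_iff[OF t T.one_closed] less_iff[OF T.one_closed t] by linarith
  then have "\<rho> trefoil_t = shift \<or> \<rho> trefoil_t = shift_inv"
    using realization unfolding dynamical_realization_def by blast
  then show ?thesis by (auto simp: shift_def shift_inv_def)
qed

definition t_sign :: int where
  "t_sign = (SOME t_sign. t_sign \<in> {1, -1} \<and> (\<forall>u. \<rho> trefoil_t u = u + of_int t_sign))"

lemma t_sign: "t_sign = 1 \<or> t_sign = -1" "\<rho> trefoil_t u = u + of_int t_sign"
proof -
  have "t_sign \<in> {1, -1} \<and> (\<forall>u. \<rho> trefoil_t u = u + of_int t_sign)"
    unfolding t_sign_def by (rule someI_ex) (use rho_t in blast)
  then show "t_sign = 1 \<or> t_sign = -1" "\<rho> trefoil_t u = u + of_int t_sign" by auto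
qed

lemma rho_t_pow: "\<rho> (trefoil_t [^]\<^bsub>G\<^esub> (k::int)) u = u + of_int (t_sign * k)"
proof -
  have t: "trefoil_t \<in> carrier G" by (rule T.nat_pow_closed) simp
  have step: "\<rho> (trefoil_t [^]\<^bsub>G\<^esub> (i + 1)) u = \<rho> (trefoil_t [^]\<^bsub>G\<^esub> i) u + of_int t_sign" for i :: int
  proof -
    have "trefoil_t [^]\<^bsub>G\<^esub> (i + 1) = trefoil_t \<otimes>\<^bsub>G\<^esub> trefoil_t [^]\<^bsub>G\<^esub> i"
      using T.int_pow_mult[OF t, of 1 i] by (simp only: T.int_pow_1[OF t] add.commute)
    then show ?thesis by (simp only: rho_mult[OF t T.int_pow_closed[OF t]] t_sign(2))
  qed
  show ?thesis
  proof (induction k rule: int_induct[of _ 0])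
    case base
    show ?case by (simp add: rho_one)
  next
    case (step1 i)
    then show ?case using step[of i] by (simp add: algebra_simps)
  next
    case (step2 i)
    then show ?case using step[of "i - 1"] by (simp add: algebra_simps)
  qed
qed

lemma rho_mult_t_pow:
  assumes "x \<in> carrier G"
  shows "\<rho> (x \<otimes>\<^bsub>G\<^esub> trefoil_t [^]\<^bsub>G\<^esub> (k::int)) u = \<rho> x u + of_int (t_sign * k)"
proof -
  have t: "trefoil_t \<in> carrier G" by (rule T.nat_pow_closed) simp
  have "x \<otimes>\<^bsub>G\<^esub> trefoil_t [^]\<^bsub>G\<^esub> k = trefoil_t [^]\<^bsub>G\<^esub> k \<otimes>\<^bsub>G\<^esub> x"
    by (rule T.commute_int_pow[OF t assms trefoil_t_central[OF assms], symmetric])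
  then show ?thesis by (simp only: rho_mult[OF T.int_pow_closed[OF t] assms] rho_t_pow)
qed

lemma rho_add_int:
  assumes "x \<in> carrier G"
  shows "\<exists>k. \<rho> x x0 + of_int n = \<rho> (x \<otimes>\<^bsub>G\<^esub> trefoil_t [^]\<^bsub>G\<^esub> (k::int)) x0"
proof -
  have "t_sign * (t_sign * n) = n" using t_sign(1) by auto
  then show ?thesis by (intro exI[of _ "t_sign * n"]) (simp only: rho_mult_t_pow[OF assms])
qed

definition turns :: "two_gens gword set \<Rightarrow> two_gens gword set \<Rightarrow> int" where
  "turns x y = signed_turns (\<rho> y x0 - \<rho> x x0)"

text \<open>The number of turns only depends on how \<open>\<rho> y x0\<close> compares with the integer translates of \<open>\<rho> x x0\<close>.
These translates lie in the orbit, so the comparison is a statement about the left invariant order.\<close>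
lemma turns_mult_left:
  assumes g: "g \<in> carrier G" and x: "x \<in> carrier G" and y: "y \<in> carrier G"
  shows "turns (g \<otimes>\<^bsub>G\<^esub> x) (g \<otimes>\<^bsub>G\<^esub> y) = turns x y"
  unfolding turns_def
proof (rule signed_turns_cong)
  fix n :: int
  have t: "trefoil_t \<in> carrier G" by (rule T.nat_pow_closed) simp
  define w where "w = trefoil_t [^]\<^bsub>G\<^esub> (t_sign * n)"
  have w: "w \<in> carrier G" unfolding w_def by (rule T.int_pow_closed[OF t])
  have add: "\<rho> v x0 + of_int n = \<rho> (v \<otimes>\<^bsub>G\<^esub> w) x0" if "v \<in> carrier G" for v
  proof -
    have "t_sign * (t_sign * n) = n" using t_sign(1) by auto
    then show ?thesis unfolding w_def by (simp only: rho_mult_t_pow[OF that])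
  qed
  have assoc: "g \<otimes>\<^bsub>G\<^esub> x \<otimes>\<^bsub>G\<^esub> w = g \<otimes>\<^bsub>G\<^esub> (x \<otimes>\<^bsub>G\<^esub> w)" using g x w by (rule T.m_assoc)
  have "\<rho> (g \<otimes>\<^bsub>G\<^esub> x) x0 + of_int n < \<rho> (g \<otimes>\<^bsub>G\<^esub> y) x0 \<longleftrightarrow> \<rho> x x0 + of_int n < \<rho> y x0"
    using order_less_mult_left[OF g T.m_closed[OF x w] y]
      less_iff[OF T.m_closed[OF g T.m_closed[OF x w]] T.m_closed[OF g y]] less_iff[OF T.m_closed[OF x w] y]
    by (simp only: add[OF T.m_closed[OF g x]] add[OF x] assoc)
  then show "of_int n < \<rho> (g \<otimes>\<^bsub>G\<^esub> y) x0 - \<rho> (g \<otimes>\<^bsub>G\<^esub> x) x0 \<longleftrightarrow> of_int n < \<rho> y x0 - \<rho> x x0"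
    by linarith
  have "\<rho> (g \<otimes>\<^bsub>G\<^esub> y) x0 < \<rho> (g \<otimes>\<^bsub>G\<^esub> x) x0 + of_int n \<longleftrightarrow> \<rho> y x0 < \<rho> x x0 + of_int n"
    using order_less_mult_left[OF g y T.m_closed[OF x w]]
      less_iff[OF T.m_closed[OF g y] T.m_closed[OF g T.m_closed[OF x w]]] less_iff[OF y T.m_closed[OF x w]]
    by (simp only: add[OF T.m_closed[OF g x]] add[OF x] assoc)
  then show "\<rho> (g \<otimes>\<^bsub>G\<^esub> y) x0 - \<rho> (g \<otimes>\<^bsub>G\<^esub> x) x0 < of_int n \<longleftrightarrow> \<rho> y x0 - \<rho> x x0 < of_int n"
    by linarith
qed

lemma turns_swap: "turns y x = - turns x y"
  unfolding turns_def using signed_turns_minus[of "\<rho> y x0 - \<rho> x x0"] by simp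

abbreviation point where "point h \<equiv> pushforward_action G q \<rho> h (circle_proj x0)"

lemma point_eq:
  assumes x: "x \<in> carrier G"
  shows "point (q x) = circle_proj (\<rho> x x0)"
proof -
  define y where "y = (SOME g. g \<in> carrier G \<and> q g = q x)"
  have y: "y \<in> carrier G \<and> q y = q x" unfolding y_def by (rule someI[of _ x]) (simp add: x)
  then obtain k :: int where "y = x \<otimes>\<^bsub>G\<^esub> trefoil_t [^]\<^bsub>G\<^esub> k" using q_eq_imp x by blast
  then have "\<rho> y x0 = \<rho> x x0 + of_int (t_sign * k)" by (simp only: rho_mult_t_pow[OF x])
  then have "circle_proj (\<rho> x x0) = circle_proj (\<rho> y x0)" unfolding circle_proj_eq_iff by blast
  moreover have "\<rho> y \<in> carrier Homeo_Z" using y rho_hom by (auto simp: hom_def)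
  ultimately show ?thesis
    by (simp add: pushforward_action_def y_def[symmetric] circle_induced_circle_proj)
qed

lemma circle_proj_rho_eq_iff:
  assumes x: "x \<in> carrier G" and y: "y \<in> carrier G"
  shows "circle_proj (\<rho> x x0) = circle_proj (\<rho> y x0) \<longleftrightarrow> q x = q y"
proof
  assume "q x = q y"
  then show "circle_proj (\<rho> x x0) = circle_proj (\<rho> y x0)" using point_eq x y by metis
next
  have t: "trefoil_t \<in> carrier G" by (rule T.nat_pow_closed) simp
  assume "circle_proj (\<rho> x x0) = circle_proj (\<rho> y x0)"
  then obtain n :: int where "\<rho> y x0 = \<rho> x x0 + of_int n" by (auto simp: circle_proj_eq_iff)
  then obtain k :: int where "\<rho> y x0 = \<rho> (x \<otimes>\<^bsub>G\<^esub> trefoil_t [^]\<^bsub>G\<^esub> k) x0" using rho_add_int[OF x] by metis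
  then have yk: "y = x \<otimes>\<^bsub>G\<^esub> trefoil_t [^]\<^bsub>G\<^esub> k" by (intro rho_inj y T.m_closed x T.int_pow_closed t)
  have "q (trefoil_t [^]\<^bsub>G\<^esub> k) = \<one>\<^bsub>H\<^esub>"
    using q.hom_int_pow[OF t, of k] unfolding q_t by simp
  then show "q x = q y" unfolding yk using x q.hom_mult[OF x T.int_pow_closed[OF t]] by simp
qed

definition orbit_order :: "two_gens gword set \<times> two_gens gword set \<times> two_gens gword set \<Rightarrow> int" where
  "orbit_order = (\<lambda>(h1, h2, h3) \<in> carrier H \<times> carrier H \<times> carrier H.
     circle_orientation (point h1) (point h2) (point h3))"

lemma orbit_order_turns:
  assumes "x \<in> carrier G" "y \<in> carrier G" "w \<in> carrier G"
  shows "orbit_order (q x, q y, q w) = turns x y + turns y w + turns w x"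
  using assms by (simp add: orbit_order_def point_eq circle_orientation_signed_turns turns_def)

lemma orbit_order_eq_0_iff:
  assumes "x \<in> carrier G" "y \<in> carrier G" "w \<in> carrier G"
  shows "orbit_order (q x, q y, q w) = 0 \<longleftrightarrow> q x = q y \<or> q y = q w \<or> q x = q w"
  using assms by (simp add: orbit_order_def point_eq circle_orientation_eq_0_iff circle_proj_rho_eq_iff)

lemma orbit_order_CO: "orbit_order \<in> CO H"
proof -
  have lift: "\<exists>x\<in>carrier G. h = q x" if "h \<in> carrier H" for h using that q_onto by blast
  have range: "orbit_order \<in> carrier H \<times> carrier H \<times> carrier H \<rightarrow>\<^sub>E {0, 1, -1}"
    unfolding orbit_order_def restrict_PiE by (simp add: Pi_iff circle_orientation_def)
  have zero: "orbit_order (g1, g2, g3) = 0 \<longleftrightarrow> g1 = g2 \<or> g2 = g3 \<or> g1 = g3"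
    if g: "g1 \<in> carrier H" "g2 \<in> carrier H" "g3 \<in> carrier H" for g1 g2 g3
    using lift[OF g(1)] lift[OF g(2)] lift[OF g(3)] orbit_order_eq_0_iff by metis
  have cocycle: "orbit_order (g2, g3, g4) - orbit_order (g1, g3, g4) + orbit_order (g1, g2, g4) - orbit_order (g1, g2, g3) = 0"
    if g: "g1 \<in> carrier H" "g2 \<in> carrier H" "g3 \<in> carrier H" "g4 \<in> carrier H" for g1 g2 g3 g4
  proof -
    obtain x1 x2 x3 x4 where x: "g1 = q x1" "g2 = q x2" "g3 = q x3" "g4 = q x4" "x1 \<in> carrier G"
      "x2 \<in> carrier G" "x3 \<in> carrier G" "x4 \<in> carrier G"
      using lift[OF g(1)] lift[OF g(2)] lift[OF g(3)] lift[OF g(4)] by blast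
    show ?thesis
      using x(5-8) turns_swap[of x3 x1] turns_swap[of x4 x1] turns_swap[of x4 x2]
      by (simp add: x(1-4) orbit_order_turns)
  qed
  have invariant: "orbit_order (g4 \<otimes>\<^bsub>H\<^esub> g1, g4 \<otimes>\<^bsub>H\<^esub> g2, g4 \<otimes>\<^bsub>H\<^esub> g3) = orbit_order (g1, g2, g3)"
    if g: "g1 \<in> carrier H" "g2 \<in> carrier H" "g3 \<in> carrier H" "g4 \<in> carrier H" for g1 g2 g3 g4
  proof -
    obtain x1 x2 x3 x4 where x: "g1 = q x1" "g2 = q x2" "g3 = q x3" "g4 = q x4" "x1 \<in> carrier G"
      "x2 \<in> carrier G" "x3 \<in> carrier G" "x4 \<in> carrier G"
      using lift[OF g(1)] lift[OF g(2)] lift[OF g(3)] lift[OF g(4)] by blast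
    show ?thesis
      using x(5-8) orbit_order_turns[of "x4 \<otimes>\<^bsub>G\<^esub> x1" "x4 \<otimes>\<^bsub>G\<^esub> x2" "x4 \<otimes>\<^bsub>G\<^esub> x3"]
      by (simp add: x(1-4) orbit_order_turns turns_mult_left)
  qed
  show ?thesis
    unfolding CO_def by (intro CollectI conjI ballI range zero cocycle invariant)
qed

text \<open>The translation amount of \<open>\<rho> x\<close> at \<open>x0\<close>, measured in signed turns, is the height of the orbit order.  The
values at \<open>a\<close> and \<open>b\<close> follow from \<open>t = a\<^sup>2 = b\<^sup>3\<close>: the defect at \<open>\<alpha>\<close> vanishes, and \<open>3\<close> divides
\<open>2 s + c\<close> with \<open>s = \<plusminus> 1\<close> and \<open>\<bar>c\<bar> \<le> 1\<close> only if \<open>c = s\<close>.\<close>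
lemma orbit_order_height: "is_height orbit_order (turns \<one>\<^bsub>G\<^esub>)"
proof -
  let ?M = "turns \<one>\<^bsub>G\<^esub>"
  have mult: "?M (x \<otimes>\<^bsub>G\<^esub> y) = ?M x + ?M y - orbit_order (\<one>\<^bsub>H\<^esub>, q x, q (x \<otimes>\<^bsub>G\<^esub> y))"
    if xy: "x \<in> carrier G" "y \<in> carrier G" for x y
    using orbit_order_turns[of "\<one>\<^bsub>G\<^esub>" x "x \<otimes>\<^bsub>G\<^esub> y"] turns_mult_left[of x "\<one>\<^bsub>G\<^esub>" y]
      turns_swap[of "\<one>\<^bsub>G\<^esub>" "x \<otimes>\<^bsub>G\<^esub> y"] xy by simp
  interpret circularly_ordered_group H orbit_order
    by (simp add: circularly_ordered_group_def circularly_ordered_group_axioms_def modular_group orbit_order_CO)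
  have t: "?M trefoil_t = 2 * t_sign"
    using signed_turns_add_int[of 0 t_sign] by (simp only: turns_def t_sign(2) rho_one) simp
  have a: "?M trefoil_t = 2 * ?M trefoil_a"
    unfolding trefoil_t_eq_a using mult[of trefoil_a trefoil_a] modular_relations(1)
    by (simp add: q_a c_eq_0_iff)
  have "?M trefoil_t = ?M (trefoil_b \<otimes>\<^bsub>G\<^esub> trefoil_b) + ?M trefoil_b"
    unfolding trefoil_t_eq_b using mult[of "trefoil_b \<otimes>\<^bsub>G\<^esub> trefoil_b" trefoil_b] modular_relations(2)
    by (simp add: q_b c_eq_0_iff)
  moreover have "?M (trefoil_b \<otimes>\<^bsub>G\<^esub> trefoil_b) = 2 * ?M trefoil_b - handedness orbit_order"
    using mult[of trefoil_b trefoil_b] by (simp add: q_b)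
  ultimately have "2 * t_sign + handedness orbit_order = 3 * ?M trefoil_b" using t by simp
  moreover have "handedness orbit_order \<in> {0, 1, -1}" by (rule c_range) auto
  ultimately have "handedness orbit_order = t_sign \<and> ?M trefoil_b = t_sign" using t_sign(1) by auto presburger+
  then show ?thesis unfolding is_height_def using mult a t by simp
qed

text \<open>An element is positive exactly if it moves \<open>x0\<close> to the right, that is, if its height is positive.\<close>
lemma order_of_orbit_order: "order_of_circular orbit_order = l"
proof -
  interpret c: trefoil_circular q orbit_order by (rule trefoil_circular[OF orbit_order_CO])
  obtain r where r: "l = order_sign G r" using l_LO by (auto simp: LO_def)
  show ?thesis
  proof
    fix x
    show "order_of_circular orbit_order x = l x"
    proof (cases "x \<in> carrier G - {\<one>\<^bsub>G\<^esub>}")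
      case False
      then show ?thesis unfolding order_of_circular_def r order_sign_def restrict_def by (simp only: if_False)
    next
      case True
      then have x: "x \<in> carrier G" "x \<noteq> \<one>\<^bsub>G\<^esub>" by auto
      have "height orbit_order x = turns \<one>\<^bsub>G\<^esub> x"
        by (rule is_height_unique[OF c.is_height orbit_order_height x(1)])
      then have "0 < height orbit_order x \<longleftrightarrow> order_less G l \<one>\<^bsub>G\<^esub> x"
        using x by (simp add: turns_def signed_turns_pos_iff less_iff)
      also have "\<dots> \<longleftrightarrow> l x = 1" using x by (simp add: order_less_def)
      finally show ?thesis using True by (auto simp: order_of_circular_def r order_sign_def)
    qed
  qed
qed

end

context trefoil_cover
begin

lemma induced_circular_order:
  assumes "l \<in> LO G"
  shows "induced_circular_order G H q trefoil_t x0 l \<in> CO H"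
    and "order_of_circular (induced_circular_order G H q trefoil_t x0 l) = l"
proof -
  define \<rho> where "\<rho> = (SOME \<rho>. dynamical_realization G trefoil_t x0 l \<rho>)"
  have "dynamical_realization G trefoil_t x0 l \<rho>"
    unfolding \<rho>_def by (rule someI_ex[OF dynamical_realization_exists[OF assms]])
  then interpret trefoil_realization q x0 l \<rho>
    using assms by (simp add: trefoil_realization_def trefoil_realization_axioms_def trefoil_cover_axioms)
  have "induced_circular_order G H q trefoil_t x0 l = orbit_order"
    by (simp only: induced_circular_order_def orbit_order_def \<rho>_def[symmetric] Let_def)
  then show "induced_circular_order G H q trefoil_t x0 l \<in> CO H"
    and "order_of_circular (induced_circular_order G H q trefoil_t x0 l) = l"
    using orbit_order_CO order_of_orbit_order by simp_all
qed

end

section \<open>Topology\<close>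

text \<open>Prescribing finitely many coordinates is an open condition in a product of discrete spaces.\<close>
lemma openin_product_discrete_local:
  assumes T: "T \<subseteq> I \<rightarrow>\<^sub>E A" and U: "U \<subseteq> T"
    and local: "\<And>f. f \<in> U \<Longrightarrow> \<exists>F. finite F \<and> F \<subseteq> I \<and> (\<forall>g\<in>T. (\<forall>i\<in>F. g i = f i) \<longrightarrow> g \<in> U)"
  shows "openin (subtopology (product_topology (\<lambda>_. discrete_topology A) I) T) U"
proof (rule openin_subopen[THEN iffD2], intro ballI)
  fix f assume f: "f \<in> U"
  obtain F where F: "finite F" "F \<subseteq> I" "\<forall>g\<in>T. (\<forall>i\<in>F. g i = f i) \<longrightarrow> g \<in> U"
    using local[OF f] by (elim exE conjE)
  let ?B = "\<lambda>i. if i \<in> F then {f i} else A"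
  have fA: "f \<in> I \<rightarrow>\<^sub>E A" using f U T by blast
  have "openin (product_topology (\<lambda>_. discrete_topology A) I) (\<Pi>\<^sub>E i\<in>I. ?B i)"
  proof (rule product_topology_basis)
    show "openin (discrete_topology A) (?B i)" for i
      using fA F(2) by (auto simp: PiE_iff)
    show "finite {i. ?B i \<noteq> topspace (discrete_topology A)}"
      by (rule finite_subset[OF _ F(1)]) auto
  qed
  then have "openin (subtopology (product_topology (\<lambda>_. discrete_topology A) I) T) ((\<Pi>\<^sub>E i\<in>I. ?B i) \<inter> T)"
    by (auto simp: openin_subtopology)
  moreover have "f \<in> (\<Pi>\<^sub>E i\<in>I. ?B i) \<inter> T" using f U fA by (auto simp: PiE_iff)
  moreover have "(\<Pi>\<^sub>E i\<in>I. ?B i) \<inter> T \<subseteq> U"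
  proof
    fix g assume g: "g \<in> (\<Pi>\<^sub>E i\<in>I. ?B i) \<inter> T"
    then have "g i = f i" if "i \<in> F" for i using that F(2) by (auto simp: PiE_iff subset_iff split: if_splits)
    then show "g \<in> U" using F(3) g by blast
  qed
  ultimately show "\<exists>V. openin (subtopology (product_topology (\<lambda>_. discrete_topology A) I) T) V \<and> f \<in> V \<and> V \<subseteq> U"
    by blast
qed

lemma CO_subset: "CO H \<subseteq> (carrier H \<times> carrier H \<times> carrier H) \<rightarrow>\<^sub>E {0, 1, -1}"
  by (auto simp: CO_def)

lemma CO_circularly_ordered: "group H \<Longrightarrow> c \<in> CO H \<Longrightarrow> circularly_ordered_group H c"
  by (simp add: circularly_ordered_group_def circularly_ordered_group_axioms_def)

text \<open>Each violation of an axiom of circular orders is visible on at most four coordinates, so the circular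
orders form a closed subset of a product of finite discrete spaces.\<close>
lemma compact_CO_topology:
  fixes H (structure)
  assumes "group H"
  shows "compact_space (CO_topology H)"
proof -
  interpret group H by fact
  let ?I = "carrier H \<times> carrier H \<times> carrier H"
  let ?P = "product_topology (\<lambda>_. discrete_topology {0, 1, -1 :: int}) ?I"
  have top: "topspace ?P = ?I \<rightarrow>\<^sub>E {0, 1, -1}" by simp
  have "openin (subtopology ?P (topspace ?P)) (topspace ?P - CO H)"
    unfolding top
  proof (rule openin_product_discrete_local)
    fix f assume f: "f \<in> (?I \<rightarrow>\<^sub>E {0, 1, -1}) - CO H"
    let ?zero = "\<forall>g1\<in>carrier H. \<forall>g2\<in>carrier H. \<forall>g3\<in>carrier H.
        f (g1, g2, g3) = 0 \<longleftrightarrow> g1 = g2 \<or> g2 = g3 \<or> g1 = g3"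
    let ?cocycle = "\<forall>g1\<in>carrier H. \<forall>g2\<in>carrier H. \<forall>g3\<in>carrier H. \<forall>g4\<in>carrier H.
        f (g2, g3, g4) - f (g1, g3, g4) + f (g1, g2, g4) - f (g1, g2, g3) = 0"
    let ?invariant = "\<forall>g1\<in>carrier H. \<forall>g2\<in>carrier H. \<forall>g3\<in>carrier H. \<forall>g4\<in>carrier H.
        f (g4 \<otimes> g1, g4 \<otimes> g2, g4 \<otimes> g3) = f (g1, g2, g3)"
    have "f \<in> CO H \<longleftrightarrow> f \<in> ?I \<rightarrow>\<^sub>E {0, 1, -1} \<and> ?zero \<and> ?cocycle \<and> ?invariant"
      by (simp only: CO_def mem_Collect_eq)
    moreover have fA: "f \<in> ?I \<rightarrow>\<^sub>E {0, 1, -1}" and "f \<notin> CO H" using f by simp_all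
    ultimately consider "\<not> ?zero" | "\<not> ?cocycle" | "\<not> ?invariant" by satx
    then show "\<exists>F. finite F \<and> F \<subseteq> ?I \<and>
      (\<forall>g\<in>?I \<rightarrow>\<^sub>E {0, 1, -1}. (\<forall>i\<in>F. g i = f i) \<longrightarrow> g \<in> (?I \<rightarrow>\<^sub>E {0, 1, -1}) - CO H)"
    proof cases
      case 1
      then obtain g1 g2 g3 where 1: "g1 \<in> carrier H" "g2 \<in> carrier H" "g3 \<in> carrier H"
        "\<not> (f (g1, g2, g3) = 0 \<longleftrightarrow> g1 = g2 \<or> g2 = g3 \<or> g1 = g3)" by blast
      then have "g \<notin> CO H" if "g (g1, g2, g3) = f (g1, g2, g3)" for g
        using that circularly_ordered_group.c_eq_0_iff[OF CO_circularly_ordered[OF assms]] by metis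
      then show ?thesis using 1 by (intro exI[of _ "{(g1, g2, g3)}"]) auto
    next
      case 2
      then obtain g1 g2 g3 g4 where 2: "g1 \<in> carrier H" "g2 \<in> carrier H" "g3 \<in> carrier H"
        "g4 \<in> carrier H"
        "f (g2, g3, g4) - f (g1, g3, g4) + f (g1, g2, g4) - f (g1, g2, g3) \<noteq> 0" by blast
      let ?F = "{(g2, g3, g4), (g1, g3, g4), (g1, g2, g4), (g1, g2, g3)}"
      have "g \<notin> CO H" if "\<forall>i\<in>?F. g i = f i" for g
      proof
        assume "g \<in> CO H"
        then have "g (g2, g3, g4) - g (g1, g3, g4) + g (g1, g2, g4) - g (g1, g2, g3) = 0"
          by (intro circularly_ordered_group.c_cocycle[OF CO_circularly_ordered[OF assms]] 2)
        then show False using that 2 by simp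
      qed
      then show ?thesis using 2 by (intro exI[of _ ?F]) auto
    next
      case 3
      then obtain g1 g2 g3 g4 where 3: "g1 \<in> carrier H" "g2 \<in> carrier H" "g3 \<in> carrier H"
        "g4 \<in> carrier H" "f (g4 \<otimes> g1, g4 \<otimes> g2, g4 \<otimes> g3) \<noteq> f (g1, g2, g3)" by blast
      let ?F = "{(g4 \<otimes> g1, g4 \<otimes> g2, g4 \<otimes> g3), (g1, g2, g3)}"
      have "g \<notin> CO H" if "\<forall>i\<in>?F. g i = f i" for g
      proof
        assume "g \<in> CO H"
        then have "g (g4 \<otimes> g1, g4 \<otimes> g2, g4 \<otimes> g3) = g (g1, g2, g3)"
          by (intro circularly_ordered_group.c_mult_left[OF CO_circularly_ordered[OF assms]] 3)
        then show False using that 3 by simp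
      qed
      then show ?thesis using 3 by (intro exI[of _ ?F]) auto
    qed
  qed auto
  then have "openin ?P (topspace ?P - CO H)" by (simp only: subtopology_topspace)
  then have "closedin ?P (CO H)"
    unfolding closedin_def top using CO_subset[of H] by blast
  moreover have "compact_space ?P"
    by (auto simp: compact_space_product_topology compact_space_discrete_topology)
  ultimately show ?thesis
    unfolding CO_topology_def by (intro compact_space_subtopology closedin_compact_space)
qed

lemma Hausdorff_LO_topology: "Hausdorff_space (LO_topology G)"
  unfolding LO_topology_def
  by (intro Hausdorff_space_subtopology) (simp add: Hausdorff_space_product_topology)

lemma topspace_CO_topology: "topspace (CO_topology H) = CO H"
  using CO_subset[of H] by (auto simp: CO_topology_def)

lemma topspace_LO_topology:
  fixes G (structure)
  shows "topspace (LO_topology G) = LO G"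
proof -
  have "LO G \<subseteq> (carrier G - {\<one>}) \<rightarrow>\<^sub>E {1, -1}"
    unfolding LO_def order_sign_def by (intro image_subsetI) (simp only: restrict_PiE, simp)
  then show ?thesis by (auto simp: LO_topology_def)
qed

context trefoil_cover
begin

lemma order_of_circular_continuous:
  "continuous_map (CO_topology H) (LO_topology G) order_of_circular"
proof -
  let ?D = "carrier G - {\<one>\<^bsub>G\<^esub>}"
  let ?I = "carrier H \<times> carrier H \<times> carrier H"
  have "continuous_map (CO_topology H) (discrete_topology {1, -1}) (\<lambda>c. order_of_circular c x)"
    if x: "x \<in> ?D" for x
    unfolding continuous_map_def
  proof (intro conjI allI impI)
    show "(\<lambda>c. order_of_circular c x) \<in> topspace (CO_topology H) \<rightarrow> topspace (discrete_topology {1, -1})"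
      using x by (auto simp: order_of_circular_def)
    fix U :: "int set"
    obtain F where F: "finite F" "F \<subseteq> ?I"
      "\<forall>c c' M M'. is_height c M \<longrightarrow> is_height c' M' \<longrightarrow> (\<forall>i\<in>F. c i = c' i) \<longrightarrow> M x = M' x"
      using height_local[of x] x by auto
    show "openin (CO_topology H) {c \<in> topspace (CO_topology H). order_of_circular c x \<in> U}"
      unfolding topspace_CO_topology unfolding CO_topology_def
    proof (rule openin_product_discrete_local[OF CO_subset])
      fix c assume c: "c \<in> {c \<in> CO H. order_of_circular c x \<in> U}"
      have "c' \<in> {c \<in> CO H. order_of_circular c x \<in> U}" if c': "c' \<in> CO H" "\<forall>i\<in>F. c' i = c i" for c'
      proof -
        interpret c: trefoil_circular q c using c by (intro trefoil_circular) simp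
        interpret c': trefoil_circular q c' using c' by (intro trefoil_circular) simp
        have "height c' x = height c x" using F(3) c.is_height c'.is_height c'(2) by blast
        then show ?thesis using c c' x by (simp add: order_of_circular_def)
      qed
      then show "\<exists>F. finite F \<and> F \<subseteq> ?I \<and>
          (\<forall>c'\<in>CO H. (\<forall>i\<in>F. c' i = c i) \<longrightarrow> c' \<in> {c \<in> CO H. order_of_circular c x \<in> U})"
        using F(1,2) by blast
    qed auto
  qed
  then show ?thesis
    unfolding LO_topology_def continuous_map_in_subtopology continuous_map_componentwise
    using order_of_circular_LO by (auto simp: topspace_CO_topology order_of_circular_def)
qed

text \<open>Surjectivity comes from realizations: every left order is recovered from the circular order of its
realization.\<close>
lemma order_of_circular_homeomorphic: "homeomorphic_map (CO_topology H) (LO_topology G) order_of_circular"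
proof (rule continuous_imp_homeomorphic_map)
  show "compact_space (CO_topology H)" by (rule compact_CO_topology[OF modular_group])
  show "Hausdorff_space (LO_topology G)" by (rule Hausdorff_LO_topology)
  show "continuous_map (CO_topology H) (LO_topology G) order_of_circular"
    by (rule order_of_circular_continuous)
  show "order_of_circular ` topspace (CO_topology H) = topspace (LO_topology G)"
  proof
    show "topspace (LO_topology G) \<subseteq> order_of_circular ` topspace (CO_topology H)"
    proof
      fix l assume "l \<in> topspace (LO_topology G)"
      then have "l \<in> LO G" by (simp add: topspace_LO_topology)
      from induced_circular_order[OF this, of 0] show "l \<in> order_of_circular ` topspace (CO_topology H)"
        unfolding topspace_CO_topology by (metis image_eqI)
    qed
  qed (auto simp: topspace_CO_topology topspace_LO_topology order_of_circular_LO)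
  show "inj_on order_of_circular (topspace (CO_topology H))"
    unfolding topspace_CO_topology by (rule order_of_circular_inj)
qed

end

theorem theorem4:
  fixes q :: "two_gens gword set \<Rightarrow> two_gens gword set"
    and x0 :: real
  assumes "q \<in> epi trefoil_group modular_group"
    and "q trefoil_a = modular_\<alpha>"
    and "q trefoil_b = modular_\<beta>"
  shows "homeomorphic_map (LO_topology trefoil_group) (CO_topology modular_group)
           (induced_circular_order trefoil_group modular_group q
              (trefoil_a [^]\<^bsub>trefoil_group\<^esub> (2::nat)) x0)"
proof -
  interpret trefoil_cover q using assms by unfold_locales
  let ?\<Phi> = "induced_circular_order trefoil_group modular_group q trefoil_t x0"
  obtain g where g: "homeomorphic_maps (CO_topology modular_group) (LO_topology trefoil_group) order_of_circular g"
    using order_of_circular_homeomorphic homeomorphic_map_maps by blast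
  then have "homeomorphic_map (LO_topology trefoil_group) (CO_topology modular_group) g"
    using homeomorphic_maps_map homeomorphic_maps_sym by blast
  moreover have "g l = ?\<Phi> l" if "l \<in> topspace (LO_topology trefoil_group)" for l
  proof -
    have l: "l \<in> LO trefoil_group" using that by (simp add: topspace_LO_topology)
    have "g (order_of_circular (?\<Phi> l)) = ?\<Phi> l"
      using g induced_circular_order(1)[OF l, of x0] by (simp add: homeomorphic_maps_def topspace_CO_topology)
    then show ?thesis using induced_circular_order(2)[OF l, of x0] by simp
  qed
  ultimately show ?thesis by (rule homeomorphic_map_eq)
qed

end
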